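(* Let $\mu_0=\mathcal N(m_0,C_0)$, $\mu_1=\mathcal N(m_1,C_1)$ be Gaussian measures on $\mathcal H$. For each fixed $\epsilon>0$, $$\mathrm{OT}^\epsilon_{d^2}(\mu_0,\mu_1)=\|m_0-m_1\|^2+\mathrm{Tr}(C_0)+\mathrm{Tr}(C_1)-\frac\epsilon2\mathrm{Tr}(M^\epsilon_{01})+\frac\epsilon2\log\det\Big(I+\frac12M^\epsilon_{01}\Big).$$
   Context: $\mathcal H$ is a real separable Hilbert space. $\mathcal N(m,C)$ is the Gaussian measure with mean $m$ and covariance $C$ self-adjoint, positive, trace class. $\mathrm{KL}(\gamma\|\mu)=\int\log\frac{d\gamma}{d\mu}d\gamma$ if $\gamma\ll\mu$, $+\infty$ otherwise. $\mathrm{OT}^\epsilon_{d^2}(\mu_0,\mu_1)=\min_{\gamma\in\mathrm{Joint}(\mu_0,\mu_1)}\{\int\|x-y\|^2d\gamma+\epsilon\,\mathrm{KL}(\gamma\|\mu_0\otimes\mu_1)\}$, where $\mathrm{Joint}(\mu_0,\mu_1)$ is the set of probability measures on $\mathcal H\times\mathcal H$ with marginals $\mu_0,\mu_1$. For $i,j\in\{0,1\}$, $M^\epsilon_{ij}=-I+\big(I+\frac{16}{\epsilon^2}C_i^{1/2}C_jC_i^{1/2}\big)^{1/2}$. $\det$ is the Fredholm determinant. *)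

theory Defs
  imports "HOL-Analysis.Analysis" "HOL-Probability.Probability"
begin

text \<open>Real separable Hilbert spaces are modelled by the type class
  real_inner + polish_space (complete, second countable = separable).
  Bounded operators are blinfun.\<close>

definition selfadjoint_op :: "('a::real_inner \<Rightarrow>\<^sub>L 'a) \<Rightarrow> bool" where
  "selfadjoint_op C \<longleftrightarrow> (\<forall>x y. inner (C x) y = inner x (C y))"

definition positive_op :: "('a::real_inner \<Rightarrow>\<^sub>L 'a) \<Rightarrow> bool" where
  "positive_op C \<longleftrightarrow> selfadjoint_op C \<and> (\<forall>x. 0 \<le> inner (C x) x)"

definition hilbert_basis :: "'a::real_inner set \<Rightarrow> bool" where
  "hilbert_basis B \<longleftrightarrow> (\<forall>e\<in>B. norm e = 1) \<and> (\<forall>e\<in>B. \<forall>f\<in>B. e \<noteq> f \<longrightarrow> inner e f = 0)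
     \<and> closure (span B) = UNIV"

text \<open>A positive operator is trace class iff its diagonal in some ONB is summable;
  its trace is the sum of the diagonal (independent of the basis).\<close>
definition trace_class_pos :: "('a::real_inner \<Rightarrow>\<^sub>L 'a) \<Rightarrow> bool" where
  "trace_class_pos C \<longleftrightarrow> positive_op C \<and>
     (\<exists>B. hilbert_basis B \<and> (\<lambda>e. inner (C e) e) summable_on B)"

definition op_trace :: "('a::real_inner \<Rightarrow>\<^sub>L 'a) \<Rightarrow> real" where
  "op_trace C = infsum (\<lambda>e. inner (C e) e) (SOME B. hilbert_basis B)"

definition op_sqrt :: "('a::real_inner \<Rightarrow>\<^sub>L 'a) \<Rightarrow> ('a \<Rightarrow>\<^sub>L 'a)" where
  "op_sqrt A = (THE S. positive_op S \<and> S o\<^sub>L S = A)"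

text \<open>Fredholm determinant of T = I + A, A self-adjoint trace class (with eigenvalues
  greater than -1, e.g. A positive): the product of (1 + eigenvalues of A) with
  multiplicity, computed along an orthonormal eigenbasis of A.\<close>
definition fredholm_det :: "('a::real_inner \<Rightarrow>\<^sub>L 'a) \<Rightarrow> real" where
  "fredholm_det T = (THE d. \<exists>B. hilbert_basis B \<and>
       (\<forall>e\<in>B. \<exists>l. (T - id_blinfun) e = l *\<^sub>R e) \<and>
       d = exp (infsum (\<lambda>e. ln (1 + inner ((T - id_blinfun) e) e)) B))"

definition normal_meas :: "real \<Rightarrow> real \<Rightarrow> real measure" where
  "normal_meas a v = (if v = 0 then return borel a
                      else density lborel (\<lambda>x. ennreal (normal_density a (sqrt v) x)))"

definition gaussian_measure :: "'a::{real_inner,polish_space} measure \<Rightarrow> 'a \<Rightarrow> ('a \<Rightarrow>\<^sub>L 'a) \<Rightarrow> bool" where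
  "gaussian_measure \<mu> m C \<longleftrightarrow> sets \<mu> = sets borel \<and> prob_space \<mu> \<and>
     (\<forall>h. distr \<mu> borel (\<lambda>x. inner x h) = normal_meas (inner m h) (inner (C h) h))"

definition KL :: "'b measure \<Rightarrow> 'b measure \<Rightarrow> ereal" where
  "KL \<gamma> \<mu> = (if sets \<gamma> = sets \<mu> \<and> absolutely_continuous \<mu> \<gamma> then
       enn2ereal (\<integral>\<^sup>+ x. ennreal (max 0 (ln (enn2real (RN_deriv \<mu> \<gamma> x)))) \<partial>\<gamma>)
     - enn2ereal (\<integral>\<^sup>+ x. ennreal (max 0 (- ln (enn2real (RN_deriv \<mu> \<gamma> x)))) \<partial>\<gamma>)
     else \<infinity>)"

definition Joint :: "'a::{real_inner,polish_space} measure \<Rightarrow> 'a measure \<Rightarrow> ('a \<times> 'a) measure set" where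
  "Joint \<mu>0 \<mu>1 = {\<gamma>. sets \<gamma> = sets (\<mu>0 \<Otimes>\<^sub>M \<mu>1) \<and> prob_space \<gamma> \<and>
      distr \<gamma> \<mu>0 fst = \<mu>0 \<and> distr \<gamma> \<mu>1 snd = \<mu>1}"

definition OT_cost :: "real \<Rightarrow> 'a::{real_inner,polish_space} measure \<Rightarrow> 'a measure \<Rightarrow> ('a \<times> 'a) measure \<Rightarrow> ereal" where
  "OT_cost \<epsilon> \<mu>0 \<mu>1 \<gamma> = enn2ereal (\<integral>\<^sup>+ p. ennreal ((norm (fst p - snd p))\<^sup>2) \<partial>\<gamma>)
      + ereal \<epsilon> * KL \<gamma> (\<mu>0 \<Otimes>\<^sub>M \<mu>1)"

definition OT_eps :: "real \<Rightarrow> 'a::{real_inner,polish_space} measure \<Rightarrow> 'a measure \<Rightarrow> ereal" where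
  "OT_eps \<epsilon> \<mu>0 \<mu>1 = (INF \<gamma>\<in>Joint \<mu>0 \<mu>1. OT_cost \<epsilon> \<mu>0 \<mu>1 \<gamma>)"

definition M_eps :: "real \<Rightarrow> ('a::real_inner \<Rightarrow>\<^sub>L 'a) \<Rightarrow> ('a \<Rightarrow>\<^sub>L 'a) \<Rightarrow> ('a \<Rightarrow>\<^sub>L 'a)" where
  "M_eps \<epsilon> Ci Cj = - id_blinfun +
      op_sqrt (id_blinfun + (16 / \<epsilon>\<^sup>2) *\<^sub>R (op_sqrt Ci o\<^sub>L Cj o\<^sub>L op_sqrt Ci))"

end

(*
  Let S be the positive square root of C0. Diagonalising the trace class operator S C1 S, with
  eigenvalues s_k^2, produces vectors a_k, b_k such that the coordinates xi_k(x) = <x - m0, a_k>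
  and eta_k(y) = <y - m1, b_k> are two independent i.i.d. standard normal sequences under the
  product measure, and <x - m0, y - m1> = sum_k s_k xi_k eta_k almost everywhere. The
  problem splits into one-dimensional Gaussian ones, whose optimal density is the Mehler kernel;
  the product of these kernels is exp phi with
    phi(x,y) = const - sum_k (M_k / 4) (xi_k^2 + eta_k^2) + (2 / eps) <x - m0, y - m1>,
  where M_k are the eigenvalues of M. For every coupling the transport cost plus
  eps times the integral of phi is the claimed value, since the mixed term cancels. The Gibbs
  inequality KL >= integral of phi gives the lower bound, and it is an equality for the measure
  with density exp phi, which is a coupling because the finite products have the right
  marginals and are bounded in L^2.
*)
theory Submission
  imports Defs
begin

section \<open>Orthonormal sets and Hilbert bases\<close>

text \<open>A coupling may be singular to the product measure, so an almost everywhere limit of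
  finite-dimensional log-densities says nothing about it. Hence \<phi> is one fixed function that
  keeps the mixed term as an inner product: its integral under a coupling is determined by the
  marginals and the mean of the mixed term. The series for the mixed term matters only under the
  product measure, where it converges in mean square because the eigenvalues of S C1 S are summable.
  The number 16 comes from the Mehler kernel. The cost forces the coefficient 2 s / \<epsilon> on a
  product of paired coordinates, while standard normal marginals require its square to be M (M + 2)
  / 4; solving for M gives sqrt (1 + 16 s^2 / \<epsilon>^2) - 1. The measures are given by their
  one-dimensional projections, so independence of coordinates has to be read off characteristic
  functions. In the limit Fatou's lemma shows only that the marginals are dominated by the
  prescribed ones; the L^2 bound restores the total mass and with it equality.\<close>

definition orthonormal :: "'a::real_inner set \<Rightarrow> bool" where
  "orthonormal E \<longleftrightarrow> (\<forall>e\<in>E. norm e = 1) \<and> (\<forall>e\<in>E. \<forall>f\<in>E. e \<noteq> f \<longrightarrow> inner e f = 0)"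

lemma hilbert_basis_iff: "hilbert_basis B \<longleftrightarrow> orthonormal B \<and> closure (span B) = UNIV"
  by (auto simp: hilbert_basis_def orthonormal_def)

lemma orthonormal_inner:
  assumes "orthonormal E" "e \<in> E" "f \<in> E"
  shows "inner e f = (if e = f then 1 else 0)"
  using assms by (auto simp: orthonormal_def dot_square_norm)

lemma orthonormal_inner_sum:
  assumes "orthonormal E" "finite F" "F \<subseteq> E" "f \<in> E"
  shows "inner (\<Sum>e\<in>F. c e *\<^sub>R e) f = (if f \<in> F then c f else 0)"
proof -
  have "inner (\<Sum>e\<in>F. c e *\<^sub>R e) f = (\<Sum>e\<in>F. if e = f then c e else 0)"
    unfolding inner_sum_left
    by (rule sum.cong) (use assms orthonormal_inner[OF assms(1)] in auto)
  then show ?thesis using assms(2) by simp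
qed

text \<open>Completing the square in the coefficients. Taking \<open>c = inner x\<close> yields
  Bessel's inequality, \<open>x = 0\<close> yields Pythagoras, and dropping the last sum shows that
  Fourier partial sums are best approximations.\<close>

lemma orthonormal_norm_diff_sum:
  assumes "orthonormal E" "finite F" "F \<subseteq> E"
  shows "(norm (x - (\<Sum>e\<in>F. c e *\<^sub>R e)))\<^sup>2
    = (norm x)\<^sup>2 - (\<Sum>e\<in>F. (inner x e)\<^sup>2) + (\<Sum>e\<in>F. (c e - inner x e)\<^sup>2)"
proof -
  let ?s = "\<Sum>e\<in>F. c e *\<^sub>R e"
  have 1: "inner x ?s = (\<Sum>e\<in>F. c e * inner x e)"
    by (simp add: inner_sum_right)
  have "inner ?s ?s = (\<Sum>e\<in>F. c e * inner ?s e)"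
    by (simp add: inner_sum_right)
  also have "\<dots> = (\<Sum>e\<in>F. (c e)\<^sup>2)"
    using assms by (intro sum.cong) (auto simp: orthonormal_inner_sum[OF assms] power2_eq_square subset_iff)
  finally have 2: "inner ?s ?s = (\<Sum>e\<in>F. (c e)\<^sup>2)" .
  have "(norm (x - ?s))\<^sup>2 = (norm x)\<^sup>2 - 2 * inner x ?s + inner ?s ?s"
    by (simp add: power2_norm_eq_inner inner_diff_left inner_diff_right inner_commute)
  also have "\<dots> = (norm x)\<^sup>2 - (\<Sum>e\<in>F. (inner x e)\<^sup>2) + (\<Sum>e\<in>F. (c e - inner x e)\<^sup>2)"
    unfolding 1 2
    by (simp add: power2_diff sum.distrib sum_subtractf sum_distrib_left algebra_simps)
  finally show ?thesis .
qed

lemma orthonormal_norm_sum: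
  assumes "orthonormal E" "finite F" "F \<subseteq> E"
  shows "(norm (\<Sum>e\<in>F. c e *\<^sub>R e))\<^sup>2 = (\<Sum>e\<in>F. (c e)\<^sup>2)"
  using orthonormal_norm_diff_sum[OF assms, of 0 c] by simp

lemma bessel_finite:
  assumes "orthonormal E" "finite F" "F \<subseteq> E"
  shows "(\<Sum>e\<in>F. (inner x e)\<^sup>2) \<le> (norm x)\<^sup>2"
  using orthonormal_norm_diff_sum[OF assms, of x "inner x"]
    zero_le_power2[of "norm (x - (\<Sum>e\<in>F. inner x e *\<^sub>R e))"] by simp

lemma bessel_summable:
  assumes "orthonormal E"
  shows "(\<lambda>e. (inner x e)\<^sup>2) summable_on E"
  by (rule nonneg_bdd_above_summable_on)
     (use bessel_finite[OF assms] in \<open>auto intro!: bdd_aboveI[of _ "(norm x)\<^sup>2"]\<close>)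

text \<open>Riesz-Fischer: by Pythagoras the squared distance of nested partial sums is a difference
  of partial sums of the numerical series, so the net is Cauchy.\<close>

lemma orthonormal_summable:
  fixes E :: "'a::{real_inner,complete_space} set"
  assumes E: "orthonormal E" and c: "(\<lambda>e. (c e)\<^sup>2) summable_on E"
  shows "(\<lambda>e. c e *\<^sub>R e) summable_on E"
proof -
  from c obtain L where "((\<lambda>e. (c e)\<^sup>2) has_sum L) E" by (auto simp: summable_on_def)
  then have lim: "(sum (\<lambda>e. (c e)\<^sup>2) \<longlongrightarrow> L) (finite_subsets_at_top E)"
    by (simp add: has_sum_def)
  have "\<exists>P. eventually P (finite_subsets_at_top E) \<and>
          (\<forall>F G. P F \<and> P G \<longrightarrow> dist (\<Sum>e\<in>F. c e *\<^sub>R e) (\<Sum>e\<in>G. c e *\<^sub>R e) < d)" if d: "d > 0" for d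
  proof -
    \<comment> \<open>Squared distances are compared, hence the square; each of two partial sums is
      compared with the one over \<open>F0\<close>, which costs d/2.\<close>
    define \<delta> where "\<delta> = (d/2)\<^sup>2"
    have "\<delta> > 0" using d by (simp add: \<delta>_def)
    then have "eventually (\<lambda>F. dist (\<Sum>e\<in>F. (c e)\<^sup>2) L < \<delta>/2) (finite_subsets_at_top E)"
      by (intro tendstoD[OF lim] half_gt_zero)
    then obtain F0 where F0: "finite F0" "F0 \<subseteq> E"
      and F0d: "\<And>F. finite F \<Longrightarrow> F0 \<subseteq> F \<Longrightarrow> F \<subseteq> E \<Longrightarrow> dist (\<Sum>e\<in>F. (c e)\<^sup>2) L < \<delta>/2"
      unfolding eventually_finite_subsets_at_top by (elim exE conjE) simp
    have near: "norm ((\<Sum>e\<in>F. c e *\<^sub>R e) - (\<Sum>e\<in>F0. c e *\<^sub>R e)) < d/2"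
      if F: "finite F" "F0 \<subseteq> F" "F \<subseteq> E" for F
    proof -
      have "(\<Sum>e\<in>F. c e *\<^sub>R e) - (\<Sum>e\<in>F0. c e *\<^sub>R e) = (\<Sum>e\<in>F-F0. c e *\<^sub>R e)"
        using F by (simp add: sum_diff)
      then have "(norm ((\<Sum>e\<in>F. c e *\<^sub>R e) - (\<Sum>e\<in>F0. c e *\<^sub>R e)))\<^sup>2 = (\<Sum>e\<in>F-F0. (c e)\<^sup>2)"
        using orthonormal_norm_sum[OF E, of "F-F0" c] F by auto
      also have "\<dots> = (\<Sum>e\<in>F. (c e)\<^sup>2) - (\<Sum>e\<in>F0. (c e)\<^sup>2)"
        using F by (simp add: sum_diff)
      also have "\<dots> < \<delta>"
        using dist_triangle_half_l[OF F0d[OF F] F0d[OF F0(1) subset_refl F0(2)]]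
        unfolding dist_real_def by linarith
      finally show ?thesis
        unfolding \<delta>_def by (rule power2_less_imp_less) (use d in simp)
    qed
    let ?P = "\<lambda>F. finite F \<and> F0 \<subseteq> F \<and> F \<subseteq> E"
    have "eventually ?P (finite_subsets_at_top E)"
      using F0 by (auto simp: eventually_finite_subsets_at_top)
    moreover have "dist (\<Sum>e\<in>F. c e *\<^sub>R e) (\<Sum>e\<in>G. c e *\<^sub>R e) < d" if F: "?P F" and G: "?P G" for F G
    proof -
      from F have "dist (\<Sum>e\<in>F. c e *\<^sub>R e) (\<Sum>e\<in>F0. c e *\<^sub>R e) < d/2"
        unfolding dist_norm by (intro near) (elim conjE, assumption)+
      moreover from G have "dist (\<Sum>e\<in>G. c e *\<^sub>R e) (\<Sum>e\<in>F0. c e *\<^sub>R e) < d/2"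
        unfolding dist_norm by (intro near) (elim conjE, assumption)+
      ultimately show ?thesis by (rule dist_triangle_half_l)
    qed
    ultimately show ?thesis by (intro exI[of _ ?P]) simp
  qed
  then have \<open>cauchy_filter (filtermap (sum (\<lambda>e. c e *\<^sub>R e)) (finite_subsets_at_top E))\<close>
    by (simp add: cauchy_filter_metric_filtermap)
  moreover have "uniform_space_class.complete (UNIV::'a set)"
    by (rule complete_UNIV)
  ultimately obtain L' where \<open>(sum (\<lambda>e. c e *\<^sub>R e) \<longlongrightarrow> L') (finite_subsets_at_top E)\<close>
    using complete_uniform[where S=UNIV] by (force simp add: filterlim_def)
  then show ?thesis
    using summable_on_def has_sum_def by blast
qed

lemma has_sum_inner_left:
  assumes "(f has_sum s) A"
  shows "((\<lambda>i. inner (f i) y) has_sum inner s y) A"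
  using has_sum_bounded_linear[OF bounded_linear_inner_left assms] .

lemma orthonormal_infsum_inner:
  fixes E :: "'a::{real_inner,complete_space} set"
  assumes E: "orthonormal E" and c: "(\<lambda>e. (c e)\<^sup>2) summable_on E" and f: "f \<in> E"
  shows "inner (\<Sum>\<^sub>\<infinity>e\<in>E. c e *\<^sub>R e) f = c f"
proof -
  have "((\<lambda>e. inner (c e *\<^sub>R e) f) has_sum inner (\<Sum>\<^sub>\<infinity>e\<in>E. c e *\<^sub>R e) f) E"
    using orthonormal_summable[OF E c] by (intro has_sum_inner_left) simp
  moreover have "((\<lambda>e. inner (c e *\<^sub>R e) f) has_sum c f) E"
    by (rule has_sum_finite_neutralI[of "{f}"])
       (use f orthonormal_inner[OF E _ f] in auto)
  ultimately show ?thesis by (rule has_sum_unique)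
qed

text \<open>Density of the span enters only in the lower bound: a vector of the span close to x
  cannot be closer than the Fourier partial sum over its support.\<close>

lemma parseval:
  assumes B: "hilbert_basis B"
  shows "((\<lambda>e. (inner x e)\<^sup>2) has_sum (norm x)\<^sup>2) B"
proof -
  have ob: "orthonormal B" and cl: "x \<in> closure (span B)" using B by (auto simp: hilbert_basis_iff)
  from bessel_summable[OF ob] have hs: "((\<lambda>e. (inner x e)\<^sup>2) has_sum (\<Sum>\<^sub>\<infinity>e\<in>B. (inner x e)\<^sup>2)) B"
    by simp
  have "(\<Sum>\<^sub>\<infinity>e\<in>B. (inner x e)\<^sup>2) \<le> (norm x)\<^sup>2"
    using hs by (rule has_sum_le_finite_sums) (use bessel_finite[OF ob] in auto)
  moreover have "(norm x)\<^sup>2 \<le> (\<Sum>\<^sub>\<infinity>e\<in>B. (inner x e)\<^sup>2) + d\<^sup>2" if "d > 0" for d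
  proof -
    from cl that obtain v where v: "v \<in> span B" "dist v x < d"
      by (auto simp: closure_approachable)
    from v(1) obtain F c where F: "finite F" "F \<subseteq> B" "v = (\<Sum>e\<in>F. c e *\<^sub>R e)"
      unfolding span_explicit by auto
    have "(norm x)\<^sup>2 - (\<Sum>e\<in>F. (inner x e)\<^sup>2) \<le> (norm (x - v))\<^sup>2"
      unfolding F(3) orthonormal_norm_diff_sum[OF ob F(1,2)] by (simp add: sum_nonneg)
    also have "\<dots> \<le> d\<^sup>2" using v(2) by (intro power_mono) (auto simp: dist_norm norm_minus_commute)
    finally have "(norm x)\<^sup>2 - (\<Sum>e\<in>F. (inner x e)\<^sup>2) \<le> d\<^sup>2" .
    moreover have "(\<Sum>e\<in>F. (inner x e)\<^sup>2) \<le> (\<Sum>\<^sub>\<infinity>e\<in>B. (inner x e)\<^sup>2)"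
      by (rule finite_sum_le_has_sum[OF hs F(1,2)]) simp
    ultimately show ?thesis by simp
  qed
  then have "(norm x)\<^sup>2 \<le> (\<Sum>\<^sub>\<infinity>e\<in>B. (inner x e)\<^sup>2) + d" if "d > 0" for d
    using that by (metis real_sqrt_gt_zero real_sqrt_pow2 less_imp_le)
  then have "(norm x)\<^sup>2 \<le> (\<Sum>\<^sub>\<infinity>e\<in>B. (inner x e)\<^sup>2)" by (rule field_le_epsilon)
  ultimately show ?thesis using hs by simp
qed

lemma hilbert_basis_eqI:
  assumes B: "hilbert_basis B" and eq: "\<And>e. e \<in> B \<Longrightarrow> inner x e = inner y e"
  shows "x = y"
proof -
  have "((\<lambda>e. (inner (x - y) e)\<^sup>2) has_sum 0) B"
    by (rule has_sum_0) (simp add: eq inner_diff_left)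
  with parseval[OF B, of "x - y"] have "(norm (x - y))\<^sup>2 = 0" by (rule has_sum_unique)
  then show ?thesis by simp
qed

lemma hilbert_basis_expansion:
  fixes x :: "'a::{real_inner,complete_space}"
  assumes B: "hilbert_basis B"
  shows "((\<lambda>e. inner x e *\<^sub>R e) has_sum x) B"
proof -
  have ob: "orthonormal B" using B by (simp add: hilbert_basis_iff)
  note s = bessel_summable[OF ob, of x]
  have "(\<Sum>\<^sub>\<infinity>e\<in>B. inner x e *\<^sub>R e) = x"
    by (rule hilbert_basis_eqI[OF B]) (rule orthonormal_infsum_inner[OF ob s])
  then show ?thesis using has_sum_infsum[OF orthonormal_summable[OF ob s]] by simp
qed

lemma parseval_inner:
  assumes B: "hilbert_basis B"
  shows "((\<lambda>e. inner x e * inner y e) has_sum inner x y) B"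
proof -
  have "((\<lambda>e. ((inner (x + y) e)\<^sup>2 + - (inner (x - y) e)\<^sup>2) * (1/4))
      has_sum ((norm (x + y))\<^sup>2 + - (norm (x - y))\<^sup>2) * (1/4)) B"
    by (intro has_sum_cmult_left has_sum_add has_sum_uminusI parseval[OF B])
  moreover have "((inner (x + y) e)\<^sup>2 + - (inner (x - y) e)\<^sup>2) * (1/4) = inner x e * inner y e" for e
    by (simp add: inner_add_left inner_diff_left power2_eq_square algebra_simps)
  moreover have "((norm (x + y))\<^sup>2 + - (norm (x - y))\<^sup>2) * (1/4) = inner x y"
    by (simp add: power2_norm_eq_inner inner_add_left inner_diff_left inner_add_right inner_diff_right inner_commute)
  ultimately show ?thesis by simp
qed

lemma blinfun_eqI_hilbert_basis:
  fixes S T :: "'a::real_inner \<Rightarrow>\<^sub>L 'b::real_normed_vector"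
  assumes B: "hilbert_basis B" and eq: "\<And>e. e \<in> B \<Longrightarrow> S e = T e"
  shows "S = T"
proof (rule blinfun_eqI)
  fix x
  have cl: "closed {x. S x = T x}"
    by (intro closed_Collect_eq continuous_intros)
  have "x \<in> {x. S x = T x}" if "x \<in> span B" for x
    using that
    by (induction rule: span_induct) (auto simp: eq subspace_def blinfun.bilinear_simps)
  then have "closure (span B) \<subseteq> {x. S x = T x}"
    using cl by (intro closure_minimal) auto
  then show "S x = T x" using B by (auto simp: hilbert_basis_def)
qed

section \<open>Countability and rearrangement of sums\<close>

lemma orthonormal_countable:
  fixes E :: "'a::{real_inner,second_countable_topology} set"
  assumes E: "orthonormal E"
  shows "countable E"
proof -
  \<comment> \<open>Distinct orthonormal vectors are sqrt 2 apart; the weaker bound 1 already makes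
    balls of radius 1/2 disjoint, and a second countable space contains only countably many disjoint
    nonempty open sets.\<close>
  have d: "dist e f \<ge> 1" if "e \<in> E" "f \<in> E" "e \<noteq> f" for e f
  proof -
    have "(norm (e - f))\<^sup>2 = 2"
      using that orthonormal_inner[OF E] by (simp add: power2_norm_eq_inner inner_diff_left inner_diff_right)
    then have "(1::real)\<^sup>2 \<le> (norm (e - f))\<^sup>2" by simp
    then show ?thesis unfolding dist_norm by (rule power2_le_imp_le) simp
  qed
  have "countable ((\<lambda>e. ball e (1/2)) ` E)"
  proof (rule countable_disjoint_open_subsets)
    show "pairwise disjnt ((\<lambda>e. ball e (1/2)) ` E)"
    proof (clarsimp simp: pairwise_def disjnt_iff)
      fix e f x assume a: "e \<in> E" "f \<in> E" "ball e (1/2) \<noteq> ball f (1/2)" "dist e x * 2 < 1" "dist f x * 2 < 1"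
      then have "dist e f \<ge> 1" using d by blast
      then show False using dist_triangle2[of e f x] a by linarith
    qed
  qed auto
  moreover have "inj_on (\<lambda>e. ball e (1/2)) E"
  proof (rule inj_onI, rule ccontr)
    fix e f assume a: "e \<in> E" "f \<in> E" "ball e (1/2) = ball f (1/2)" "e \<noteq> f"
    then have "e \<in> ball f (1/2)" using centre_in_ball[of e "1/2"] by simp
    then show False using d[of f e] a by (simp add: dist_commute)
  qed
  ultimately show ?thesis by (rule countable_image_inj_on)
qed

lemma has_sum_swap_nonneg:
  fixes f :: "'a \<Rightarrow> 'b \<Rightarrow> real"
  assumes r: "\<And>x. x \<in> A \<Longrightarrow> (f x has_sum g x) B" and g: "(g has_sum S) A"
    and c: "\<And>y. y \<in> B \<Longrightarrow> ((\<lambda>x. f x y) has_sum h y) A"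
    and nn: "\<And>x y. x \<in> A \<Longrightarrow> y \<in> B \<Longrightarrow> 0 \<le> f x y"
  shows "(h has_sum S) B"
proof -
  let ?f = "\<lambda>(x,y). f x y"
  have "?f summable_on (Sigma A (\<lambda>_. B))"
    by (rule summable_on_SigmaI[where g = g])
       (use r g nn in \<open>auto simp: summable_on_def\<close>)
  then have "(?f has_sum S) (Sigma A (\<lambda>_. B))"
    by (intro has_sum_SigmaI[where g = g]) (use r g in auto)
  then have "((\<lambda>(y,x). f x y) has_sum S) (B \<times> A)"
    using has_sum_swap[where f = ?f and S = S and A = A and B = B] by simp
  then show ?thesis
    by (rule has_sum_SigmaD) (use c in auto)
qed

text \<open>Each value \<open>l e\<close> is spread over \<open>B'\<close> with the weights
  \<open>(inner e f)\<^sup>2\<close>, whose sum is 1 by Parseval; the double sum is then read in the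
  other order. It serves to compare two eigenbases.\<close>

lemma has_sum_basis_change:
  assumes B: "hilbert_basis B" and B': "hilbert_basis B'"
    and l: "(l has_sum S) B" and nn: "\<And>e. e \<in> B \<Longrightarrow> 0 \<le> l e"
    and h: "\<And>f. f \<in> B' \<Longrightarrow> ((\<lambda>e. l e * (inner f e)\<^sup>2) has_sum h f) B"
  shows "(h has_sum S) B'"
proof (rule has_sum_swap_nonneg[where f = "\<lambda>e f. l e * (inner f e)\<^sup>2" and g = l and A = B])
  fix e assume e: "e \<in> B"
  have "norm e = 1" using B e by (auto simp: hilbert_basis_def)
  then have "((\<lambda>f. l e * (inner e f)\<^sup>2) has_sum l e * 1) B'"
    using parseval[OF B', of e] by (intro has_sum_cmult_right) simp
  then show "((\<lambda>f. l e * (inner f e)\<^sup>2) has_sum l e) B'" by (simp add: inner_commute)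
qed (use assms in auto)

section \<open>Spectral theorem for positive trace class operators\<close>

lemma positive_op_sym: "positive_op A \<Longrightarrow> inner (A x) y = inner x (A y)"
  by (auto simp: positive_op_def selfadjoint_op_def)

lemma positive_op_nonneg: "positive_op A \<Longrightarrow> 0 \<le> inner (A x) x"
  by (auto simp: positive_op_def)

lemma positive_op_Cauchy_Schwarz:
  assumes A: "positive_op A"
  shows "(inner (A x) y)\<^sup>2 \<le> inner (A x) x * inner (A y) y"
proof -
  define a b c where "a = inner (A x) x" "b = inner (A x) y" "c = inner (A y) y"
  have q: "0 \<le> a + 2 * t * b + t\<^sup>2 * c" for t
  proof -
    have "inner (A (x + t *\<^sub>R y)) (x + t *\<^sub>R y) = a + 2 * t * b + t\<^sup>2 * c"
      using positive_op_sym[OF A, of y x]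
      by (simp add: a_b_c_def blinfun.bilinear_simps inner_add_left inner_add_right
          inner_commute power2_eq_square algebra_simps)
    then show ?thesis using positive_op_nonneg[OF A, of "x + t *\<^sub>R y"] by simp
  qed
  have c0: "0 \<le> c" unfolding a_b_c_def by (rule positive_op_nonneg[OF A])
  have "b\<^sup>2 \<le> a * c"
  proof (cases "c = 0")
    case True
    have "b = 0"
    proof (rule ccontr)
      assume "b \<noteq> 0"
      \<comment> \<open>For \<open>c = 0\<close> the quadratic is affine in t, and this choice of t
        gives it the value -1.\<close>
      then have "2 * (-(a + 1)/(2*b)) * b = -(a + 1)" by (simp add: field_simps)
      then show False using q[of "-(a + 1)/(2*b)"] True by simp
    qed
    then show ?thesis using True by simp
  next
    case False
    then have "a + 2 * (-b/c) * b + (-b/c)\<^sup>2 * c = (a * c - b\<^sup>2) / c"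
      by (simp add: field_simps power2_eq_square)
    then have "0 \<le> (a * c - b\<^sup>2) / c" using q[of "-b/c"] by simp
    then show ?thesis using False c0 by (simp add: zero_le_divide_iff)
  qed
  then show ?thesis by (simp add: a_b_c_def)
qed

text \<open>The norm of the square root of \<open>A\<close> applied to \<open>x\<close>, usable
  before square roots are constructed.\<close>

definition op_seminorm :: "('a::real_inner \<Rightarrow>\<^sub>L 'a) \<Rightarrow> 'a \<Rightarrow> real" where
  "op_seminorm A x = sqrt (inner (A x) x)"

lemma op_seminorm_power2: "positive_op A \<Longrightarrow> (op_seminorm A x)\<^sup>2 = inner (A x) x"
  by (simp add: op_seminorm_def positive_op_nonneg)

lemma op_seminorm_nonneg: "positive_op A \<Longrightarrow> 0 \<le> op_seminorm A x"
  by (simp add: op_seminorm_def positive_op_nonneg)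

lemma op_seminorm_triangle:
  assumes A: "positive_op A"
  shows "op_seminorm A (x + y) \<le> op_seminorm A x + op_seminorm A y"
proof (rule power2_le_imp_le)
  have "(inner (A x) y)\<^sup>2 \<le> (op_seminorm A x * op_seminorm A y)\<^sup>2"
    using positive_op_Cauchy_Schwarz[OF A, of x y]
    by (simp add: power_mult_distrib op_seminorm_power2[OF A])
  then have "inner (A x) y \<le> op_seminorm A x * op_seminorm A y"
    by (meson power2_le_imp_le mult_nonneg_nonneg op_seminorm_nonneg[OF A])
  then show "(op_seminorm A (x + y))\<^sup>2 \<le> (op_seminorm A x + op_seminorm A y)\<^sup>2"
    using positive_op_sym[OF A, of y x]
    by (simp add: op_seminorm_power2[OF A] power2_sum blinfun.bilinear_simps inner_add_left
        inner_add_right inner_commute)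
qed (simp add: op_seminorm_nonneg[OF A])

lemma op_seminorm_scaleR:
  "op_seminorm A (c *\<^sub>R x) = \<bar>c\<bar> * op_seminorm A x"
  by (simp add: op_seminorm_def blinfun.bilinear_simps real_sqrt_mult mult.assoc[symmetric])

lemma op_seminorm_sum:
  assumes A: "positive_op A" and F: "finite F"
  shows "op_seminorm A (\<Sum>i\<in>F. f i) \<le> (\<Sum>i\<in>F. op_seminorm A (f i))"
  using F
proof (induction F rule: finite_induct)
  case empty
  then show ?case by (simp add: op_seminorm_def)
next
  case (insert i F)
  then show ?case using op_seminorm_triangle[OF A, of "f i" "\<Sum>i\<in>F. f i"] by simp
qed

text \<open>Cauchy-Schwarz for the form of \<open>A\<close>, applied to \<open>x\<close> and
  \<open>A x\<close>, then division by the squared norm of \<open>A x\<close>. The bound is assumed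
  at \<open>A x\<close> only, so \<open>l\<close> may be the supremum of the form over an invariant
  subspace instead of the operator norm.\<close>

lemma norm_le_op_seminorm:
  assumes A: "positive_op A"
    and l: "inner (A (A x)) (A x) \<le> l * (norm (A x))\<^sup>2"
  shows "(norm (A x))\<^sup>2 \<le> l * inner (A x) x"
proof (cases "A x = 0")
  case False
  have "(norm (A x))\<^sup>2 * (norm (A x))\<^sup>2 \<le> inner (A x) x * inner (A (A x)) (A x)"
    using positive_op_Cauchy_Schwarz[OF A, of x "A x"]
    by (simp only: power2_norm_eq_inner power2_eq_square[of "inner _ _"])
  also have "\<dots> \<le> inner (A x) x * (l * (norm (A x))\<^sup>2)"
    by (intro mult_left_mono l positive_op_nonneg[OF A])
  finally have "(norm (A x))\<^sup>2 * (norm (A x))\<^sup>2 \<le> (l * inner (A x) x) * (norm (A x))\<^sup>2"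
    by (simp add: ac_simps)
  then show ?thesis by (rule mult_right_le_imp_le) (use False in simp)
qed simp

lemma inner_blinfun_le: "inner ((A::'a::real_inner \<Rightarrow>\<^sub>L 'a) x) x \<le> norm A * (norm x)\<^sup>2"
proof -
  have "inner (A x) x \<le> norm (A x) * norm x" by (rule norm_cauchy_schwarz)
  also have "\<dots> \<le> (norm A * norm x) * norm x" by (intro mult_right_mono norm_blinfun) simp
  finally show ?thesis by (simp add: power2_eq_square mult.assoc)
qed

lemma norm_blinfun_le_op_seminorm:
  assumes A: "positive_op A"
  shows "norm (A x) \<le> sqrt (norm A) * op_seminorm A x"
proof -
  have "(norm (A x))\<^sup>2 \<le> norm A * inner (A x) x"
    by (rule norm_le_op_seminorm[OF A inner_blinfun_le])
  then have "norm (A x) \<le> sqrt (norm A * inner (A x) x)" by (rule real_le_rsqrt)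
  then show ?thesis by (simp add: op_seminorm_def real_sqrt_mult)
qed

section \<open>Compactness and eigenvectors of positive trace class operators\<close>

lemma diagonal_convergent_subsequence:
  fixes x :: "nat \<Rightarrow> 'i \<Rightarrow> real"
  assumes I: "countable I" and bd: "\<And>n i. i \<in> I \<Longrightarrow> \<bar>x n i\<bar> \<le> R i"
  shows "\<exists>r. strict_mono (r :: nat \<Rightarrow> nat) \<and> (\<forall>i\<in>I. convergent (\<lambda>n. x (r n) i))"
proof (cases "I = {}")
  case True
  then show ?thesis by (intro exI[of _ id]) (simp add: strict_mono_id)
next
  case False
  let ?P = "\<lambda>k s. convergent (\<lambda>n. x (s n) (from_nat_into I k))"
  interpret subseqs ?P
  proof
    fix k and s :: "nat \<Rightarrow> nat"
    have "bounded (range (\<lambda>n. x (s n) (from_nat_into I k)))"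
      using bd[OF from_nat_into[OF False]] by (auto simp: bounded_iff)
    from bounded_imp_convergent_subsequence[OF this]
    show "\<exists>r'. strict_mono r' \<and> ?P k (s \<circ> r')" by (auto simp: convergent_def o_def)
  qed
  have "?P k diagseq" for k
  proof -
    \<comment> \<open>Property k is guaranteed for the diagonal sequence only after its first
      \<open>Suc k\<close> terms; convergence does not notice the shift.\<close>
    have "?P k (diagseq \<circ> ((+) (Suc k)))"
      by (rule diagseq_holds) (auto dest: convergent_subseq_convergent simp: o_def)
    then show ?thesis
      using convergent_ignore_initial_segment[of "\<lambda>n. x (diagseq n) (from_nat_into I k)" "Suc k"]
      by (simp add: o_def add.commute)
  qed
  then have "\<forall>i\<in>I. convergent (\<lambda>n. x (diagseq n) i)"
    using from_nat_into_surj[OF I] by blast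
  then show ?thesis using subseq_diagseq by blast
qed

text \<open>Coordinates in \<open>F\<close> are handled by the triangle inequality, the remaining
  ones by Cauchy-Schwarz, which bounds them by the tail of the trace uniformly over bounded
  \<open>z\<close>. This takes the place of approximation by finite rank operators.\<close>

lemma op_seminorm_le_split:
  fixes A :: "'a::{real_inner,complete_space} \<Rightarrow>\<^sub>L 'a"
  assumes A: "positive_op A" and B: "hilbert_basis B"
    and S: "((\<lambda>e. inner (A e) e) has_sum S) B"
    and F: "finite F" "F \<subseteq> B"
  shows "op_seminorm A z \<le> (\<Sum>e\<in>F. \<bar>inner z e\<bar> * op_seminorm A e)
    + norm z * sqrt (S - (\<Sum>e\<in>F. inner (A e) e))"
    (is "_ \<le> ?R")
proof -
  have ob: "orthonormal B" using B by (simp add: hilbert_basis_iff)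
  have fin: "op_seminorm A (\<Sum>e\<in>G. inner z e *\<^sub>R e) \<le> ?R" if G: "finite G" "G \<subseteq> B" for G
  proof -
    have "op_seminorm A (\<Sum>e\<in>G. inner z e *\<^sub>R e) \<le> (\<Sum>e\<in>G. \<bar>inner z e\<bar> * op_seminorm A e)"
      using op_seminorm_sum[OF A G(1), of "\<lambda>e. inner z e *\<^sub>R e"] by (simp add: op_seminorm_scaleR)
    also have "\<dots> \<le> (\<Sum>e\<in>F \<union> (G - F). \<bar>inner z e\<bar> * op_seminorm A e)"
      by (intro sum_mono2) (use F G op_seminorm_nonneg[OF A] in auto)
    also have "\<dots> = (\<Sum>e\<in>F. \<bar>inner z e\<bar> * op_seminorm A e) + (\<Sum>e\<in>G-F. \<bar>inner z e\<bar> * op_seminorm A e)"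
      by (intro sum.union_disjoint) (use F G in auto)
    also have "(\<Sum>e\<in>G-F. \<bar>inner z e\<bar> * op_seminorm A e)
        \<le> sqrt (\<Sum>e\<in>G-F. (inner z e)\<^sup>2) * sqrt (\<Sum>e\<in>G-F. inner (A e) e)"
      using L2_set_mult_ineq[of "\<lambda>e. inner z e" "op_seminorm A" "G - F"] op_seminorm_nonneg[OF A]
      by (simp add: L2_set_def op_seminorm_power2[OF A])
    also have "\<dots> \<le> norm z * sqrt (S - (\<Sum>e\<in>F. inner (A e) e))"
    proof (intro mult_mono real_sqrt_le_mono)
      show "sqrt (\<Sum>e\<in>G-F. (inner z e)\<^sup>2) \<le> norm z"
        using bessel_finite[OF ob, of "G - F" z] G by (intro real_le_lsqrt) (auto intro: sum_nonneg)
      have "(\<Sum>e\<in>F \<union> (G-F). inner (A e) e) \<le> S"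
        by (rule finite_sum_le_has_sum[OF S]) (use F G positive_op_nonneg[OF A] in auto)
      moreover have "(\<Sum>e\<in>F \<union> (G-F). inner (A e) e) = (\<Sum>e\<in>F. inner (A e) e) + (\<Sum>e\<in>G-F. inner (A e) e)"
        by (intro sum.union_disjoint) (use F G in auto)
      ultimately show "(\<Sum>e\<in>G-F. inner (A e) e) \<le> S - (\<Sum>e\<in>F. inner (A e) e)" by simp
    qed (auto intro!: sum_nonneg positive_op_nonneg[OF A])
    finally show ?thesis by simp
  qed
  have "((\<lambda>G. \<Sum>e\<in>G. inner z e *\<^sub>R e) \<longlongrightarrow> z) (finite_subsets_at_top B)"
    using hilbert_basis_expansion[OF B, of z] by (simp add: has_sum_def)
  then have "((\<lambda>G. op_seminorm A (\<Sum>e\<in>G. inner z e *\<^sub>R e)) \<longlongrightarrow> op_seminorm A z) (finite_subsets_at_top B)"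
    unfolding op_seminorm_def by (intro tendsto_intros)
  then show ?thesis
    by (rule tendsto_upperbound)
       (auto intro!: eventually_finite_subsets_at_top_weakI fin)
qed

text \<open>A bounded sequence has a subsequence along which all coordinates converge;
  \<open>op_seminorm_le_split\<close> turns this into norm convergence of the images.\<close>

lemma trace_class_compact:
  fixes A :: "'a::{real_inner,polish_space} \<Rightarrow>\<^sub>L 'a"
  assumes A: "positive_op A" and B: "hilbert_basis B"
    and S: "(\<lambda>e. inner (A e) e) summable_on B"
    and x: "\<And>n. norm (x n) \<le> R"
  shows "\<exists>r. strict_mono (r :: nat \<Rightarrow> nat) \<and> convergent (\<lambda>n. A (x (r n)))"
proof -
  have ob: "orthonormal B" using B by (simp add: hilbert_basis_iff)
  have R0: "0 \<le> R" using x[of 0] norm_ge_zero[of "x 0"] by linarith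
  have "\<bar>inner (x n) e\<bar> \<le> R" if "e \<in> B" for n e
    using Cauchy_Schwarz_ineq2[of "x n" e] x[of n] that ob by (simp add: orthonormal_def)
  from diagonal_convergent_subsequence[of B "\<lambda>n e. inner (x n) e", OF orthonormal_countable[OF ob] this]
  obtain r where r: "strict_mono (r :: nat \<Rightarrow> nat)"
    and conv: "\<forall>e\<in>B. convergent (\<lambda>n. inner (x (r n)) e)" by blast
  define y where "y n = x (r n)" for n
  from conv obtain c where c: "\<And>e. e \<in> B \<Longrightarrow> (\<lambda>n. inner (y n) e) \<longlonglongrightarrow> c e"
    unfolding convergent_def y_def by metis
  from S obtain L where L: "((\<lambda>e. inner (A e) e) has_sum L) B" by (auto simp: summable_on_def)
  have "Cauchy (\<lambda>n. A (y n))"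
  proof (rule metric_CauchyI)
    fix d :: real assume d: "d > 0"
    \<comment> \<open>The summand 1 keeps the divisor positive when \<open>A\<close> is
      zero.\<close>
    define N where "N = sqrt (norm A) + 1"
    have N: "N > 0" "sqrt (norm A) \<le> N" unfolding N_def by (auto intro: add_nonneg_pos)
    define \<delta> where "\<delta> = d / (4 * N)"
    have \<delta>: "\<delta> > 0" using d N by (simp add: \<delta>_def)
    \<comment> \<open>Chosen so that \<open>(2 * R + 1) * sqrt \<eta> = \<delta>\<close>: the tail
      costs \<delta>, and so do the coordinates of each of the two points. The 1 covers
      \<open>R = 0\<close>.\<close>
    define \<eta> where "\<eta> = (\<delta> / (2 * R + 1))\<^sup>2"
    have \<eta>: "\<eta> > 0" using \<delta> R0 by (simp add: \<eta>_def)
    from has_sum_finite_approximation[OF L \<eta>] obtain F where F: "finite F" "F \<subseteq> B"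
      and Fd: "dist (\<Sum>e\<in>F. inner (A e) e) L \<le> \<eta>" by blast
    define u where "u n = (\<Sum>e\<in>F. \<bar>inner (y n) e - c e\<bar> * op_seminorm A e)" for n
    have "u \<longlonglongrightarrow> (\<Sum>e\<in>F. \<bar>c e - c e\<bar> * op_seminorm A e)"
      unfolding u_def using F by (intro tendsto_intros c) auto
    then have "u \<longlonglongrightarrow> 0" by simp
    then have "eventually (\<lambda>n. u n < \<delta>) sequentially"
      using \<delta> by (rule order_tendstoD)
    then obtain M where M: "\<And>n. n \<ge> M \<Longrightarrow> u n < \<delta>" by (auto simp: eventually_sequentially)
    have "dist (A (y m)) (A (y n)) < d" if "m \<ge> M" "n \<ge> M" for m n
    proof -
      have "(\<Sum>e\<in>F. \<bar>inner (y m - y n) e\<bar> * op_seminorm A e) \<le> u m + u n"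
        unfolding u_def sum.distrib[symmetric] distrib_right[symmetric]
        by (intro sum_mono mult_right_mono op_seminorm_nonneg[OF A])
           (simp add: inner_diff_left)
      moreover have "norm (y m - y n) * sqrt (L - (\<Sum>e\<in>F. inner (A e) e)) \<le> (2 * R + 1) * sqrt \<eta>"
      proof (intro mult_mono real_sqrt_le_mono)
        show "norm (y m - y n) \<le> 2 * R + 1"
          using norm_triangle_ineq4[of "y m" "y n"] x[of "r m"] x[of "r n"] by (simp add: y_def)
        show "L - (\<Sum>e\<in>F. inner (A e) e) \<le> \<eta>" using Fd by (simp add: dist_real_def)
        have "(\<Sum>e\<in>F. inner (A e) e) \<le> L"
          by (rule finite_sum_le_has_sum[OF L F]) (simp add: positive_op_nonneg[OF A])
        then show "0 \<le> sqrt (L - (\<Sum>e\<in>F. inner (A e) e))" by simp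
      qed (use R0 in auto)
      moreover have "(2 * R + 1) * sqrt \<eta> = \<delta>" using R0 \<delta> by (simp add: \<eta>_def)
      ultimately have "op_seminorm A (y m - y n) < 3 * \<delta>"
        using op_seminorm_le_split[OF A B L F, of "y m - y n"] M[OF that(1)] M[OF that(2)] by linarith
      then have "N * op_seminorm A (y m - y n) < N * (3 * \<delta>)" using N by simp
      also have "\<dots> < d" using N d by (simp add: \<delta>_def)
      finally have "N * op_seminorm A (y m - y n) < d" .
      moreover have "norm (A (y m - y n)) \<le> N * op_seminorm A (y m - y n)"
        using norm_blinfun_le_op_seminorm[OF A, of "y m - y n"]
          mult_right_mono[OF N(2) op_seminorm_nonneg[OF A, of "y m - y n"]] by linarith
      ultimately show ?thesis by (simp add: dist_norm blinfun.bilinear_simps)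
    qed
    then show "\<exists>M. \<forall>m\<ge>M. \<forall>n\<ge>M. dist (A (y m)) (A (y n)) < d" by blast
  qed
  then have "convergent (\<lambda>n. A (y n))" by (rule Cauchy_convergent)
  then show ?thesis using r by (auto simp: y_def)
qed

lemma positive_op_eigenvector:
  fixes A :: "'a::{real_inner,polish_space} \<Rightarrow>\<^sub>L 'a"
  assumes A: "positive_op A" and B: "hilbert_basis B"
    and S: "(\<lambda>e. inner (A e) e) summable_on B"
    and V: "closed V" "subspace V" and inv: "\<And>v. v \<in> V \<Longrightarrow> A v \<in> V"
    and ne: "v0 \<in> V" "v0 \<noteq> 0"
  shows "\<exists>v\<in>V. norm v = 1 \<and> (\<exists>l. A v = l *\<^sub>R v)"
proof -
  define U where "U = {v\<in>V. norm v = 1}"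
  define l where "l = (SUP v\<in>U. inner (A v) v)"
  have v1: "(1 / norm v) *\<^sub>R v \<in> U" if "v \<in> V" "v \<noteq> 0" for v
    using that V by (auto simp: U_def subspace_scale)
  have bdd: "bdd_above ((\<lambda>v. inner (A v) v) ` U)"
  proof (rule bdd_aboveI2)
    fix v assume "v \<in> U" then show "inner (A v) v \<le> norm A"
      using inner_blinfun_le[of A v] by (simp add: U_def)
  qed
  have le_l: "inner (A v) v \<le> l * (norm v)\<^sup>2" if v: "v \<in> V" for v
  proof (cases "v = 0")
    case False
    have "inner (A ((1 / norm v) *\<^sub>R v)) ((1 / norm v) *\<^sub>R v) \<le> l"
      unfolding l_def by (rule cSUP_upper[OF v1[OF v False] bdd])
    then show ?thesis using False
      by (simp add: blinfun.bilinear_simps field_simps power2_eq_square)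
  qed simp
  have norm_le: "(norm (A v))\<^sup>2 \<le> l * inner (A v) v" if "v \<in> V" for v
    by (rule norm_le_op_seminorm[OF A le_l[OF inv[OF that]]])
  have l0: "0 \<le> l"
    using le_l[OF ne(1)] positive_op_nonneg[OF A, of v0] ne(2)
    by (meson order_trans zero_le_mult_iff zero_less_norm_iff zero_less_power not_less)
  show ?thesis
  proof (cases "l = 0")
    case True
    then have "A v = 0" if "v \<in> V" for v using norm_le[OF that] by simp
    then show ?thesis using v1[OF ne] by (intro bexI[of _ "(1 / norm v0) *\<^sub>R v0"] conjI exI[of _ 0]) (auto simp: U_def)
  next
    case False
    then have l: "l > 0" using l0 by simp
    have "\<exists>v\<in>U. l - 1 / real (Suc n) < inner (A v) v" for n
    proof (rule less_cSUP_iff[THEN iffD1, folded l_def, OF _ bdd])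
      show "U \<noteq> {}" using v1[OF ne] by blast
      have "l - 1 / real (Suc n) < l" by simp
      then show "l - 1 / real (Suc n) < (SUP v\<in>U. inner (A v) v)" unfolding l_def .
    qed
    \<comment> \<open>A maximising sequence consists of approximate eigenvectors; compactness of \<open>A\<close> makes it converge.\<close>
    then obtain v where v: "\<And>n. v n \<in> U" "\<And>n. l - 1 / real (Suc n) < inner (A (v n)) (v n)"
      by metis
    have vn: "norm (v n) = 1" and vV: "v n \<in> V" for n using v(1)[of n] by (auto simp: U_def)
    obtain r w where r: "strict_mono (r::nat\<Rightarrow>nat)" and w: "(\<lambda>n. A (v (r n))) \<longlonglongrightarrow> w"
      using trace_class_compact[OF A B S, of v 1] vn by (auto simp: convergent_def)
    \<comment> \<open>Expanding the square and inserting \<open>norm_le\<close> leaves l times the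
      defect \<open>l - inner (A (v n)) (v n)\<close>.\<close>
    have d: "(norm (A (v n) - l *\<^sub>R v n))\<^sup>2 \<le> l * (1 / real (Suc n))" for n
    proof -
      have "(norm (A (v n) - l *\<^sub>R v n))\<^sup>2 = (norm (A (v n)))\<^sup>2 - 2 * l * inner (A (v n)) (v n) + l\<^sup>2 * (norm (v n))\<^sup>2"
        using inner_commute[of "v n" "A (v n)"]
        by (simp add: power2_norm_eq_inner inner_diff_left inner_diff_right)
          (simp add: power2_eq_square algebra_simps)
      also have "\<dots> \<le> l * (l - inner (A (v n)) (v n))"
        using norm_le[OF vV[of n]] vn[of n] by (simp add: power2_eq_square algebra_simps)
      also have "\<dots> \<le> l * (1 / real (Suc n))"
        using v(2)[of n] l by (intro mult_left_mono) auto
      finally show ?thesis .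
    qed
    have "(\<lambda>n. (norm (A (v n) - l *\<^sub>R v n))\<^sup>2) \<longlonglongrightarrow> 0"
    proof (rule tendsto_sandwich[OF _ _ tendsto_const])
      show "(\<lambda>n. l * (1 / real (Suc n))) \<longlonglongrightarrow> 0"
        using tendsto_mult[OF tendsto_const[of l] lim_inverse_n'[THEN LIMSEQ_Suc]] by simp
    qed (use d in auto)
    then have "(\<lambda>n. sqrt ((norm (A (v n) - l *\<^sub>R v n))\<^sup>2)) \<longlonglongrightarrow> sqrt 0"
      by (rule tendsto_real_sqrt)
    then have "(\<lambda>n. norm (A (v n) - l *\<^sub>R v n)) \<longlonglongrightarrow> 0" by simp
    then have "(\<lambda>n. A (v n) - l *\<^sub>R v n) \<longlonglongrightarrow> 0" by (rule tendsto_norm_zero_cancel)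
    from LIMSEQ_subseq_LIMSEQ[OF this r]
    have "(\<lambda>n. A (v (r n)) - l *\<^sub>R v (r n)) \<longlonglongrightarrow> 0" by (simp add: o_def)
    from tendsto_diff[OF w this] have "(\<lambda>n. l *\<^sub>R v (r n)) \<longlonglongrightarrow> w" by simp
    from tendsto_scaleR[OF tendsto_const[of "1/l"] this]
    have vlim: "(\<lambda>n. v (r n)) \<longlonglongrightarrow> (1/l) *\<^sub>R w" using l by simp
    define u where "u = (1/l) *\<^sub>R w"
    have "u \<in> V" unfolding u_def by (rule closed_sequentially[OF V(1) vV vlim])
    moreover have "norm u = 1"
      using LIMSEQ_unique[OF tendsto_norm[OF vlim, unfolded vn] tendsto_const] by (simp only: u_def)
    moreover have "(\<lambda>n. A (v (r n))) \<longlonglongrightarrow> A u"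
      unfolding u_def by (intro tendsto_intros vlim)
    from LIMSEQ_unique[OF this w] have "A u = l *\<^sub>R u" using l by (simp add: u_def)
    ultimately show ?thesis by blast
  qed
qed

definition eigenbasis :: "('a::real_inner \<Rightarrow>\<^sub>L 'a) \<Rightarrow> 'a set \<Rightarrow> bool" where
  "eigenbasis A B \<longleftrightarrow> hilbert_basis B \<and> (\<forall>e\<in>B. \<exists>l. A e = l *\<^sub>R e)"

lemma eigenbasis_basis: "eigenbasis A B \<Longrightarrow> hilbert_basis B"
  by (simp add: eigenbasis_def)

lemma eigenbasis_eq:
  assumes "eigenbasis A B" "e \<in> B"
  shows "A e = inner (A e) e *\<^sub>R e"
proof -
  from assms obtain l where l: "A e = l *\<^sub>R e"
    by (auto simp: eigenbasis_def)
  have n: "norm e = 1" using assms by (auto simp: eigenbasis_def hilbert_basis_def)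
  have "inner e e = 1" using n by (simp add: dot_square_norm)
  then have "inner (A e) e = l" by (simp add: l)
  then show ?thesis using l by simp
qed

text \<open>A maximal orthonormal set of eigenvectors, obtained from Zorn's lemma, has an invariant
  orthogonal complement; a nonzero vector there would yield one more eigenvector.\<close>

theorem trace_class_eigenbasis:
  fixes A :: "'a::{real_inner,polish_space} \<Rightarrow>\<^sub>L 'a"
  assumes A: "positive_op A" and B: "hilbert_basis B"
    and S: "(\<lambda>e. inner (A e) e) summable_on B"
  shows "\<exists>E. eigenbasis A E"
proof -
  define \<E> where "\<E> = {E. orthonormal E \<and> (\<forall>e\<in>E. \<exists>l. A e = l *\<^sub>R e)}"
  have "\<exists>E\<in>\<E>. \<forall>X\<in>\<E>. E \<subseteq> X \<longrightarrow> X = E"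
  proof (rule subset_Zorn_nonempty)
    show "\<E> \<noteq> {}" by (auto simp: \<E>_def orthonormal_def intro!: exI[of _ "{}"])
    fix C assume "C \<noteq> {}" and C: "subset.chain \<E> C"
    have "orthonormal (\<Union>C)"
      unfolding orthonormal_def
    proof (intro conjI ballI impI)
      fix e assume "e \<in> \<Union>C"
      then show "norm e = 1" using C by (auto simp: subset_chain_def \<E>_def orthonormal_def)
      fix f assume "f \<in> \<Union>C" "e \<noteq> f"
      then obtain X Y where XY: "X \<in> C" "e \<in> X" "Y \<in> C" "f \<in> Y" using \<open>e \<in> \<Union>C\<close> by blast
      then have "X \<subseteq> Y \<or> Y \<subseteq> X" using C unfolding subset_chain_def by blast
      then obtain X where "X \<in> C" "e \<in> X" "f \<in> X" using XY by blast
      then show "inner e f = 0"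
        using C \<open>e \<noteq> f\<close> by (auto simp: subset_chain_def \<E>_def orthonormal_def)
    qed
    then show "\<Union>C \<in> \<E>" using C by (auto simp: subset_chain_def \<E>_def)
  qed
  then obtain E where E: "E \<in> \<E>" and max: "\<And>X. X \<in> \<E> \<Longrightarrow> E \<subseteq> X \<Longrightarrow> X = E" by blast
  have oE: "orthonormal E" and eE: "\<And>e. e \<in> E \<Longrightarrow> \<exists>l. A e = l *\<^sub>R e" using E by (auto simp: \<E>_def)
  define V where "V = {v. \<forall>e\<in>E. inner v e = 0}"
  have V0: "v = 0" if "v \<in> V" for v
  proof (rule ccontr)
    assume "v \<noteq> 0"
    have "V = (\<Inter>e\<in>E. {v. inner v e = 0})" by (auto simp: V_def)
    then have "closed V" by (auto intro!: closed_Collect_eq continuous_intros)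
    moreover have "subspace V" by (auto simp: V_def subspace_def inner_add_left)
    moreover have "A v \<in> V" if "v \<in> V" for v
    proof -
      have "inner (A v) e = 0" if e: "e \<in> E" for e
      proof -
        obtain l where "A e = l *\<^sub>R e" using eE[OF e] by blast
        then show ?thesis using \<open>v \<in> V\<close> e by (simp add: positive_op_sym[OF A] V_def)
      qed
      then show ?thesis by (simp add: V_def)
    qed
    ultimately obtain u where u: "u \<in> V" "norm u = 1" "\<exists>l. A u = l *\<^sub>R u"
      using positive_op_eigenvector[OF A B S _ _ _ \<open>v \<in> V\<close> \<open>v \<noteq> 0\<close>] by blast
    have "inner u e = 0" "inner e u = 0" if "e \<in> E" for e
      using u(1) that inner_commute[of e u] by (auto simp: V_def)
    then have "insert u E \<in> \<E>"
      using u(2,3) oE eE by (auto simp: \<E>_def orthonormal_def)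
    then have "u \<in> E" using max[of "insert u E"] by auto
    then have "inner u u = 0" using u(1) by (auto simp: V_def)
    then show False using u(2) by simp
  qed
  have "x \<in> closure (span E)" for x
  proof -
    note s = bessel_summable[OF oE, of x]
    define y where "y = (\<Sum>\<^sub>\<infinity>e\<in>E. inner x e *\<^sub>R e)"
    have "x - y \<in> V"
      using orthonormal_infsum_inner[OF oE s] by (auto simp: V_def inner_diff_left y_def)
    then have xy: "x = y" using V0 by fastforce
    have lim: "((\<lambda>F. \<Sum>e\<in>F. inner x e *\<^sub>R e) \<longlongrightarrow> y) (finite_subsets_at_top E)"
      using has_sum_infsum[OF orthonormal_summable[OF oE s]] by (simp add: has_sum_def y_def)
    have "(\<Sum>e\<in>F. inner x e *\<^sub>R e) \<in> closure (span E)" if "F \<subseteq> E" for F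
      using that by (intro closure_subset[THEN subsetD] span_sum span_scale) (blast intro: span_base)
    then have "eventually (\<lambda>F. (\<Sum>e\<in>F. inner x e *\<^sub>R e) \<in> closure (span E)) (finite_subsets_at_top E)"
      by (intro eventually_finite_subsets_at_top_weakI)
    then have "y \<in> closure (span E)"
      by (rule Lim_in_closed_set[OF closed_closure _ finite_subsets_at_top_neq_bot lim])
    then show ?thesis by (subst xy)
  qed
  then have "hilbert_basis E" using oE by (auto simp: hilbert_basis_iff)
  then show ?thesis using eE by (auto simp: eigenbasis_def)
qed

section \<open>Square roots, traces and Fredholm determinants\<close>

lemma eigenbasis_inner_has_sum:
  assumes A: "selfadjoint_op A" and B: "eigenbasis A B"
  shows "((\<lambda>e. inner (A e) e * (inner x e * inner y e)) has_sum inner (A x) y) B"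
proof -
  have "inner (A x) e * inner y e = inner (A e) e * (inner x e * inner y e)" if "e \<in> B" for e
  proof -
    have "inner (A x) e = inner x (A e)" using A by (simp add: selfadjoint_op_def)
    also have "\<dots> = inner (A e) e * inner x e"
      by (subst eigenbasis_eq[OF B that]) simp
    finally show ?thesis by simp
  qed
  from has_sum_cong[THEN iffD1, OF this parseval_inner[OF eigenbasis_basis[OF B]]]
  show ?thesis by simp
qed

lemma eigenbasis_positive_op:
  assumes A: "selfadjoint_op A" and B: "eigenbasis A B"
    and nn: "\<And>e. e \<in> B \<Longrightarrow> 0 \<le> inner (A e) e"
  shows "positive_op A"
  unfolding positive_op_def
proof (intro conjI allI A)
  fix x
  show "0 \<le> inner (A x) x"
    using eigenbasis_inner_has_sum[OF A B, of x x] by (rule has_sum_nonneg) (simp add: nn)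
qed

lemma diagonal_op_exists:
  fixes B :: "'a::{real_inner,complete_space} set"
  assumes B: "hilbert_basis B" and g: "\<And>e. e \<in> B \<Longrightarrow> \<bar>g e\<bar> \<le> c"
  shows "\<exists>T. selfadjoint_op T \<and> (\<forall>e\<in>B. T e = g e *\<^sub>R e)"
proof -
  have ob: "orthonormal B" using B by (simp add: hilbert_basis_iff)
  define T where "T x = (\<Sum>\<^sub>\<infinity>e\<in>B. (g e * inner x e) *\<^sub>R e)" for x
  have le: "(g e * inner x e)\<^sup>2 \<le> c\<^sup>2 * (inner x e)\<^sup>2" if "e \<in> B" for e x
    unfolding power_mult_distrib using g[OF that]
    by (intro mult_right_mono) (simp_all add: abs_le_square_iff[symmetric])
  have sm: "(\<lambda>e. (g e * inner x e)\<^sup>2) summable_on B" for x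
    by (rule summable_on_comparison_test[OF summable_on_cmult_right[OF bessel_summable[OF ob, of x], of "c\<^sup>2"]])
       (auto simp: le)
  have T: "inner (T x) e = g e * inner x e" if "e \<in> B" for x e
    unfolding T_def by (rule orthonormal_infsum_inner[OF ob sm that])
  have bl: "bounded_linear T"
  proof (rule bounded_linear_intro)
    show "T (x + y) = T x + T y" for x y
      by (rule hilbert_basis_eqI[OF B]) (simp add: T inner_add_left algebra_simps)
    show "T (r *\<^sub>R x) = r *\<^sub>R T x" for r x
      by (rule hilbert_basis_eqI[OF B]) (simp add: T)
    show "norm (T x) \<le> norm x * \<bar>c\<bar>" for x
    proof (rule power2_le_imp_le)
      have "((\<lambda>e. (g e * inner x e)\<^sup>2) has_sum (norm (T x))\<^sup>2) B"
        using parseval[OF B, of "T x"] by (simp add: T cong: has_sum_cong)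
      moreover have "((\<lambda>e. c\<^sup>2 * (inner x e)\<^sup>2) has_sum c\<^sup>2 * (norm x)\<^sup>2) B"
        by (intro has_sum_cmult_right parseval[OF B])
      ultimately have "(norm (T x))\<^sup>2 \<le> c\<^sup>2 * (norm x)\<^sup>2"
        by (rule has_sum_mono) (rule le)
      then show "(norm (T x))\<^sup>2 \<le> (norm x * \<bar>c\<bar>)\<^sup>2" by (simp add: power_mult_distrib mult.commute)
    qed simp
  qed
  define T' where "T' = Blinfun T"
  have T': "blinfun_apply T' = T" unfolding T'_def by (rule bounded_linear_Blinfun_apply[OF bl])
  have "inner (T x) y = inner x (T y)" for x y
  proof -
    have "((\<lambda>e. g e * inner x e * inner y e) has_sum inner (T x) y) B"
      using parseval_inner[OF B, of "T x" y] by (simp add: T cong: has_sum_cong)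
    moreover have "((\<lambda>e. g e * inner x e * inner y e) has_sum inner x (T y)) B"
      using parseval_inner[OF B, of x "T y"] by (simp add: T mult.left_commute mult.assoc cong: has_sum_cong)
    ultimately show ?thesis by (rule has_sum_unique)
  qed
  moreover have "T e = g e *\<^sub>R e" if "e \<in> B" for e
    by (rule hilbert_basis_eqI[OF B]) (use that orthonormal_inner[OF ob] in \<open>auto simp: T\<close>)
  ultimately show ?thesis using T' by (intro exI[of _ T']) (simp add: selfadjoint_op_def)
qed

text \<open>\<open>S\<close> multiplies the difference \<open>f\<close> by \<open>- sqrt l\<close>,
  which positivity allows only for \<open>f = 0\<close> if \<open>l > 0\<close>; for
  \<open>l = 0\<close> the squared norm of \<open>S e\<close> is
  \<open>inner (S (S e)) e = 0\<close>. Every positive square root is thus fixed on an eigenbasis,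
  which makes the description in \<open>op_sqrt\<close> unique.\<close>

lemma positive_sqrt_eigenvector:
  assumes S: "positive_op S" and SS: "S o\<^sub>L S = A" and e: "A e = l *\<^sub>R e" "0 \<le> l"
  shows "S e = sqrt l *\<^sub>R e"
proof -
  define f where "f = S e - sqrt l *\<^sub>R e"
  have SSe: "S (S e) = l *\<^sub>R e" using SS e(1) by (metis blinfun_apply_blinfun_compose)
  have "S f = (- sqrt l) *\<^sub>R f"
    using e(2) by (simp add: f_def blinfun.bilinear_simps SSe algebra_simps)
  then have "inner (S f) f = - sqrt l * inner f f" by simp
  with positive_op_nonneg[OF S, of f] have 1: "sqrt l * inner f f \<le> 0" by simp
  show ?thesis
  proof (cases "l = 0")
    case True
    have "inner (S e) (S e) = inner (S (S e)) e" using positive_op_sym[OF S] by metis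
    then show ?thesis using True SSe by simp
  next
    case False
    then have "inner f f \<le> 0" using 1 e(2) by (simp add: mult_le_0_iff)
    then have "f = 0" using inner_gt_zero_iff[of f] by linarith
    then show ?thesis by (simp add: f_def)
  qed
qed

lemma eigenvalue_bound:
  assumes "eigenbasis A B" "e \<in> B"
  shows "inner (A e) e \<le> norm A"
proof -
  have "norm e = 1" using assms by (auto simp: eigenbasis_def hilbert_basis_def)
  then show ?thesis using inner_blinfun_le[of A e] by simp
qed

lemma op_sqrt_eigenbasis:
  fixes A :: "'a::{real_inner,complete_space} \<Rightarrow>\<^sub>L 'a"
  assumes A: "positive_op A" and B: "eigenbasis A B"
  shows "positive_op (op_sqrt A)" (is ?pos) and "op_sqrt A o\<^sub>L op_sqrt A = A" (is ?sq)
    and "e \<in> B \<Longrightarrow> op_sqrt A e = sqrt (inner (A e) e) *\<^sub>R e"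
proof -
  note nn = positive_op_nonneg[OF A]
  have "\<bar>sqrt (inner (A e) e)\<bar> \<le> sqrt (norm A)" if "e \<in> B" for e
    using eigenvalue_bound[OF B that] nn[of e] by simp
  from diagonal_op_exists[where g = "\<lambda>e. sqrt (inner (A e) e)", OF eigenbasis_basis[OF B] this]
  obtain S where S: "selfadjoint_op S" and Se: "\<And>e. e \<in> B \<Longrightarrow> S e = sqrt (inner (A e) e) *\<^sub>R e"
    by blast
  have "eigenbasis S B" using eigenbasis_basis[OF B] Se by (auto simp: eigenbasis_def)
  then have pS: "positive_op S"
    by (rule eigenbasis_positive_op[OF S]) (simp add: Se nn)
  have "S o\<^sub>L S = A"
  proof (rule blinfun_eqI_hilbert_basis[OF eigenbasis_basis[OF B]])
    fix e assume e: "e \<in> B"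
    then have "(S o\<^sub>L S) e = inner (A e) e *\<^sub>R e"
      using nn[of e] by (simp add: Se blinfun.bilinear_simps)
    then show "(S o\<^sub>L S) e = A e" using eigenbasis_eq[OF B e] by simp
  qed
  moreover have "R = S" if R: "positive_op R \<and> R o\<^sub>L R = A" for R
  proof (rule blinfun_eqI_hilbert_basis[OF eigenbasis_basis[OF B]])
    fix e assume e: "e \<in> B"
    show "R e = S e"
      using positive_sqrt_eigenvector[of R A e "inner (A e) e"] R eigenbasis_eq[OF B e] nn[of e] Se[OF e]
      by simp
  qed
  ultimately have eq: "op_sqrt A = S"
    unfolding op_sqrt_def using pS by (intro the_equality conjI)
  show ?pos ?sq "e \<in> B \<Longrightarrow> op_sqrt A e = sqrt (inner (A e) e) *\<^sub>R e"
    unfolding eq by (fact pS, fact \<open>S o\<^sub>L S = A\<close>, rule Se)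
qed

text \<open>With \<open>R\<close> the square root, \<open>inner (A e) e\<close> is the squared norm
  of \<open>R e\<close>; expanding it in \<open>B'\<close> gives a double array whose row and column
  sums are the two diagonals. This frees \<open>op_trace\<close> from the arbitrary choice of
  basis.\<close>

lemma trace_has_sum:
  fixes A :: "'a::{real_inner,complete_space} \<Rightarrow>\<^sub>L 'a"
  assumes A: "positive_op A" and E: "eigenbasis A E"
    and B: "hilbert_basis B" and S: "((\<lambda>e. inner (A e) e) has_sum S) B" and B': "hilbert_basis B'"
  shows "((\<lambda>f. inner (A f) f) has_sum S) B'"
proof -
  define R where "R = op_sqrt A"
  note R = op_sqrt_eigenbasis(1,2)[OF A E, folded R_def]
  have RR: "inner (A x) x = (norm (R x))\<^sup>2" for x
  proof -
    have "A x = R (R x)" using R(2) by (metis blinfun_apply_blinfun_compose)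
    then show ?thesis by (simp add: positive_op_sym[OF R(1)] power2_norm_eq_inner)
  qed
  show ?thesis
  proof (rule has_sum_swap_nonneg[where f = "\<lambda>e f. (inner (R e) f)\<^sup>2", OF _ S])
    show "((\<lambda>f. (inner (R e) f)\<^sup>2) has_sum inner (A e) e) B'" for e
      unfolding RR by (rule parseval[OF B'])
    show "((\<lambda>e. (inner (R e) f)\<^sup>2) has_sum inner (A f) f) B" for f
    proof -
      have "inner (R e) f = inner (R f) e" for e
        using positive_op_sym[OF R(1), of e f] inner_commute[of e "R f"] by (rule trans)
      then show ?thesis using parseval[OF B, of "R f"] by (simp add: RR)
    qed
  qed simp
qed

lemma op_trace_eigenbasis:
  fixes A :: "'a::{real_inner,complete_space} \<Rightarrow>\<^sub>L 'a"
  assumes A: "positive_op A" and B: "eigenbasis A B" and S: "((\<lambda>e. inner (A e) e) has_sum S) B"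
  shows "op_trace A = S"
  unfolding op_trace_def
  by (intro infsumI trace_has_sum[OF A B eigenbasis_basis[OF B] S] someI[of hilbert_basis, OF eigenbasis_basis[OF B]])

text \<open>The description in \<open>fredholm_det\<close> ranges over all eigenbases, so any two of
  them must be shown to give the same sum.\<close>

lemma ln_fredholm_det_eigenbasis:
  assumes A: "positive_op A" and B: "eigenbasis A B" and S: "((\<lambda>e. ln (1 + inner (A e) e)) has_sum S) B"
  shows "ln (fredholm_det (id_blinfun + A)) = S"
proof -
  have "fredholm_det (id_blinfun + A) = exp S"
    unfolding fredholm_det_def add_diff_cancel_left'
  proof (rule the_equality)
    show "\<exists>B. hilbert_basis B \<and> (\<forall>e\<in>B. \<exists>l. A e = l *\<^sub>R e) \<and> exp S = exp (\<Sum>\<^sub>\<infinity>e\<in>B. ln (1 + inner (A e) e))"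
      using B infsumI[OF S] by (auto simp: eigenbasis_def)
  next
    fix d
    assume "\<exists>B. hilbert_basis B \<and> (\<forall>e\<in>B. \<exists>l. A e = l *\<^sub>R e) \<and> d = exp (\<Sum>\<^sub>\<infinity>e\<in>B. ln (1 + inner (A e) e))"
    then obtain B' where B': "eigenbasis A B'" and d: "d = exp (\<Sum>\<^sub>\<infinity>e\<in>B'. ln (1 + inner (A e) e))"
      by (auto simp: eigenbasis_def)
    have "((\<lambda>e. ln (1 + inner (A e) e)) has_sum S) B'"
    proof (rule has_sum_basis_change[OF eigenbasis_basis[OF B] eigenbasis_basis[OF B'] S])
      show "0 \<le> ln (1 + inner (A e) e)" for e using positive_op_nonneg[OF A, of e] by simp
    next
      fix f assume f: "f \<in> B'"
      \<comment> \<open>Eigenvectors for different eigenvalues are orthogonal, so a nonzero weight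
        forces equal eigenvalues.\<close>
      have eq: "ln (1 + inner (A f) f) * (inner f e)\<^sup>2 = ln (1 + inner (A e) e) * (inner f e)\<^sup>2" if e: "e \<in> B" for e
      proof (cases "inner f e = 0")
        case False
        have "inner (A f) e = inner (A f) f * inner f e" by (subst eigenbasis_eq[OF B' f]) simp
        moreover have "inner f (A e) = inner (A e) e * inner f e" by (subst eigenbasis_eq[OF B e]) simp
        ultimately have "inner (A f) f = inner (A e) e" using positive_op_sym[OF A, of f e] False by simp
        then show ?thesis by simp
      qed simp
      have "norm f = 1" using B' f by (auto simp: eigenbasis_def hilbert_basis_def)
      then have hs: "((\<lambda>e. ln (1 + inner (A f) f) * (inner f e)\<^sup>2) has_sum ln (1 + inner (A f) f) * 1) B"
        using parseval[OF eigenbasis_basis[OF B], of f] by (intro has_sum_cmult_right) simp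
      show "((\<lambda>e. ln (1 + inner (A e) e) * (inner f e)\<^sup>2) has_sum ln (1 + inner (A f) f)) B"
        using has_sum_cong[THEN iffD1, OF eq hs] by simp
    qed
    then show "d = exp S" using d infsumI by blast
  qed
  then show ?thesis by simp
qed

text \<open>Turns an unordered sum into a series over the naturals whatever the cardinality of
  \<open>P\<close>: indices that name no element of \<open>P\<close> are sent to 0, where
  \<open>g\<close> vanishes.\<close>

lemma enumerate_support:
  fixes B :: "'a::{zero} set"
  assumes "countable B" and "P \<subseteq> B" and "0 \<notin> P"
  obtains e :: "nat \<Rightarrow> 'a" where "\<And>k. e k \<in> P \<or> e k = 0"
    and "\<And>k l. e k \<in> P \<Longrightarrow> e k = e l \<Longrightarrow> k = l"
    and "\<And>(g :: 'a \<Rightarrow> real) S. (g has_sum S) B \<Longrightarrow> (\<And>x. x \<in> B - P \<Longrightarrow> g x = 0) \<Longrightarrow> g 0 = 0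
      \<Longrightarrow> (\<lambda>k. g (e k)) sums S"
proof -
  have cP: "countable P" using assms(1,2) by (rule countable_subset[rotated])
  define i where "i = to_nat_on P"
  have inj: "inj_on i P" unfolding i_def by (rule inj_on_to_nat_on[OF cP])
  define e where "e k = (if k \<in> i ` P then inv_into P i k else 0)" for k
  have bij: "bij_betw e (i ` P) P"
  proof -
    have "bij_betw (inv_into P i) (i ` P) P" using inj by (simp add: bij_betw_inv_into inj_on_imp_bij_betw)
    then show ?thesis by (rule bij_betw_cong[THEN iffD1, rotated]) (simp add: e_def)
  qed
  have eP: "e k \<in> P \<longleftrightarrow> k \<in> i ` P" for k
    using assms(3) by (auto simp: e_def inv_into_into)
  show thesis
  proof (rule that[of e])
    fix k show "e k \<in> P \<or> e k = 0" using eP by (auto simp: e_def)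
    fix l assume "e k \<in> P" "e k = e l"
    then show "k = l" using bij eP unfolding bij_betw_def inj_on_def by metis
  next
    fix g :: "'a \<Rightarrow> real" and S assume g: "(g has_sum S) B" "\<And>x. x \<in> B - P \<Longrightarrow> g x = 0" "g 0 = 0"
    have "(g has_sum S) P"
      using g(1) by (rule has_sum_cong_neutral[THEN iffD1, rotated -1]) (use g(2) assms in auto)
    then have "((\<lambda>k. g (e k)) has_sum S) (i ` P)"
      using has_sum_reindex_bij_betw[OF bij, of g S] by simp
    then have "((\<lambda>k. g (e k)) has_sum S) UNIV"
      by (rule has_sum_cong_neutral[THEN iffD1, rotated -1]) (use g(3) in \<open>auto simp: e_def\<close>)
    then show "(\<lambda>k. g (e k)) sums S" by (rule has_sum_imp_sums)
  qed
qed

section \<open>Simultaneous coordinates for two covariance operators\<close>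

lemma summable_on_eigenbasis:
  fixes A :: "'a::real_inner \<Rightarrow>\<^sub>L 'a"
  assumes l: "(\<lambda>e. inner (A e) e) summable_on E" and nn: "\<And>e. e \<in> E \<Longrightarrow> 0 \<le> g (inner (A e) e)"
    and le: "\<And>t. 0 \<le> t \<Longrightarrow> g t \<le> c * t" and A: "positive_op A"
  shows "(\<lambda>e. g (inner (A e) e)) summable_on E"
  by (rule summable_on_comparison_test[OF summable_on_cmult_right[OF l, of c]])
     (use le nn positive_op_nonneg[OF A] in auto)

text \<open>The eigenvalue of \<open>M_eps\<close> belonging to the eigenvalue \<open>t\<close> of
  the operator under its square root. For \<open>t \<ge> 0\<close> it is the nonnegative solution r
  of r (r + 2) = 16 t / \<epsilon>^2, the form in which it meets the Mehler kernel.\<close>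

definition entropic_rate :: "real \<Rightarrow> real \<Rightarrow> real" where
  "entropic_rate \<epsilon> t = sqrt (1 + 16 / \<epsilon>\<^sup>2 * t) - 1"

lemma entropic_rate_0 [simp]: "entropic_rate \<epsilon> 0 = 0"
  by (simp add: entropic_rate_def)

lemma entropic_rate_nonneg: "0 \<le> t \<Longrightarrow> 0 \<le> entropic_rate \<epsilon> t"
  by (simp add: entropic_rate_def)

text \<open>The tangent at 0 of a concave function. Linear growth carries summability over from the
  eigenvalues \<open>t\<close>.\<close>

lemma entropic_rate_le:
  assumes "0 \<le> t"
  shows "entropic_rate \<epsilon> t \<le> 8 / \<epsilon>\<^sup>2 * t"
proof -
  have "1 + 16 / \<epsilon>\<^sup>2 * t \<le> (1 + 8 / \<epsilon>\<^sup>2 * t)\<^sup>2"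
    by (simp add: power2_sum)
  then have "sqrt (1 + 16 / \<epsilon>\<^sup>2 * t) \<le> 1 + 8 / \<epsilon>\<^sup>2 * t"
    by (intro real_le_lsqrt) (use assms in \<open>auto intro!: add_nonneg_nonneg\<close>)
  then show ?thesis by (simp add: entropic_rate_def)
qed

lemma M_eps_eigenbasis:
  fixes C0 C1 :: "'a::{real_inner,complete_space} \<Rightarrow>\<^sub>L 'a"
  defines "K \<equiv> op_sqrt C0 o\<^sub>L C1 o\<^sub>L op_sqrt C0"
  assumes K: "positive_op K" and E: "eigenbasis K E"
  shows "positive_op (M_eps \<epsilon> C0 C1)" and "eigenbasis (M_eps \<epsilon> C0 C1) E"
    and "e \<in> E \<Longrightarrow> inner (M_eps \<epsilon> C0 C1 e) e = entropic_rate \<epsilon> (inner (K e) e)"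
proof -
  let ?M = "M_eps \<epsilon> C0 C1"
  define L where "L = id_blinfun + (16 / \<epsilon>\<^sup>2) *\<^sub>R K"
  have M: "?M = - id_blinfun + op_sqrt L" by (simp add: M_eps_def L_def K_def)
  have Lx: "L x = x + (16 / \<epsilon>\<^sup>2) *\<^sub>R K x" for x by (simp add: L_def blinfun.bilinear_simps)
  have ee: "inner e e = 1" if "e \<in> E" for e
    using E that by (auto simp: eigenbasis_def hilbert_basis_def dot_square_norm)
  have pL: "positive_op L"
    using K by (auto simp: positive_op_def selfadjoint_op_def Lx inner_add_left inner_add_right)
  have Le: "L e = (1 + 16 / \<epsilon>\<^sup>2 * inner (K e) e) *\<^sub>R e" if "e \<in> E" for e
    using eigenbasis_eq[OF E that] unfolding Lx by (metis scaleR_add_left scaleR_one scaleR_scaleR)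
  then have EL: "eigenbasis L E" using E by (auto simp: eigenbasis_def)
  have Lee: "inner (L e) e = 1 + 16 / \<epsilon>\<^sup>2 * inner (K e) e" if "e \<in> E" for e
    by (simp add: Le[OF that] ee[OF that])
  note sL = op_sqrt_eigenbasis[OF pL EL]
  have Me: "?M e = entropic_rate \<epsilon> (inner (K e) e) *\<^sub>R e" if "e \<in> E" for e
    unfolding M
    by (simp add: blinfun.bilinear_simps sL(3)[OF that] Lee[OF that] entropic_rate_def algebra_simps)
  show Mee: "inner (?M e) e = entropic_rate \<epsilon> (inner (K e) e)" if "e \<in> E" for e
    by (simp add: Me[OF that] ee[OF that])
  show EM: "eigenbasis ?M E" using E Me by (auto simp: eigenbasis_def)
  have "selfadjoint_op ?M"
    using sL(1) unfolding M by (simp add: positive_op_def selfadjoint_op_def blinfun.bilinear_simps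
        inner_add_left inner_add_right inner_diff_left inner_diff_right)
  then show "positive_op ?M"
    by (rule eigenbasis_positive_op[OF _ EM])
       (simp add: Mee entropic_rate_nonneg positive_op_nonneg[OF K])
qed

lemma positive_op_scaleR:
  assumes "positive_op A" and "0 \<le> c"
  shows "positive_op (c *\<^sub>R A)"
  unfolding positive_op_def selfadjoint_op_def
proof (intro conjI allI)
  have cA: "(c *\<^sub>R A) x = c *\<^sub>R A x" for x by (simp add: blinfun.bilinear_simps)
  show "inner ((c *\<^sub>R A) x) y = inner x ((c *\<^sub>R A) y)" for x y
    by (simp add: cA positive_op_sym[OF assms(1)])
  show "0 \<le> inner ((c *\<^sub>R A) x) x" for x
    unfolding cA inner_scaleR_left by (intro mult_nonneg_nonneg assms(2) positive_op_nonneg[OF assms(1)])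
qed

text \<open>The \<open>s k\<close> are the nonzero singular values of the product of the square
  roots of \<open>C1\<close> and \<open>C0\<close>, padded with zeros if there are finitely many.
  The relation between \<open>a k\<close> and \<open>b k\<close> makes
  \<open>s k * inner y (b k)\<close> the coefficient of \<open>y\<close> along \<open>a k\<close>
  for the form of \<open>C0\<close>; the expansion of the mixed term rests on this.\<close>

theorem canonical_pairs:
  fixes C0 C1 :: "'a::{real_inner,polish_space} \<Rightarrow>\<^sub>L 'a"
  assumes C0: "trace_class_pos C0" and C1: "positive_op C1"
  obtains S B T s a b where "positive_op S" "S o\<^sub>L S = C0" "hilbert_basis B"
    "((\<lambda>e. inner (C1 (S e)) (S e)) has_sum T) B" "(\<lambda>k. (s k)\<^sup>2) sums T"
    "\<And>k. C0 (a k) = s k *\<^sub>R b k"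
    "\<And>k l. inner (C0 (a k)) (a l) = (if k = l \<and> s k \<noteq> 0 then 1 else 0)"
    "\<And>k l. inner (C1 (b k)) (b l) = (if k = l \<and> s k \<noteq> 0 then 1 else 0)"
    "(\<lambda>k::nat. entropic_rate \<epsilon> ((s k)\<^sup>2)) sums op_trace (M_eps \<epsilon> C0 C1)"
    "(\<lambda>k. ln (1 + entropic_rate \<epsilon> ((s k)\<^sup>2) / 2))
       sums ln (fredholm_det (id_blinfun + (1/2) *\<^sub>R M_eps \<epsilon> C0 C1))"
proof -
  from C0 obtain B0 where p0: "positive_op C0" and B0: "hilbert_basis B0"
    and sum0: "(\<lambda>e. inner (C0 e) e) summable_on B0" by (auto simp: trace_class_pos_def)
  from trace_class_eigenbasis[OF p0 B0 sum0] obtain E0 where E0: "eigenbasis C0 E0" by blast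
  define S where "S = op_sqrt C0"
  note S = op_sqrt_eigenbasis(1,2)[OF p0 E0, folded S_def]
  have SS: "S (S x) = C0 x" for x using S(2) by (metis blinfun_apply_blinfun_compose)
  define K where "K = S o\<^sub>L C1 o\<^sub>L S"
  have Kx: "K x = S (C1 (S x))" for x by (simp add: K_def)
  have Kxy: "inner (K x) y = inner (C1 (S x)) (S y)" for x y
    by (simp add: Kx positive_op_sym[OF S(1)])
  have pK: "positive_op K"
    unfolding positive_op_def selfadjoint_op_def
  proof (intro conjI allI)
    show "inner (K x) y = inner x (K y)" for x y
      by (simp add: Kx positive_op_sym[OF S(1)] positive_op_sym[OF C1])
    show "0 \<le> inner (K x) x" for x unfolding Kxy by (rule positive_op_nonneg[OF C1])
  qed
  have "(\<lambda>e. inner (K e) e) summable_on B0"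
  proof (rule summable_on_comparison_test[OF summable_on_cmult_right[OF sum0, of "norm C1"]])
    fix e show "inner (K e) e \<le> norm C1 * inner (C0 e) e"
      using inner_blinfun_le[of C1 "S e"]
      by (simp add: Kxy SS[symmetric] positive_op_sym[OF S(1)] power2_norm_eq_inner)
  qed (simp add: positive_op_nonneg[OF pK])
  note sK0 = this
  from trace_class_eigenbasis[OF pK B0 sK0] obtain E where E: "eigenbasis K E" by blast
  have hE: "hilbert_basis E" and oE: "orthonormal E"
    using E by (auto simp: eigenbasis_def hilbert_basis_iff)
  have sK: "(\<lambda>e. inner (K e) e) summable_on E"
    using trace_has_sum[OF pK E B0 has_sum_infsum[OF sK0] hE] by (auto simp: summable_on_def)
  define T where "T = (\<Sum>\<^sub>\<infinity>e\<in>E. inner (K e) e)"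
  have T: "((\<lambda>e. inner (K e) e) has_sum T) E" using sK by (simp add: T_def)
  let ?M = "M_eps \<epsilon> C0 C1"
  note Mfacts = M_eps_eigenbasis[where ?C0.0 = C0 and ?C1.0 = C1 and E = E and \<epsilon> = \<epsilon>, folded S_def, folded K_def, OF pK E]
  let ?r = "\<lambda>e. entropic_rate \<epsilon> (inner (K e) e)"
  have "?r summable_on E"
    by (rule summable_on_eigenbasis[OF sK _ entropic_rate_le pK])
       (simp_all add: entropic_rate_nonneg positive_op_nonneg[OF pK])
  then obtain t where t: "(?r has_sum t) E" by (auto simp: summable_on_def)
  have trM: "op_trace ?M = t"
    using t by (intro op_trace_eigenbasis[OF Mfacts(1,2)]) (simp add: Mfacts(3) cong: has_sum_cong)
  have r2: "0 \<le> entropic_rate \<epsilon> u / 2" if "0 \<le> u" for u using entropic_rate_nonneg[OF that] by simp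
  have "(\<lambda>e. ln (1 + ?r e / 2)) summable_on E"
  proof (rule summable_on_eigenbasis[OF sK, where g = "\<lambda>u. ln (1 + entropic_rate \<epsilon> u / 2)", OF _ _ pK])
    fix u :: real assume u: "0 \<le> u"
    have "ln (1 + entropic_rate \<epsilon> u / 2) \<le> entropic_rate \<epsilon> u / 2"
      using r2[OF u] by (intro ln_add_one_self_le_self)
    also have "\<dots> \<le> 8 / \<epsilon>\<^sup>2 * u" using entropic_rate_le[OF u, of \<epsilon>] r2[OF u] by simp
    finally show "ln (1 + entropic_rate \<epsilon> u / 2) \<le> 8 / \<epsilon>\<^sup>2 * u" .
  qed (use r2 positive_op_nonneg[OF pK] in simp)
  then obtain d where d: "((\<lambda>e. ln (1 + ?r e / 2)) has_sum d) E" by (auto simp: summable_on_def)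
  have "positive_op ((1/2) *\<^sub>R ?M)"
    by (rule positive_op_scaleR[OF Mfacts(1)]) simp
  moreover have "eigenbasis ((1/2) *\<^sub>R ?M) E"
    using Mfacts(2) unfolding eigenbasis_def by (metis blinfun.scaleR_left scaleR_scaleR)
  ultimately have detM: "ln (fredholm_det (id_blinfun + (1/2) *\<^sub>R ?M)) = d"
    using d by (intro ln_fredholm_det_eigenbasis)
      (auto simp: blinfun.bilinear_simps Mfacts(3) cong: has_sum_cong)
  define P where "P = {e\<in>E. K e \<noteq> 0}"
  have "0 \<notin> P" by (simp add: P_def)
  have cE: "countable E" by (rule orthonormal_countable[OF oE])
  have "P \<subseteq> E" by (auto simp: P_def)
  \<comment> \<open>Only eigenvectors with nonzero eigenvalue are enumerated; if there are finitely many, \<open>e\<close> is padded with 0.\<close>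
  obtain e :: "nat \<Rightarrow> 'a" where
    e: "\<And>k. e k \<in> P \<or> e k = 0" and einj: "\<And>k l. e k \<in> P \<Longrightarrow> e k = e l \<Longrightarrow> k = l"
    and esums: "\<And>(g :: 'a \<Rightarrow> real) S. (g has_sum S) E \<Longrightarrow> (\<And>x. x \<in> E - P \<Longrightarrow> g x = 0) \<Longrightarrow> g 0 = 0
      \<Longrightarrow> (\<lambda>k. g (e k)) sums S"
    by (fact enumerate_support[OF cE \<open>P \<subseteq> E\<close> \<open>0 \<notin> P\<close>])
  define s where "s k = sqrt (inner (K (e k)) (e k))" for k
  have s2: "(s k)\<^sup>2 = inner (K (e k)) (e k)" for k by (simp add: s_def positive_op_nonneg[OF pK])
  have Ke: "K (e k) = (s k)\<^sup>2 *\<^sub>R e k" for k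
    using e[of k] eigenbasis_eq[OF E, of "e k"] by (auto simp: s2 P_def)
  have s0: "s k \<noteq> 0 \<longleftrightarrow> e k \<in> P" for k
  proof
    assume "e k \<in> P"
    then have "K (e k) \<noteq> 0" by (simp add: P_def)
    then show "s k \<noteq> 0" using Ke[of k] by auto
  next
    assume "s k \<noteq> 0"
    then have "e k \<noteq> 0" by (auto simp: s_def)
    then show "e k \<in> P" using e by blast
  qed
  have ek: "e k = 0" if "s k = 0" for k using s0[of k] e[of k] that by blast
  have ee: "inner (e k) (e l) = (if k = l \<and> s k \<noteq> 0 then 1 else 0)" for k l
  proof (cases "s k = 0 \<or> s l = 0")
    case True then show ?thesis using ek[of k] ek[of l] by auto
  next
    case False
    then have "e k \<in> P" "e l \<in> P" using s0 by auto
    then have "e k \<in> E" "e l \<in> E" by (auto simp: P_def)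
    then show ?thesis using orthonormal_inner[OF oE] False einj[OF \<open>e k \<in> P\<close>, of l] by auto
  qed
  \<comment> \<open>The vector \<open>a k\<close> plays the role of \<open>S\<close> inverse applied to \<open>e k\<close>: an eigenvector of \<open>K\<close> for a nonzero
    eigenvalue lies in the range of \<open>S\<close>, so no unbounded inverse is needed.\<close>
  define a where "a k = (1 / (s k)\<^sup>2) *\<^sub>R C1 (S (e k))" for k
  \<comment> \<open>Since \<open>1 / 0 = 0\<close>, both \<open>a k\<close> and \<open>b k\<close>
    vanish at padded indices.\<close>
  define b where "b k = (1 / s k) *\<^sub>R S (e k)" for k
  have Sa: "S (a k) = e k" for k
    using Ke[of k] ek[of k] by (cases "s k = 0") (auto simp: a_def blinfun.bilinear_simps Kx)
  have C0a: "C0 (a k) = s k *\<^sub>R b k" for k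
    using ek[of k] by (cases "s k = 0") (auto simp: b_def Sa SS[symmetric] blinfun.bilinear_simps)
  have aa: "inner (C0 (a k)) (a l) = (if k = l \<and> s k \<noteq> 0 then 1 else 0)" for k l
    by (simp only: SS[symmetric] positive_op_sym[OF S(1)] Sa ee)
  have bb: "inner (C1 (b k)) (b l) = (if k = l \<and> s k \<noteq> 0 then 1 else 0)" for k l
  proof -
    have "inner (C1 (b k)) (b l) = (1 / (s k * s l)) * inner (K (e k)) (e l)"
      by (simp add: b_def blinfun.bilinear_simps Kxy)
    also have "\<dots> = (1 / (s k * s l)) * ((s k)\<^sup>2 * (if k = l \<and> s k \<noteq> 0 then 1 else 0))"
      by (simp only: Ke inner_scaleR_left ee)
    finally show ?thesis by (cases "k = l"; cases "s k = 0") (simp_all add: power2_eq_square)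
  qed
  have z: "K x = 0" if "x \<in> E - P" for x using that by (auto simp: P_def)
  show ?thesis
  proof (rule that[of S E T s a b])
    show "((\<lambda>e. inner (C1 (S e)) (S e)) has_sum T) E" using T by (simp add: Kxy)
    show "(\<lambda>k. (s k)\<^sup>2) sums T" unfolding s2 by (rule esums[OF T]) (simp_all add: z)
    show "(\<lambda>k. entropic_rate \<epsilon> ((s k)\<^sup>2)) sums op_trace ?M"
      unfolding s2 trM by (rule esums[OF t]) (simp_all add: z)
    show "(\<lambda>k. ln (1 + entropic_rate \<epsilon> ((s k)\<^sup>2) / 2)) sums ln (fredholm_det (id_blinfun + (1/2) *\<^sub>R ?M))"
      unfolding s2 detM by (rule esums[OF d]) (simp_all add: z)
  qed (fact S hE C0a aa bb)+
qed

section \<open>Independence from characteristic functions\<close>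

text \<open>In effect the conditional expectation of \<open>h\<close> given \<open>X\<close> is the
  constant \<open>c\<close>. Because \<open>h\<close> enters through a change of measure, Levy's
  uniqueness theorem on the line suffices.\<close>

lemma (in prob_space) char_weight_real:
  fixes h :: "'a \<Rightarrow> real" and X :: "'a \<Rightarrow> real"
  assumes h [measurable]: "h \<in> borel_measurable M" and hb: "\<And>x. \<bar>h x\<bar> \<le> 1"
    and X [measurable]: "X \<in> borel_measurable M" and A [measurable]: "A \<in> sets borel"
    and eq: "\<And>s. (CLINT x|M. of_real (h x) * iexp (s * X x)) = of_real c * (CLINT x|M. iexp (s * X x))"
  shows "(LINT x|M. h x * indicator A (X x)) = c * prob {x\<in>space M. X x \<in> A}"
proof -
  have int_h [intro, simp]: "integrable M h"
    by (rule integrable_const_bound[of _ 1]) (simp_all add: hb)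
  have c: "(LINT x|M. h x) = c"
    using eq[of 0] by (simp add: prob_space)
  have "(LINT x|M. -1) \<le> (LINT x|M. h x)"
  proof (rule integral_mono)
    show "-1 \<le> h x" for x using hb[of x] by linarith
  qed simp_all
  then have c1: "2 + c > 0" using c by (simp add: prob_space)
  \<comment> \<open>Shifting \<open>h\<close> makes it a probability density under which \<open>X\<close> keeps its characteristic function.\<close>
  define w where "w x = (2 + h x) / (2 + c)" for x
  have w0: "0 \<le> w x" for x using hb[of x] c1 by (simp add: w_def)
  have w_m [measurable]: "w \<in> borel_measurable M" unfolding w_def by measurable
  have int_w: "integrable M w" unfolding w_def by simp
  have Ew: "(LINT x|M. w x) = 1"
    unfolding w_def using c c1 by (simp add: prob_space)
  define N where "N = density M w"
  interpret N: prob_space N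
  proof
    show "emeasure N (space N) = 1"
      unfolding N_def by (simp add: emeasure_density nn_integral_eq_integral[OF int_w] w0 Ew cong: nn_integral_cong)
  qed
  have XN [measurable]: "X \<in> borel_measurable N" by (simp add: N_def)
  have bdd: "integrable M (\<lambda>x. iexp (s * X x))" "integrable M (\<lambda>x. of_real (h x) * iexp (s * X x))" for s
    by (rule integrable_const_bound[of _ 1]; simp add: norm_mult hb)+
  have "char (distr N borel X) s = char (distr M borel X) s" for s
  proof -
    have "char (distr N borel X) s = (CLINT x|M. w x *\<^sub>R iexp (s * X x))"
      unfolding char_def N_def
      by (simp add: integral_distr integral_density w0)
    also have "\<dots> = (CLINT x|M. (2 * iexp (s * X x) + of_real (h x) * iexp (s * X x)) / of_real (2 + c))"
      by (intro Bochner_Integration.integral_cong) (simp_all add: w_def scaleR_conv_of_real algebra_simps)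
    also have "\<dots> = (2 * (CLINT x|M. iexp (s * X x)) + of_real c * (CLINT x|M. iexp (s * X x))) / of_real (2 + c)"
      using bdd[of s] eq[of s] by simp
    also have "\<dots> = (CLINT x|M. iexp (s * X x))"
    proof -
      have "complex_of_real (2 + c) \<noteq> 0" using c1 by (simp only: of_real_eq_0_iff)
      then show ?thesis by (simp add: field_simps)
    qed
    finally show ?thesis by (simp add: char_def integral_distr)
  qed
  then have "distr N borel X = distr M borel X"
    by (intro Levy_uniqueness N.real_distribution_distr real_distribution_distr ext) auto
  then have "measure (distr N borel X) A = measure (distr M borel X) A" by simp
  then have "measure N {x\<in>space M. X x \<in> A} = prob {x\<in>space M. X x \<in> A}"
    by (simp add: measure_distr vimage_def Int_def conj_commute) (simp add: N_def)
  moreover have "measure N {x\<in>space M. X x \<in> A} = (LINT x|M. w x * indicator A (X x))"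
  proof -
    have "{x\<in>space M. X x \<in> A} \<in> sets N" unfolding N_def by simp
    then have "measure N {x\<in>space M. X x \<in> A} = (LINT x|N. indicator {x\<in>space M. X x \<in> A} x)"
      by (simp add: sets.Int_space_eq2)
    also have "\<dots> = (LINT x|M. w x * indicator {x\<in>space M. X x \<in> A} x)"
      unfolding N_def by (subst integral_density) (simp_all add: w0)
    also have "\<dots> = (LINT x|M. w x * indicator A (X x))"
      by (intro Bochner_Integration.integral_cong) (auto simp: indicator_def)
    finally show ?thesis .
  qed
  moreover have "(LINT x|M. w x * indicator A (X x))
      = (2 * prob {x\<in>space M. X x \<in> A} + (LINT x|M. h x * indicator A (X x))) / (2 + c)"
  proof -
    have i1: "integrable M (\<lambda>x. indicator A (X x) :: real)"
      by (rule integrable_const_bound[of _ 1]) (auto simp: indicator_def)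
    have i2: "integrable M (\<lambda>x. h x * indicator A (X x))"
      by (rule integrable_const_bound[of _ 1]) (auto simp: indicator_def hb)
    have "(LINT x|M. indicator A (X x)) = (LINT x|M. indicator {x\<in>space M. X x \<in> A} x :: real)"
      by (intro Bochner_Integration.integral_cong) (auto simp: indicator_def)
    then have e: "(LINT x|M. indicator A (X x)) = prob {x\<in>space M. X x \<in> A}" by simp
    have "(LINT x|M. w x * indicator A (X x)) = (LINT x|M. (2 * indicator A (X x) + h x * indicator A (X x)) / (2 + c))"
      by (intro Bochner_Integration.integral_cong) (simp_all add: w_def algebra_simps)
    also have "\<dots> = (2 * prob {x\<in>space M. X x \<in> A} + (LINT x|M. h x * indicator A (X x))) / (2 + c)"
      using i1 i2 e by simp
    finally show ?thesis .
  qed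
  ultimately show ?thesis using c1 by (simp add: field_simps)
qed

text \<open>Passing from s to -s shows that the hypothesis is stable under conjugation of
  \<open>h\<close> and \<open>c\<close>; it therefore splits into real and imaginary parts, to which
  the real case applies.\<close>

lemma (in prob_space) char_weight:
  fixes h :: "'a \<Rightarrow> complex" and X :: "'a \<Rightarrow> real"
  assumes h [measurable]: "h \<in> borel_measurable M" and hb: "\<And>x. norm (h x) \<le> 1"
    and X [measurable]: "X \<in> borel_measurable M" and A [measurable]: "A \<in> sets borel"
    and eq: "\<And>s. (CLINT x|M. h x * iexp (s * X x)) = c * (CLINT x|M. iexp (s * X x))"
  shows "(CLINT x|M. h x * indicator A (X x)) = c * prob {x\<in>space M. X x \<in> A}"
proof -
  have [measurable]: "(\<lambda>x. cnj (h x)) \<in> borel_measurable M"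
    by (rule borel_measurable_continuous_on[OF _ h]) (intro continuous_intros)
  have bdd: "integrable M (\<lambda>x. h x * iexp (s * X x))" "integrable M (\<lambda>x. cnj (h x) * iexp (s * X x))" for s
    by (rule integrable_const_bound[of _ 1]; simp add: norm_mult hb)+
  have conj: "(CLINT x|M. cnj (h x) * iexp (s * X x)) = cnj c * (CLINT x|M. iexp (s * X x))" for s
  proof -
    have "(CLINT x|M. cnj (h x) * iexp (s * X x)) = (CLINT x|M. cnj (h x * iexp (- s * X x)))"
      by (intro Bochner_Integration.integral_cong) (simp_all add: exp_cnj)
    also have "\<dots> = cnj (c * (CLINT x|M. iexp (- s * X x)))"
      by (subst Bochner_Integration.integral_cnj) (simp only: eq)
    also have "\<dots> = cnj c * (CLINT x|M. cnj (iexp (- s * X x)))"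
      by (subst Bochner_Integration.integral_cnj) simp
    finally show ?thesis by (simp add: exp_cnj)
  qed
  have re: "(LINT x|M. Re (h x) * indicator A (X x)) = Re c * prob {x\<in>space M. X x \<in> A}"
  proof (rule char_weight_real)
    show "(CLINT x|M. of_real (Re (h x)) * iexp (s * X x)) = of_real (Re c) * (CLINT x|M. iexp (s * X x))" for s
    proof -
      have r: "complex_of_real (Re z) = (z + cnj z) / 2" for z by (simp add: complex_eq_iff)
      have "(CLINT x|M. of_real (Re (h x)) * iexp (s * X x))
          = (CLINT x|M. (h x * iexp (s * X x) + cnj (h x) * iexp (s * X x)) / 2)"
        unfolding r by (intro Bochner_Integration.integral_cong) (simp_all add: algebra_simps)
      also have "\<dots> = (c * (CLINT x|M. iexp (s * X x)) + cnj c * (CLINT x|M. iexp (s * X x))) / 2"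
        using bdd[of s] eq[of s] conj[of s] by simp
      finally show ?thesis unfolding r by (simp add: algebra_simps)
    qed
    show "\<bar>Re (h x)\<bar> \<le> 1" for x using abs_Re_le_cmod[of "h x"] hb[of x] by linarith
  qed measurable
  have im: "(LINT x|M. Im (h x) * indicator A (X x)) = Im c * prob {x\<in>space M. X x \<in> A}"
  proof (rule char_weight_real)
    show "(CLINT x|M. of_real (Im (h x)) * iexp (s * X x)) = of_real (Im c) * (CLINT x|M. iexp (s * X x))" for s
    proof -
      have r: "complex_of_real (Im z) = (z - cnj z) / (2 * \<i>)" for z by (simp add: complex_eq_iff)
      have "(CLINT x|M. of_real (Im (h x)) * iexp (s * X x))
          = (CLINT x|M. (h x * iexp (s * X x) - cnj (h x) * iexp (s * X x)) / (2 * \<i>))"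
        unfolding r by (intro Bochner_Integration.integral_cong) (simp_all add: algebra_simps)
      also have "\<dots> = (c * (CLINT x|M. iexp (s * X x)) - cnj c * (CLINT x|M. iexp (s * X x))) / (2 * \<i>)"
        using bdd[of s] eq[of s] conj[of s] by simp
      finally show ?thesis unfolding r by (simp add: algebra_simps)
    qed
    show "\<bar>Im (h x)\<bar> \<le> 1" for x using abs_Im_le_cmod[of "h x"] hb[of x] by linarith
  qed measurable
  have i: "integrable M (\<lambda>x. h x * indicator A (X x))"
    by (rule integrable_const_bound[of _ 1]) (auto simp: indicator_def hb)
  have sp: "Re (indicator A y) = indicator A y" "Im (indicator A y) = 0" for y
    by (auto simp: indicator_def)
  show ?thesis
    using re im integral_Re[OF i] integral_Im[OF i] by (simp add: complex_eq_iff sp)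
qed

text \<open>Exponentials are exchanged for indicators one variable at a time. In \<open>main\<close>
  the indices of \<open>J\<close> carry indicators and the others exponentials:
  \<open>J = {}\<close> is the hypothesis, and with all frequencies 0 it becomes the product formula
  for events.\<close>

lemma (in prob_space) indep_vars_char:
  fixes X :: "'i \<Rightarrow> 'a \<Rightarrow> real"
  assumes I: "finite I" and X [measurable]: "\<And>i. X i \<in> borel_measurable M"
    and eq: "\<And>t. (CLINT x|M. iexp (\<Sum>i\<in>I. t i * X i x)) = (\<Prod>i\<in>I. CLINT x|M. iexp (t i * X i x))"
  shows "indep_vars (\<lambda>_. borel) X I"
proof -
  define \<phi> where "\<phi> i t = (CLINT x|M. iexp (t * X i x))" for i t
  have main: "(CLINT x|M. (\<Prod>j\<in>J. indicator (A j) (X j x)) * iexp (\<Sum>i\<in>I-J. t i * X i x))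
      = (\<Prod>j\<in>J. of_real (prob {x\<in>space M. X j x \<in> A j})) * (\<Prod>i\<in>I-J. \<phi> i (t i))"
    if J: "finite J" "J \<subseteq> I" and A: "\<And>j. j \<in> J \<Longrightarrow> A j \<in> sets borel" for J t A
    using J A
  proof (induction J arbitrary: t rule: finite_induct)
    case empty
    show ?case using eq[of t] by (simp add: \<phi>_def)
  next
    case (insert j J)
    have Aj [measurable]: "A j \<in> sets borel" and Ai: "\<And>i. i \<in> J \<Longrightarrow> A i \<in> sets borel" using insert.prems by auto
    have IJ: "I - J = insert j (I - insert j J)" using insert by auto
    have fin: "finite (I - insert j J)" using I by simp
    have [measurable]: "(\<lambda>x. \<Prod>j\<in>J. indicator (A j) (X j x) :: complex) \<in> borel_measurable M"
    proof (intro borel_measurable_prod)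
      fix i assume "i \<in> J"
      then have [measurable]: "A i \<in> sets borel" by (rule Ai)
      show "(\<lambda>x. indicator (A i) (X i x) :: complex) \<in> borel_measurable M" by measurable
    qed
    let ?h = "\<lambda>x. (\<Prod>j\<in>J. indicator (A j) (X j x)) * iexp (\<Sum>i\<in>I - insert j J. t i * X i x)"
    let ?c = "(\<Prod>j\<in>J. of_real (prob {x\<in>space M. X j x \<in> A j})) * (\<Prod>i\<in>I - insert j J. \<phi> i (t i))"
    have "(CLINT x|M. ?h x * indicator (A j) (X j x)) = ?c * prob {x\<in>space M. X j x \<in> A j}"
    proof (rule char_weight)
      show "cmod (?h x) \<le> 1" for x
        by (auto simp: norm_mult prod_norm[symmetric] indicator_def intro!: prod_le_1)
      show "(CLINT x|M. ?h x * iexp (s * X j x)) = ?c * (CLINT x|M. iexp (s * X j x))" for s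
      proof -
        \<comment> \<open>The exponential of the new variable, at an arbitrary frequency s, is
          absorbed into the remaining sum as \<open>t(j := s)\<close>; this is why \<open>t\<close>
          is generalised in the induction.\<close>
        have "(CLINT x|M. ?h x * iexp (s * X j x))
            = (CLINT x|M. (\<Prod>j\<in>J. indicator (A j) (X j x)) * iexp (\<Sum>i\<in>I-J. (t(j := s)) i * X i x))"
        proof (intro Bochner_Integration.integral_cong refl)
          fix x
          have "(\<Sum>i\<in>I-J. (t(j := s)) i * X i x) = s * X j x + (\<Sum>i\<in>I - insert j J. t i * X i x)"
            unfolding IJ using fin by simp
          then show "?h x * iexp (s * X j x)
              = (\<Prod>j\<in>J. indicator (A j) (X j x)) * iexp (\<Sum>i\<in>I-J. (t(j := s)) i * X i x)"
            by (simp add: distrib_left exp_add)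
        qed
        also have "\<dots> = (\<Prod>j\<in>J. of_real (prob {x\<in>space M. X j x \<in> A j})) * (\<Prod>i\<in>I-J. \<phi> i ((t(j := s)) i))"
          using insert.prems insert.IH[of "t(j := s)"] by auto
        also have "(\<Prod>i\<in>I-J. \<phi> i ((t(j := s)) i)) = \<phi> j s * (\<Prod>i\<in>I - insert j J. \<phi> i (t i))"
          unfolding IJ using fin by simp
        finally show ?thesis by (simp add: \<phi>_def)
      qed
    qed measurable
    moreover have "(CLINT x|M. ?h x * indicator (A j) (X j x))
        = (CLINT x|M. (\<Prod>j\<in>insert j J. indicator (A j) (X j x)) * iexp (\<Sum>i\<in>I - insert j J. t i * X i x))"
      using insert.hyps by (intro Bochner_Integration.integral_cong) simp_all
    ultimately show ?case using insert.hyps by (simp add: mult_ac)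
  qed
  show ?thesis
    unfolding indep_vars_def2 indep_sets_def
  proof (intro conjI ballI allI impI)
    show "X i \<in> borel_measurable M" for i by measurable
    show "{X i -` A \<inter> space M |A. A \<in> sets borel} \<subseteq> events" for i by auto
    fix J S assume J: "J \<subseteq> I" "J \<noteq> {}" "finite J" and S: "S \<in> (\<Pi> i\<in>J. {X i -` A \<inter> space M |A. A \<in> sets borel})"
    then have "\<forall>i\<in>J. \<exists>A. A \<in> sets borel \<and> S i = X i -` A \<inter> space M" by (auto simp: Pi_iff)
    then obtain A where A: "\<And>i. i \<in> J \<Longrightarrow> A i \<in> sets borel" and SA: "\<And>i. i \<in> J \<Longrightarrow> S i = X i -` A i \<inter> space M"
      by metis
    have Seq: "S i = {x\<in>space M. X i x \<in> A i}" if "i \<in> J" for i using SA[OF that] by auto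
    have ev: "S i \<in> events" if "i \<in> J" for i using A[OF that] SA[OF that] by auto
    then have ev: "(\<Inter>i\<in>J. S i) \<in> events" using J by (intro sets.finite_INT) auto
    have "complex_of_real (prob (\<Inter>i\<in>J. S i)) = (CLINT x|M. indicator (\<Inter>i\<in>J. S i) x)"
    proof -
      have "(CLINT x|M. indicator (\<Inter>i\<in>J. S i) x) = (CLINT x|M. complex_of_real (indicator (\<Inter>i\<in>J. S i) x))"
        by (intro Bochner_Integration.integral_cong) (auto simp: indicator_def)
      then show ?thesis using ev by (simp only: integral_complex_of_real) simp
    qed
    also have "\<dots> = (CLINT x|M. (\<Prod>j\<in>J. indicator (A j) (X j x)))"
    proof (intro Bochner_Integration.integral_cong refl)
      fix x assume x: "x \<in> space M"
      show "indicator (\<Inter>i\<in>J. S i) x = (\<Prod>j\<in>J. indicator (A j) (X j x) :: complex)"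
      proof (cases "x \<in> (\<Inter>i\<in>J. S i)")
        case True
        then show ?thesis using Seq by (auto simp: indicator_def intro!: prod.neutral[symmetric])
      next
        case False
        then obtain j where "j \<in> J" "X j x \<notin> A j" using Seq x by auto
        then have "(\<Prod>j\<in>J. indicator (A j) (X j x) :: complex) = 0"
          using J(3) by (intro prod_zero) (auto intro!: bexI[of _ j])
        then show ?thesis using False by simp
      qed
    qed
    also have "\<dots> = (\<Prod>j\<in>J. complex_of_real (prob (S j)))"
      using main[of J A "\<lambda>_. 0", OF J(3,1) A] by (simp add: \<phi>_def prob_space Seq cong: prod.cong)
    also have "\<dots> = complex_of_real (\<Prod>j\<in>J. prob (S j))" by simp
    finally show "prob (\<Inter>i\<in>J. S i) = (\<Prod>j\<in>J. prob (S j))"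
      by (simp only: of_real_eq_iff)
  qed
qed

section \<open>Gaussian integrals and Gaussian measures\<close>

text \<open>An affine image of the standard normal covers the point mass and the density case alike,
  so laws of linear functionals need no case split on degenerate directions.\<close>

lemma normal_meas_eq_distr:
  assumes v: "0 \<le> v"
  shows "normal_meas a v = distr std_normal_distribution borel (\<lambda>z. a + sqrt v * z)"
proof -
  interpret N: prob_space std_normal_distribution by (rule prob_space_normal_density) simp
  show ?thesis
  proof (cases "v = 0")
    case False
    have "distr std_normal_distribution lborel (\<lambda>z. z) = distr std_normal_distribution std_normal_distribution (\<lambda>z. z)"
      by (rule distr_cong) simp_all
    then have "distributed std_normal_distribution lborel (\<lambda>z. z) std_normal_density"
      by (simp add: distributed_def distr_id)
    from N.normal_density_affine[OF this, of "sqrt v" a]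
    have "distr std_normal_distribution lborel (\<lambda>z. a + sqrt v * z) = density lborel (normal_density a (sqrt v))"
      using False v by (simp add: distributed_def)
    moreover have "distr std_normal_distribution lborel (\<lambda>z. a + sqrt v * z)
        = distr std_normal_distribution borel (\<lambda>z. a + sqrt v * z)"
      by (rule distr_cong) simp_all
    ultimately show ?thesis using False by (simp add: normal_meas_def)
  qed (simp add: normal_meas_def)
qed

lemma nn_integral_count_space_has_sum:
  fixes f :: "'a \<Rightarrow> real"
  assumes f: "(f has_sum S) A" and nn: "\<And>x. x \<in> A \<Longrightarrow> 0 \<le> f x"
  shows "(\<integral>\<^sup>+x. ennreal (f x) \<partial>count_space A) = ennreal S"
proof -
  have "(\<lambda>x. norm (f x)) summable_on A"
    using f nn by (auto simp: summable_on_def cong: has_sum_cong)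
  then have "Infinite_Set_Sum.abs_summable_on f A" by (rule abs_summable_equivalent[THEN iffD1])
  then show ?thesis
    using nn infsumI[OF f] by (simp add: nn_integral_conv_infsetsum infsetsum_infsum)
qed

text \<open>Completing the square: the integrand times the standard normal density is a multiple of
  the normal density with mean \<alpha> / q and variance 1 / q, where
  \<open>q = 1 + 2 * \<beta>\<close> is positive by hypothesis.\<close>

lemma std_normal_exp_quadratic:
  fixes \<alpha> \<beta> :: real
  assumes \<beta>: "-1 < 2 * \<beta>"
  shows "(\<integral>\<^sup>+z. ennreal (exp (\<alpha> * z - \<beta> * z\<^sup>2)) \<partial>std_normal_distribution)
    = ennreal (exp (\<alpha>\<^sup>2 / (2 * (1 + 2 * \<beta>))) / sqrt (1 + 2 * \<beta>))"
proof -
  define q where "q = 1 + 2 * \<beta>"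
  have q: "q > 0" using \<beta> by (simp add: q_def)
  define c where "c = exp (\<alpha>\<^sup>2 / (2 * q)) / sqrt q"
  have c0: "c \<ge> 0" using q by (simp add: c_def)
  have eq: "std_normal_density z * exp (\<alpha> * z - \<beta> * z\<^sup>2) = c * normal_density (\<alpha> / q) (1 / sqrt q) z" for z
  proof -
    have s: "sqrt (2 * pi * (1 / sqrt q)\<^sup>2) = sqrt (2 * pi) / sqrt q"
      using q by (simp add: power_divide real_sqrt_divide)
    have "- z\<^sup>2 / 2 + (\<alpha> * z - \<beta> * z\<^sup>2) = \<alpha>\<^sup>2 / (2 * q) + - (z - \<alpha> / q)\<^sup>2 / (2 * (1 / sqrt q)\<^sup>2)"
    proof -
      have "(1 / sqrt q)\<^sup>2 = 1 / q" using q by (simp add: power_divide)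
      moreover have "\<beta> = (q - 1) / 2" by (simp add: q_def)
      ultimately show ?thesis using q by (simp only:) (simp add: field_simps power2_eq_square)
    qed
    then have e: "exp (- z\<^sup>2 / 2) * exp (\<alpha> * z - \<beta> * z\<^sup>2)
        = exp (\<alpha>\<^sup>2 / (2 * q)) * exp (- (z - \<alpha> / q)\<^sup>2 / (2 * (1 / sqrt q)\<^sup>2))"
      by (simp only: exp_add[symmetric])
    have "std_normal_density z * exp (\<alpha> * z - \<beta> * z\<^sup>2)
        = (1 / sqrt (2 * pi)) * (exp (- z\<^sup>2 / 2) * exp (\<alpha> * z - \<beta> * z\<^sup>2))"
      by (simp only: std_normal_density_def mult.assoc)
    also have "\<dots> = c * normal_density (\<alpha> / q) (1 / sqrt q) z"
      unfolding e normal_density_def s c_def using q by simp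
    finally show ?thesis .
  qed
  interpret P: prob_space "density lborel (normal_density (\<alpha> / q) (1 / sqrt q))"
    by (rule prob_space_normal_density) (use q in simp)
  have "(\<integral>\<^sup>+z. ennreal (exp (\<alpha> * z - \<beta> * z\<^sup>2)) \<partial>std_normal_distribution)
      = (\<integral>\<^sup>+z. ennreal c * ennreal (normal_density (\<alpha> / q) (1 / sqrt q) z) \<partial>lborel)"
    by (subst nn_integral_density)
       (auto intro!: nn_integral_cong simp: eq c0 simp flip: ennreal_mult)
  also have "\<dots> = ennreal c * (\<integral>\<^sup>+z. ennreal (normal_density (\<alpha> / q) (1 / sqrt q) z) \<partial>lborel)"
    by (rule nn_integral_cmult) simp
  also have "(\<integral>\<^sup>+z. ennreal (normal_density (\<alpha> / q) (1 / sqrt q) z) \<partial>lborel) = 1"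
    using P.emeasure_space_1 by (simp add: emeasure_density)
  finally show ?thesis by (simp add: c_def q_def)
qed

text \<open>The log-density of a pair of standard normals with correlation \<open>\<rho>\<close> relative to the independent pair,
  where \<open>1 - \<rho>\<^sup>2 = 1 / (1 + M/2)\<close> and \<open>\<kappa> = \<rho> / (1 - \<rho>\<^sup>2)\<close>, that is \<open>\<kappa>\<^sup>2 = M (M + 2) / 4\<close>.\<close>
definition mehler_exponent :: "real \<Rightarrow> real \<Rightarrow> real \<Rightarrow> real \<Rightarrow> real" where
  "mehler_exponent M \<kappa> \<xi> \<eta> = ln (1 + M / 2) / 2 - M / 4 * (\<xi>\<^sup>2 + \<eta>\<^sup>2) + \<kappa> * \<xi> * \<eta>"

lemma mehler_exponent_commute: "mehler_exponent M \<kappa> \<xi> \<eta> = mehler_exponent M \<kappa> \<eta> \<xi>"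
  by (simp add: mehler_exponent_def algebra_simps)

lemma exp_half_ln: "0 < x \<Longrightarrow> exp (ln x / 2) = sqrt x"
  by (simp only: ln_sqrt[symmetric] exp_ln real_sqrt_gt_zero)

text \<open>The integral over \<eta> produces \<kappa>^2 \<xi>^2 / (2 + M) in the exponent, and the
  relation between \<kappa> and \<open>M\<close> is exactly what cancels it against - M \<xi>^2 /
  4.\<close>

lemma mehler_marginal:
  assumes M: "0 \<le> M" and \<kappa>: "\<kappa>\<^sup>2 = M * (M + 2) / 4"
  shows "(\<integral>\<^sup>+\<eta>. ennreal (exp (mehler_exponent M \<kappa> \<xi> \<eta>)) \<partial>std_normal_distribution) = 1"
proof -
  define c where "c = sqrt (1 + M / 2) * exp (- M / 4 * \<xi>\<^sup>2)"
  have c0: "0 \<le> c" using M by (simp add: c_def)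
  have eq: "exp (mehler_exponent M \<kappa> \<xi> \<eta>) = c * exp ((\<kappa> * \<xi>) * \<eta> - M / 4 * \<eta>\<^sup>2)" for \<eta>
  proof -
    have "mehler_exponent M \<kappa> \<xi> \<eta> = ln (1 + M / 2) / 2 + (- M / 4 * \<xi>\<^sup>2) + ((\<kappa> * \<xi>) * \<eta> - M / 4 * \<eta>\<^sup>2)"
      by (simp add: mehler_exponent_def algebra_simps)
    then show ?thesis using M by (simp only: exp_add) (simp add: exp_half_ln c_def)
  qed
  have "(\<integral>\<^sup>+\<eta>. ennreal (exp (mehler_exponent M \<kappa> \<xi> \<eta>)) \<partial>std_normal_distribution)
      = ennreal c * (\<integral>\<^sup>+\<eta>. ennreal (exp ((\<kappa> * \<xi>) * \<eta> - M / 4 * \<eta>\<^sup>2)) \<partial>std_normal_distribution)"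
    unfolding eq by (subst nn_integral_cmult[symmetric]) (simp_all add: ennreal_mult c0)
  also have "\<dots> = ennreal c * ennreal (exp ((\<kappa> * \<xi>)\<^sup>2 / (2 * (1 + 2 * (M / 4)))) / sqrt (1 + 2 * (M / 4)))"
    by (subst std_normal_exp_quadratic) (use M in simp_all)
  also have "\<dots> = ennreal (c * (exp ((\<kappa> * \<xi>)\<^sup>2 / (2 * (1 + 2 * (M / 4)))) / sqrt (1 + 2 * (M / 4))))"
    by (rule ennreal_mult[symmetric]) (use M c0 in simp_all)
  also have "(\<kappa> * \<xi>)\<^sup>2 / (2 * (1 + 2 * (M / 4))) = M / 4 * \<xi>\<^sup>2"
    unfolding power_mult_distrib \<kappa> using M by (simp add: field_simps)
  also have "c * (exp (M / 4 * \<xi>\<^sup>2) / sqrt (1 + 2 * (M / 4))) = 1"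
  proof -
    have "sqrt (1 + M / 2) > 0" using M by simp
    then show ?thesis by (simp add: c_def exp_minus field_simps)
  qed
  finally show ?thesis by simp
qed

text \<open>The Mehler kernel with correlation \<rho> has the eigenvalues \<rho>^n, so its squared
  Hilbert-Schmidt norm is 1 / (1 - \<rho>^2) = 1 + M / 2. For summable \<open>M\<close> these
  factors have bounded products.\<close>

lemma mehler_second_moment:
  assumes M: "0 \<le> M" and \<kappa>: "\<kappa>\<^sup>2 = M * (M + 2) / 4"
  shows "(\<integral>\<^sup>+\<xi>. \<integral>\<^sup>+\<eta>. ennreal (exp (2 * mehler_exponent M \<kappa> \<xi> \<eta>)) \<partial>std_normal_distribution \<partial>std_normal_distribution)
    = ennreal (1 + M / 2)"
proof -
  have q: "1 + M / 2 > 0" "1 + M > 0" using M by auto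
  have inner: "(\<integral>\<^sup>+\<eta>. ennreal (exp (2 * mehler_exponent M \<kappa> \<xi> \<eta>)) \<partial>std_normal_distribution)
     = ennreal ((1 + M / 2) / sqrt (1 + M)) * ennreal (exp (0 * \<xi> - (- M / (2 * (1 + M))) * \<xi>\<^sup>2))" for \<xi>
  proof -
    define c where "c = (1 + M / 2) * exp (- M / 2 * \<xi>\<^sup>2)"
    have c0: "0 \<le> c" using M by (simp add: c_def)
    have eq: "exp (2 * mehler_exponent M \<kappa> \<xi> \<eta>) = c * exp ((2 * \<kappa> * \<xi>) * \<eta> - M / 2 * \<eta>\<^sup>2)" for \<eta>
    proof -
      have "2 * mehler_exponent M \<kappa> \<xi> \<eta> = ln (1 + M / 2) + (- M / 2 * \<xi>\<^sup>2) + ((2 * \<kappa> * \<xi>) * \<eta> - M / 2 * \<eta>\<^sup>2)"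
        by (simp add: mehler_exponent_def algebra_simps)
      then show ?thesis using q by (simp only: exp_add) (simp add: c_def)
    qed
    have "(\<integral>\<^sup>+\<eta>. ennreal (exp (2 * mehler_exponent M \<kappa> \<xi> \<eta>)) \<partial>std_normal_distribution)
        = ennreal c * (\<integral>\<^sup>+\<eta>. ennreal (exp ((2 * \<kappa> * \<xi>) * \<eta> - M / 2 * \<eta>\<^sup>2)) \<partial>std_normal_distribution)"
      unfolding eq by (subst nn_integral_cmult[symmetric]) (simp_all add: ennreal_mult c0)
    also have "\<dots> = ennreal c * ennreal (exp ((2 * \<kappa> * \<xi>)\<^sup>2 / (2 * (1 + 2 * (M / 2)))) / sqrt (1 + 2 * (M / 2)))"
      by (subst std_normal_exp_quadratic) (use M in simp_all)
    also have "\<dots> = ennreal (c * (exp ((2 * \<kappa> * \<xi>)\<^sup>2 / (2 * (1 + 2 * (M / 2)))) / sqrt (1 + 2 * (M / 2))))"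
      by (rule ennreal_mult[symmetric]) (use M c0 in simp_all)
    also have "c * (exp ((2 * \<kappa> * \<xi>)\<^sup>2 / (2 * (1 + 2 * (M / 2)))) / sqrt (1 + 2 * (M / 2)))
        = (1 + M / 2) / sqrt (1 + M) * exp (- M / 2 * \<xi>\<^sup>2 + (2 * \<kappa> * \<xi>)\<^sup>2 / (2 * (1 + M)))"
      by (simp only: exp_add c_def) simp
    also have "- M / 2 * \<xi>\<^sup>2 + (2 * \<kappa> * \<xi>)\<^sup>2 / (2 * (1 + M)) = 0 * \<xi> - (- M / (2 * (1 + M))) * \<xi>\<^sup>2"
      unfolding power_mult_distrib \<kappa> using q by (simp add: field_simps)
    finally show ?thesis
      by (rule trans) (rule ennreal_mult, use M in simp_all)
  qed
  have "(\<integral>\<^sup>+\<xi>. \<integral>\<^sup>+\<eta>. ennreal (exp (2 * mehler_exponent M \<kappa> \<xi> \<eta>)) \<partial>std_normal_distribution \<partial>std_normal_distribution)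
     = ennreal ((1 + M / 2) / sqrt (1 + M)) * (\<integral>\<^sup>+\<xi>. ennreal (exp (0 * \<xi> - (- M / (2 * (1 + M))) * \<xi>\<^sup>2)) \<partial>std_normal_distribution)"
    unfolding inner by (rule nn_integral_cmult) simp
  \<comment> \<open>The exponent now grows with \<xi>, but its coefficient M / (2 (1 + M)) stays
    below 1/2.\<close>
  also have "\<dots> = ennreal ((1 + M / 2) / sqrt (1 + M)) * ennreal (1 / sqrt (1 + 2 * (- M / (2 * (1 + M)))))"
    by (subst std_normal_exp_quadratic) (use q in \<open>simp_all add: field_simps\<close>)
  also have "1 + 2 * (- M / (2 * (1 + M))) = 1 / (1 + M)" using q by (simp add: field_simps)
  also have "ennreal ((1 + M / 2) / sqrt (1 + M)) * ennreal (1 / sqrt (1 / (1 + M)))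
      = ennreal ((1 + M / 2) / sqrt (1 + M) * (1 / sqrt (1 / (1 + M))))"
    by (rule ennreal_mult[symmetric]) (use M in simp_all)
  also have "(1 + M / 2) / sqrt (1 + M) * (1 / sqrt (1 / (1 + M))) = 1 + M / 2"
    using q by (simp add: real_sqrt_divide)
  finally show ?thesis .
qed

section \<open>Linear functionals of a Gaussian measure\<close>

locale gaussian = prob_space \<mu> for \<mu> :: "'a::{real_inner,polish_space} measure" +
  fixes m :: 'a and C :: "'a \<Rightarrow>\<^sub>L 'a"
  assumes gaussian: "gaussian_measure \<mu> m C" and C: "positive_op C"
begin

lemma sets_eq [measurable_cong, simp]: "sets \<mu> = sets borel"
  using gaussian by (simp add: gaussian_measure_def)

lemma space_eq [simp]: "space \<mu> = UNIV"
  using sets_eq_imp_space_eq[OF sets_eq] by simp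

lemma distr_inner:
  "distr \<mu> borel (\<lambda>x. inner (x - m) h) = distr std_normal_distribution borel (\<lambda>z. sqrt (inner (C h) h) * z)"
proof -
  have "distr \<mu> borel (\<lambda>x. inner (x - m) h) = distr (distr \<mu> borel (\<lambda>x. inner x h)) borel (\<lambda>t. t - inner m h)"
    by (subst distr_distr) (auto simp: comp_def inner_diff_left)
  also have "distr \<mu> borel (\<lambda>x. inner x h) = distr std_normal_distribution borel (\<lambda>z. inner m h + sqrt (inner (C h) h) * z)"
    using gaussian normal_meas_eq_distr[OF positive_op_nonneg[OF C, of h], of "inner m h"]
    by (simp add: gaussian_measure_def)
  also have "distr \<dots> borel (\<lambda>t. t - inner m h) = distr std_normal_distribution borel (\<lambda>z. sqrt (inner (C h) h) * z)"
    by (subst distr_distr) (auto simp: comp_def)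
  finally show ?thesis .
qed

lemma nn_integral_inner:
  assumes [measurable]: "f \<in> borel_measurable borel"
  shows "(\<integral>\<^sup>+x. f (inner (x - m) h) \<partial>\<mu>) = (\<integral>\<^sup>+z. f (sqrt (inner (C h) h) * z) \<partial>std_normal_distribution)"
proof -
  have "(\<integral>\<^sup>+x. f (inner (x - m) h) \<partial>\<mu>) = (\<integral>\<^sup>+t. f t \<partial>distr \<mu> borel (\<lambda>x. inner (x - m) h))"
    by (rule nn_integral_distr[symmetric]) measurable
  also have "\<dots> = (\<integral>\<^sup>+z. f (sqrt (inner (C h) h) * z) \<partial>std_normal_distribution)"
    unfolding distr_inner by (rule nn_integral_distr) measurable
  finally show ?thesis .
qed

lemma integrable_inner_square: "integrable \<mu> (\<lambda>x. (inner (x - m) h)\<^sup>2)" (is ?i)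
  and integral_inner_square: "(LINT x|\<mu>. (inner (x - m) h)\<^sup>2) = inner (C h) h" (is ?e)
proof -
  let ?f = "\<lambda>z. (sqrt (inner (C h) h) * z)\<^sup>2"
  have f: "?f = (\<lambda>z. inner (C h) h * z ^ (2 * 1))"
    by (simp add: power_mult_distrib positive_op_nonneg[OF C])
  have "integrable (distr \<mu> borel (\<lambda>x. inner (x - m) h)) (\<lambda>t. t\<^sup>2)"
    unfolding distr_inner using std_normal_distribution_even_moments(2)[of 1]
    by (subst integrable_distr_eq) (simp_all add: f[simplified])
  then show ?i by (subst (asm) integrable_distr_eq) simp_all
  have "(LINT x|\<mu>. (inner (x - m) h)\<^sup>2) = (LINT t|distr \<mu> borel (\<lambda>x. inner (x - m) h). t\<^sup>2)"
    by (rule integral_distr[symmetric]) measurable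
  also have "\<dots> = (LINT z|std_normal_distribution. ?f z)"
    unfolding distr_inner by (rule integral_distr) measurable
  also have "\<dots> = inner (C h) h"
    unfolding f using std_normal_distribution_even_moments(1)[of 1] by (simp add: fact_numeral)
  finally show ?e .
qed

lemma nn_integral_inner_square: "(\<integral>\<^sup>+x. ennreal ((inner (x - m) h)\<^sup>2) \<partial>\<mu>) = ennreal (inner (C h) h)"
  using nn_integral_eq_integral[OF integrable_inner_square[of h]] by (simp add: integral_inner_square)

text \<open>With \<open>L\<close> a self-adjoint operator, \<open>q\<close> is the squared norm of \<open>L x\<close>.\<close>
lemma nn_integral_parseval:
  fixes B :: "'a set"
  assumes B: "hilbert_basis B" and L: "\<And>x. ((\<lambda>e. (inner x (L e))\<^sup>2) has_sum q x) B"
    and T: "((\<lambda>e. inner (C (L e)) (L e)) has_sum T) B"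
  shows "(\<integral>\<^sup>+x. ennreal (q (x - m)) \<partial>\<mu>) = ennreal T"
proof -
  have cB: "countable B" by (rule orthonormal_countable) (use B in \<open>simp add: hilbert_basis_iff\<close>)
  have "(\<integral>\<^sup>+x. ennreal (q (x - m)) \<partial>\<mu>) = (\<integral>\<^sup>+x. \<integral>\<^sup>+e. ennreal ((inner (x - m) (L e))\<^sup>2) \<partial>count_space B \<partial>\<mu>)"
    by (intro nn_integral_cong nn_integral_count_space_has_sum[symmetric] L) simp
  also have "\<dots> = (\<integral>\<^sup>+e. \<integral>\<^sup>+x. ennreal ((inner (x - m) (L e))\<^sup>2) \<partial>\<mu> \<partial>count_space B)"
    by (rule nn_integral_count_space_nn_integral[OF cB]) measurable
  also have "\<dots> = (\<integral>\<^sup>+e. ennreal (inner (C (L e)) (L e)) \<partial>count_space B)"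
    by (simp add: nn_integral_inner_square)
  also have "\<dots> = ennreal T"
    by (intro nn_integral_count_space_has_sum T positive_op_nonneg[OF C])
  finally show ?thesis .
qed

lemma char_inner: "(CLINT x|\<mu>. iexp (inner (x - m) h)) = complex_of_real (exp (- (inner (C h) h) / 2))"
proof -
  let ?\<sigma> = "sqrt (inner (C h) h)"
  have "(CLINT x|\<mu>. iexp (inner (x - m) h)) = (CLINT t|distr \<mu> borel (\<lambda>x. inner (x - m) h). iexp t)"
    by (rule integral_distr[symmetric]) measurable
  also have "\<dots> = (CLINT z|std_normal_distribution. iexp (?\<sigma> * z))"
    unfolding distr_inner by (rule integral_distr) measurable
  also have "\<dots> = char std_normal_distribution ?\<sigma>" by (simp add: char_def)
  also have "\<dots> = complex_of_real (exp (- (inner (C h) h) / 2))"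
    by (simp add: char_std_normal_distribution positive_op_nonneg[OF C])
  finally show ?thesis .
qed

text \<open>A linear combination of these functionals is again such a functional; by orthogonality
  its variance is the sum of the separate variances, so its characteristic function factors.\<close>

lemma indep_vars_inner:
  assumes I: "finite I" and orth: "\<And>i j. i \<in> I \<Longrightarrow> j \<in> I \<Longrightarrow> i \<noteq> j \<Longrightarrow> inner (C (h i)) (h j) = 0"
  shows "indep_vars (\<lambda>_. borel) (\<lambda>i x. inner (x - m) (h i)) I"
proof (rule indep_vars_char[OF I])
  show "(\<lambda>x. inner (x - m) (h i)) \<in> borel_measurable \<mu>" for i by measurable
  fix t
  have C_sum: "inner (C (\<Sum>i\<in>I. t i *\<^sub>R h i)) (\<Sum>i\<in>I. t i *\<^sub>R h i) = (\<Sum>i\<in>I. (t i)\<^sup>2 * inner (C (h i)) (h i))"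
  proof -
    have "inner (C (\<Sum>i\<in>I. t i *\<^sub>R h i)) (\<Sum>i\<in>I. t i *\<^sub>R h i)
        = (\<Sum>i\<in>I. \<Sum>j\<in>I. t i * (t j * inner (C (h j)) (h i)))"
      by (simp add: blinfun.sum_right blinfun.bilinear_simps inner_sum_left inner_sum_right sum_distrib_left)
    also have "\<dots> = (\<Sum>i\<in>I. \<Sum>j\<in>I. if i = j then (t i)\<^sup>2 * inner (C (h i)) (h i) else 0)"
      by (intro sum.cong refl) (auto simp: orth power2_eq_square)
    finally show ?thesis using I by simp
  qed
  have "(CLINT x|\<mu>. iexp (\<Sum>i\<in>I. t i * inner (x - m) (h i))) = (CLINT x|\<mu>. iexp (inner (x - m) (\<Sum>i\<in>I. t i *\<^sub>R h i)))"
    by (simp only: inner_sum_right inner_scaleR_right)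
  also have "\<dots> = complex_of_real (exp (\<Sum>i\<in>I. - ((t i)\<^sup>2 * inner (C (h i)) (h i)) / 2))"
    unfolding char_inner C_sum by (simp add: sum_negf sum_divide_distrib)
  also have "\<dots> = (\<Prod>i\<in>I. complex_of_real (exp (- ((t i)\<^sup>2 * inner (C (h i)) (h i)) / 2)))"
    using I by (simp add: exp_sum)
  also have "\<dots> = (\<Prod>i\<in>I. CLINT x|\<mu>. iexp (t i * inner (x - m) (h i)))"
  proof (rule prod.cong[OF refl])
    fix i
    have "(CLINT x|\<mu>. iexp (t i * inner (x - m) (h i))) = (CLINT x|\<mu>. iexp (inner (x - m) (t i *\<^sub>R h i)))"
      by (simp only: inner_scaleR_right)
    then show "complex_of_real (exp (- ((t i)\<^sup>2 * inner (C (h i)) (h i)) / 2)) = (CLINT x|\<mu>. iexp (t i * inner (x - m) (h i)))"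
      unfolding char_inner by (simp add: blinfun.bilinear_simps power2_eq_square mult.assoc)
  qed
  finally show "(CLINT x|\<mu>. iexp (\<Sum>i\<in>I. t i * inner (x - m) (h i))) = (\<Prod>i\<in>I. CLINT x|\<mu>. iexp (t i * inner (x - m) (h i)))" .
qed

lemma nn_integral_prod_inner:
  fixes g :: "'i \<Rightarrow> real \<Rightarrow> ennreal"
  assumes I: "finite I" and orth: "\<And>i j. i \<in> I \<Longrightarrow> j \<in> I \<Longrightarrow> i \<noteq> j \<Longrightarrow> inner (C (h i)) (h j) = 0"
    and g [measurable]: "\<And>i. g i \<in> borel_measurable borel"
  shows "(\<integral>\<^sup>+x. (\<Prod>i\<in>I. g i (inner (x - m) (h i))) \<partial>\<mu>)
    = (\<Prod>i\<in>I. \<integral>\<^sup>+z. g i (sqrt (inner (C (h i)) (h i)) * z) \<partial>std_normal_distribution)"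
proof -
  have "indep_vars (\<lambda>_. borel) (\<lambda>i x. g i (inner (x - m) (h i))) I"
    by (rule indep_vars_compose2[OF indep_vars_inner[OF I orth]]) simp_all
  from indep_vars_nn_integral[OF I this] show ?thesis by (simp add: nn_integral_inner)
qed

end

section \<open>The Gibbs variational principle\<close>

lemma ennreal_max_0: "ennreal (max 0 r) = ennreal r"
  by (simp add: max_def ennreal_neg)

lemma KL_eq_integral:
  assumes s: "sets \<gamma> = sets \<mu>" and ac: "absolutely_continuous \<mu> \<gamma>"
    and int: "integrable \<gamma> (\<lambda>x. ln (enn2real (RN_deriv \<mu> \<gamma> x)))"
  shows "KL \<gamma> \<mu> = ereal (LINT x|\<gamma>. ln (enn2real (RN_deriv \<mu> \<gamma> x)))"
proof -
  let ?f = "\<lambda>x. ln (enn2real (RN_deriv \<mu> \<gamma> x))"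
  let ?p = "\<integral>\<^sup>+x. ennreal (?f x) \<partial>\<gamma>" and ?n = "\<integral>\<^sup>+x. ennreal (- ?f x) \<partial>\<gamma>"
  have fin: "?p \<noteq> \<infinity>" "?n \<noteq> \<infinity>" using int unfolding real_integrable_def by auto
  have "enn2ereal u = ereal (enn2real u)" if "u \<noteq> \<infinity>" for u
    using that by (cases u) auto
  then show ?thesis
    using s ac fin by (simp add: KL_def ennreal_max_0 real_lebesgue_integral_def[OF int])
qed

lemma KL_density_exp:
  assumes \<mu>: "sigma_finite_measure \<mu>" and \<phi> [measurable]: "\<phi> \<in> borel_measurable \<mu>"
    and int: "integrable (density \<mu> (\<lambda>x. ennreal (exp (\<phi> x)))) \<phi>"
  shows "KL (density \<mu> (\<lambda>x. ennreal (exp (\<phi> x)))) \<mu> = ereal (LINT x|density \<mu> (\<lambda>x. ennreal (exp (\<phi> x))). \<phi> x)"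
proof -
  interpret sigma_finite_measure \<mu> by (rule \<mu>)
  define \<gamma> where "\<gamma> = density \<mu> (\<lambda>x. ennreal (exp (\<phi> x)))"
  have ac: "absolutely_continuous \<mu> \<gamma>"
    unfolding \<gamma>_def by (rule absolutely_continuousI_density) measurable
  have s: "sets \<gamma> = sets \<mu>" by (simp add: \<gamma>_def)
  have [measurable]: "RN_deriv \<mu> \<gamma> \<in> borel_measurable \<gamma>"
    using borel_measurable_RN_deriv[of \<mu> \<gamma>] measurable_cong_sets[OF s refl] by blast
  have "AE x in \<mu>. ennreal (exp (\<phi> x)) = RN_deriv \<mu> \<gamma> x"
    by (rule RN_deriv_unique) (auto simp: \<gamma>_def)
  then have "AE x in \<gamma>. ennreal (exp (\<phi> x)) = RN_deriv \<mu> \<gamma> x"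
    unfolding \<gamma>_def by (subst AE_density) auto
  then have ae: "AE x in \<gamma>. \<phi> x = ln (enn2real (RN_deriv \<mu> \<gamma> x))"
  proof (rule AE_mp, intro AE_I2 impI)
    fix x assume "ennreal (exp (\<phi> x)) = RN_deriv \<mu> \<gamma> x"
    from this[symmetric] show "\<phi> x = ln (enn2real (RN_deriv \<mu> \<gamma> x))" by simp
  qed
  have [measurable]: "\<phi> \<in> borel_measurable \<gamma>" by (simp add: \<gamma>_def)
  have "integrable \<gamma> (\<lambda>x. ln (enn2real (RN_deriv \<mu> \<gamma> x)))"
    by (rule integrable_cong_AE_imp[OF int[folded \<gamma>_def] _ ae]) measurable
  note KL = KL_eq_integral[OF s ac this]
  have "(LINT x|\<gamma>. \<phi> x) = (LINT x|\<gamma>. ln (enn2real (RN_deriv \<mu> \<gamma> x)))"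
    by (rule integral_cong_AE[OF _ _ ae]) measurable
  with KL show ?thesis unfolding \<gamma>_def by (simp only:)
qed

text \<open>Integrate \<open>u \<le> exp u - 1\<close> under \<gamma> for
  \<open>u = \<phi> - ln d\<close>, where \<open>d\<close> is the density of \<gamma>; the integral
  of \<open>exp u\<close> is at most that of \<open>exp \<phi>\<close> under \<mu>.\<close>

lemma KL_ge_integral:
  assumes \<mu>: "prob_space \<mu>" and \<gamma>: "prob_space \<gamma>" and s: "sets \<gamma> = sets \<mu>"
    and \<phi> [measurable]: "\<phi> \<in> borel_measurable \<mu>" and int: "integrable \<gamma> \<phi>"
    and le: "(\<integral>\<^sup>+x. ennreal (exp (\<phi> x)) \<partial>\<mu>) \<le> 1"
  shows "ereal (LINT x|\<gamma>. \<phi> x) \<le> KL \<gamma> \<mu>"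
proof (cases "absolutely_continuous \<mu> \<gamma>")
  case False
  then show ?thesis by (simp add: KL_def)
next
  case ac: True
  interpret \<mu>: prob_space \<mu> by (rule \<mu>)
  interpret \<gamma>: prob_space \<gamma> by (rule \<gamma>)
  define d where "d x = enn2real (RN_deriv \<mu> \<gamma> x)" for x
  have d0: "0 \<le> d x" for x by (simp add: d_def)
  have d_m [measurable]: "d \<in> borel_measurable \<mu>" unfolding d_def by measurable
  have mg: "f \<in> borel_measurable \<gamma> \<longleftrightarrow> f \<in> borel_measurable \<mu>" for f :: "_ \<Rightarrow> real"
    using measurable_cong_sets[OF s refl] by blast
  have fin: "AE x in \<mu>. RN_deriv \<mu> \<gamma> x \<noteq> \<infinity>"
    using \<mu>.RN_deriv_finite[OF _ ac s] \<gamma>.sigma_finite_measure_axioms by simp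
  have \<gamma>_eq: "\<gamma> = density \<mu> (\<lambda>x. ennreal (d x))"
  proof -
    have "\<gamma> = density \<mu> (RN_deriv \<mu> \<gamma>)" by (rule \<mu>.density_RN_deriv[OF ac s, symmetric])
    also have "\<dots> = density \<mu> (\<lambda>x. ennreal (d x))"
    proof (rule density_cong)
      show "AE x in \<mu>. RN_deriv \<mu> \<gamma> x = ennreal (d x)"
        using fin by (rule AE_mp) (auto simp: d_def ennreal_enn2real_if)
    qed measurable
    finally show ?thesis .
  qed
  have nn: "(\<integral>\<^sup>+x. f x \<partial>\<gamma>) = (\<integral>\<^sup>+x. ennreal (d x) * f x \<partial>\<mu>)" if "f \<in> borel_measurable \<mu>" for f
    by (subst \<gamma>_eq, rule nn_integral_density) (use that in simp_all)
  let ?p = "\<integral>\<^sup>+x. ennreal (ln (d x)) \<partial>\<gamma>" and ?n = "\<integral>\<^sup>+x. ennreal (- ln (d x)) \<partial>\<gamma>"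
  have "?n = (\<integral>\<^sup>+x. ennreal (d x) * ennreal (- ln (d x)) \<partial>\<mu>)" by (rule nn) measurable
  \<comment> \<open>Pointwise - d ln d \<le> 1, so the negative part of the entropy is always finite
    and an infinite positive part makes \<open>KL\<close> infinite.\<close>
  also have "\<dots> \<le> (\<integral>\<^sup>+x. 1 \<partial>\<mu>)"
  proof (rule nn_integral_mono)
    fix x
    have "d x * - ln (d x) \<le> 1"
    proof (cases "d x = 0")
      case False
      then have d: "d x > 0" using d0[of x] by simp
      then have "- ln (d x) \<le> 1 / d x - 1"
        using ln_le_minus_one[of "1 / d x"] by (simp add: ln_div)
      then have "d x * - ln (d x) \<le> d x * (1 / d x - 1)" using d by (intro mult_left_mono) auto
      also have "\<dots> \<le> 1" using d by (simp add: right_diff_distrib)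
      finally show ?thesis .
    qed simp
    then have "ennreal (d x * - ln (d x)) \<le> ennreal 1" by (rule ennreal_leI)
    then show "ennreal (d x) * ennreal (- ln (d x)) \<le> 1"
      unfolding ennreal_mult'[OF d0] ennreal_1 .
  qed
  also have "\<dots> = 1" by (simp add: \<mu>.emeasure_space_1)
  finally have n1: "?n \<le> 1" .
  then have n_fin: "?n \<noteq> \<infinity>" by (auto simp: top_unique)
  show ?thesis
  proof (cases "?p = \<infinity>")
    case True
    have "enn2ereal ?n \<noteq> \<infinity>" using n_fin by (cases ?n) auto
    then have "KL \<gamma> \<mu> = \<infinity>"
      using s ac True by (simp add: KL_def ennreal_max_0 d_def[symmetric])
    then show ?thesis by simp
  next
    case False
    have ln_m: "(\<lambda>x. ln (d x)) \<in> borel_measurable \<gamma>" unfolding mg by measurable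
    then have i_ln: "integrable \<gamma> (\<lambda>x. ln (d x))"
      using False n_fin unfolding real_integrable_def by simp
    have "(\<integral>\<^sup>+x. ennreal (exp (\<phi> x - ln (d x))) \<partial>\<gamma>) = (\<integral>\<^sup>+x. ennreal (d x) * ennreal (exp (\<phi> x - ln (d x))) \<partial>\<mu>)"
      by (rule nn) measurable
    also have "\<dots> \<le> (\<integral>\<^sup>+x. ennreal (exp (\<phi> x)) \<partial>\<mu>)"
    proof (rule nn_integral_mono)
      fix x
      \<comment> \<open>Equality where \<open>d x\<close> is positive; where it is zero the left
        side vanishes.\<close>
      have "d x * exp (\<phi> x - ln (d x)) \<le> exp (\<phi> x)"
        using d0[of x] by (cases "d x = 0") (simp_all add: exp_diff)
      then show "ennreal (d x) * ennreal (exp (\<phi> x - ln (d x))) \<le> ennreal (exp (\<phi> x))"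
        using d0[of x] by (simp add: ennreal_leI flip: ennreal_mult)
    qed
    also note le
    finally have e1: "(\<integral>\<^sup>+x. ennreal (exp (\<phi> x - ln (d x))) \<partial>\<gamma>) \<le> 1" .
    have em: "(\<lambda>x. exp (\<phi> x - ln (d x))) \<in> borel_measurable \<gamma>" unfolding mg by measurable
    have i_e: "integrable \<gamma> (\<lambda>x. exp (\<phi> x - ln (d x)))"
      using e1 em by (intro integrableI_nonneg) (auto simp: less_top[symmetric] top_unique)
    have e2: "(LINT x|\<gamma>. exp (\<phi> x - ln (d x))) \<le> 1"
      using e1 nn_integral_eq_integral[OF i_e] by simp
    have "(LINT x|\<gamma>. \<phi> x) - (LINT x|\<gamma>. ln (d x)) = (LINT x|\<gamma>. \<phi> x - ln (d x))"
      using int i_ln by simp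
    also have "\<dots> \<le> (LINT x|\<gamma>. exp (\<phi> x - ln (d x)) - 1)"
    proof (rule integral_mono)
      show "\<phi> x - ln (d x) \<le> exp (\<phi> x - ln (d x)) - 1" for x
        using exp_ge_add_one_self[of "\<phi> x - ln (d x)"] by linarith
    qed (use int i_ln i_e in auto)
    also have "\<dots> \<le> 0" using i_e e2 by (simp add: \<gamma>.prob_space)
    finally have "(LINT x|\<gamma>. \<phi> x) \<le> (LINT x|\<gamma>. ln (d x))" by simp
    then show ?thesis
      using KL_eq_integral[OF s ac] i_ln by (simp add: d_def)
  qed
qed

section \<open>Limits and moments\<close>

text \<open>\<open>op_trace\<close> sums over an arbitrarily chosen basis; this supplies a basis
  whose diagonal is known to converge to that value.\<close>

lemma trace_class_pos_op_trace:
  fixes C :: "'a::{real_inner,polish_space} \<Rightarrow>\<^sub>L 'a"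
  assumes "trace_class_pos C"
  obtains B where "hilbert_basis B" "((\<lambda>e. inner (C e) e) has_sum op_trace C) B"
proof -
  from assms obtain B0 where C: "positive_op C" and B0: "hilbert_basis B0"
    and s: "(\<lambda>e. inner (C e) e) summable_on B0" by (auto simp: trace_class_pos_def)
  from trace_class_eigenbasis[OF C B0 s] obtain E where E: "eigenbasis C E" by blast
  note h = trace_has_sum[OF C E B0 has_sum_infsum[OF s] eigenbasis_basis[OF E]]
  show thesis
    using that[OF eigenbasis_basis[OF E]] h op_trace_eigenbasis[OF C E h] by simp
qed

text \<open>Boundedness in \<open>L\<^sup>2\<close> gives uniform integrability, so no mass is lost in the limit.\<close>
lemma (in prob_space) nn_integral_limit_L2_bounded:
  fixes Z :: "'a \<Rightarrow> real" and Zn :: "nat \<Rightarrow> 'a \<Rightarrow> real"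
  assumes [measurable]: "Z \<in> borel_measurable M" "\<And>n. Zn n \<in> borel_measurable M"
    and nn: "\<And>n x. 0 \<le> Zn n x" "\<And>x. 0 \<le> Z x"
    and lim: "AE x in M. (\<lambda>n. Zn n x) \<longlonglongrightarrow> Z x"
    and one: "\<And>n. (\<integral>\<^sup>+x. ennreal (Zn n x) \<partial>M) = 1"
    and V: "\<And>n. (\<integral>\<^sup>+x. ennreal ((Zn n x)\<^sup>2) \<partial>M) \<le> ennreal V"
  shows "1 \<le> (\<integral>\<^sup>+x. ennreal (Z x) \<partial>M)"
proof (rule ccontr)
  assume "\<not> ?thesis"
  then have lt: "(\<integral>\<^sup>+x. ennreal (Z x) \<partial>M) < 1" by simp
  then have iZ: "integrable M Z"
    by (intro integrableI_nonneg) (auto simp: nn elim: less_trans)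
  define v where "v = max V 0"
  have v0: "0 \<le> v" by (simp add: v_def)
  have Vn: "(\<integral>\<^sup>+x. ennreal ((Zn n x)\<^sup>2) \<partial>M) \<le> ennreal v" for n
    using V[of n] by (rule order_trans) (simp add: v_def ennreal_leI)
  have i2: "integrable M (\<lambda>x. (Zn n x)\<^sup>2)" for n
    by (rule integrableI_nonneg) (use Vn[of n] in \<open>auto intro: le_less_trans\<close>)
  have i1: "integrable M (Zn n)" for n
    by (rule integrableI_nonneg) (auto simp: nn one)
  have e1: "(LINT x|M. Zn n x) = 1" for n
    using one[of n] nn_integral_eq_integral[OF i1, of n] by (simp add: nn)
  have e2: "(LINT x|M. (Zn n x)\<^sup>2) \<le> v" for n
    using Vn[of n] nn_integral_eq_integral[OF i2, of n] v0 by simp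
  have key: "1 - v / R \<le> (LINT x|M. Z x)" if R: "R > 0" for R
  proof -
    have im: "integrable M (\<lambda>x. min (Zn n x) R)" for n
      by (rule integrable_const_bound[of _ R]) (use nn R in \<open>auto simp: min_def\<close>)
    have low: "1 - v / R \<le> (LINT x|M. min (Zn n x) R)" for n
    proof -
      \<comment> \<open>Above the level R one has z \<le> z^2 / R, so truncation loses at most v / R
        of the mass, uniformly in n.\<close>
      have pt: "z \<le> min z R + z\<^sup>2 / R" if "0 \<le> z" for z :: real
      proof (cases "z \<le> R")
        case False
        then have "R * z \<le> z * z" using R by (intro mult_right_mono) auto
        then have "z \<le> z\<^sup>2 / R" using R by (simp add: field_simps power2_eq_square)
        then show ?thesis using R False by simp
      qed (use R in simp)
      have "1 = (LINT x|M. Zn n x)" by (simp add: e1)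
      also have "\<dots> \<le> (LINT x|M. min (Zn n x) R + (Zn n x)\<^sup>2 / R)"
        by (rule integral_mono) (use i1 im i2 pt nn in auto)
      also have "\<dots> = (LINT x|M. min (Zn n x) R) + (LINT x|M. (Zn n x)\<^sup>2) / R"
        using im i2 by simp
      also have "(LINT x|M. (Zn n x)\<^sup>2) / R \<le> v / R"
        using e2 R by (intro divide_right_mono) auto
      finally show ?thesis by simp
    qed
    have "(\<lambda>n. LINT x|M. min (Zn n x) R) \<longlonglongrightarrow> (LINT x|M. min (Z x) R)"
    proof (rule integral_dominated_convergence[where w = "\<lambda>_. R"])
      show "AE x in M. (\<lambda>n. min (Zn n x) R) \<longlonglongrightarrow> min (Z x) R"
        using lim by (rule AE_mp) (auto intro!: AE_I2 tendsto_min)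
      show "AE x in M. norm (min (Zn n x) R) \<le> R" for n
        using nn R by (intro AE_I2) (auto simp: min_def)
    qed auto
    then have "1 - v / R \<le> (LINT x|M. min (Z x) R)"
      by (rule LIMSEQ_le_const) (use low in auto)
    also have "\<dots> \<le> (LINT x|M. Z x)"
      by (rule integral_mono) (use iZ nn R in \<open>auto intro!: integrable_const_bound[of _ R] simp: min_def\<close>)
    finally show ?thesis .
  qed
  have "(\<lambda>n. 1 - v * inverse (real (Suc n))) \<longlonglongrightarrow> 1 - v * 0"
    by (intro tendsto_intros LIMSEQ_inverse_real_of_nat)
  moreover have "1 - v * inverse (real (Suc n)) \<le> (LINT x|M. Z x)" for n
    using key[of "real (Suc n)"] by (simp add: divide_inverse)
  ultimately have "1 - v * 0 \<le> (LINT x|M. Z x)"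
    by (intro LIMSEQ_le_const2) auto
  then show False
    using lt nn_integral_eq_integral[OF iZ] nn by simp
qed

text \<open>Domination on a set and on its complement, together with equal total mass, forces
  equality. It upgrades the one-sided bounds that Fatou's lemma gives for the marginals.\<close>

lemma measure_eqI_le:
  assumes M: "prob_space M" and N: "prob_space N" and s: "sets M = sets N"
    and le: "\<And>A. A \<in> sets N \<Longrightarrow> emeasure M A \<le> emeasure N A"
  shows "M = N"
proof (rule measure_eqI[OF s])
  interpret M: prob_space M by fact
  interpret N: prob_space N by fact
  fix A assume A: "A \<in> sets M"
  then have A': "A \<in> sets N" using s by simp
  have sp: "space M = space N" by (rule sets_eq_imp_space_eq[OF s])
  have "measure M A \<le> measure N A"
    using le[OF A'] by (simp add: M.emeasure_eq_measure N.emeasure_eq_measure)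
  moreover have "measure M (space M - A) \<le> measure N (space N - A)"
    using le[of "space N - A"] A' by (simp add: sp M.emeasure_eq_measure N.emeasure_eq_measure)
  ultimately have "measure M A = measure N A"
    using M.prob_compl[OF A] N.prob_compl[OF A'] by linarith
  then show "emeasure M A = emeasure N A" by (simp add: M.emeasure_eq_measure N.emeasure_eq_measure)
qed

context gaussian
begin

lemma integrable_inner: "integrable \<mu> (\<lambda>x. inner (x - m) h)" (is ?i)
  and integral_inner: "(LINT x|\<mu>. inner (x - m) h) = 0" (is ?e)
proof -
  let ?\<sigma> = "sqrt (inner (C h) h)"
  have id: "integrable std_normal_distribution (\<lambda>z. z)"
    using integrable_std_normal_distribution_moment[of 1] unfolding power_one_right .
  have "integrable (distr std_normal_distribution borel (\<lambda>z. ?\<sigma> * z)) (\<lambda>t. t)"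
    by (rule integrable_distr_eq[THEN iffD2]) (measurable, rule integrable_mult_right, rule id)
  then have "integrable (distr \<mu> borel (\<lambda>x. inner (x - m) h)) (\<lambda>t. t)"
    unfolding distr_inner .
  then show ?i by (rule integrable_distr_eq[THEN iffD1, rotated 2]) measurable
  have "(LINT x|\<mu>. inner (x - m) h) = (LINT t|distr \<mu> borel (\<lambda>x. inner (x - m) h). t)"
    by (rule integral_distr[symmetric]) measurable
  also have "\<dots> = (LINT z|std_normal_distribution. ?\<sigma> * z)"
    unfolding distr_inner by (rule integral_distr) measurable
  also have "\<dots> = 0"
    using integral_std_normal_distribution_moment_odd[of 1] by simp
  finally show ?e .
qed

lemma integrable_norm_square:
  assumes B: "hilbert_basis B" and T: "((\<lambda>e. inner (C e) e) has_sum T) B"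
  shows "integrable \<mu> (\<lambda>x. (norm (x - m))\<^sup>2)" "(LINT x|\<mu>. (norm (x - m))\<^sup>2) = T"
proof -
  have T0: "0 \<le> T" using T by (rule has_sum_nonneg) (rule positive_op_nonneg[OF C])
  have nn: "(\<integral>\<^sup>+x. ennreal ((norm (x - m))\<^sup>2) \<partial>\<mu>) = ennreal T"
    by (rule nn_integral_parseval[where L = "\<lambda>e. e" and q = "\<lambda>x. (norm x)\<^sup>2", OF B parseval[OF B] T])
  show i: "integrable \<mu> (\<lambda>x. (norm (x - m))\<^sup>2)"
    by (rule integrableI_nonneg) (simp_all add: nn)
  show "(LINT x|\<mu>. (norm (x - m))\<^sup>2) = T"
    using nn nn_integral_eq_integral[OF i] T0 by simp
qed

text \<open>The expected sum is finite, hence the series converges almost everywhere. The hypothesis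
  on \<open>h\<close> asks for unit variance only where the weight is nonzero, which admits the zero
  vectors at padded indices.\<close>

lemma weighted_square_sum:
  fixes c :: "nat \<Rightarrow> real"
  assumes c: "\<And>k. 0 \<le> c k" "c sums s" and h: "\<And>k. c k * inner (C (h k)) (h k) = c k"
  shows "AE x in \<mu>. summable (\<lambda>k. c k * (inner (x - m) (h k))\<^sup>2)"
    and "integrable \<mu> (\<lambda>x. \<Sum>k. c k * (inner (x - m) (h k))\<^sup>2)"
    and "(LINT x|\<mu>. (\<Sum>k. c k * (inner (x - m) (h k))\<^sup>2)) = s"
proof -
  let ?f = "\<lambda>k x. c k * (inner (x - m) (h k))\<^sup>2"
  have i: "integrable \<mu> (?f k)" for k by (intro integrable_mult_right integrable_inner_square)
  have e: "(LINT x|\<mu>. ?f k x) = c k" for k by (simp add: integral_inner_square h)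
  have "(\<integral>\<^sup>+x. (\<Sum>k. ennreal (?f k x)) \<partial>\<mu>) = (\<Sum>k. \<integral>\<^sup>+x. ennreal (?f k x) \<partial>\<mu>)"
    by (rule nn_integral_suminf) measurable
  also have "\<dots> = (\<Sum>k. ennreal (c k))"
  proof (rule arg_cong[where f = suminf], rule ext)
    fix k
    have "(\<integral>\<^sup>+x. ennreal (?f k x) \<partial>\<mu>) = ennreal (LINT x|\<mu>. ?f k x)"
      by (rule nn_integral_eq_integral[OF i]) (simp add: c(1))
    then show "(\<integral>\<^sup>+x. ennreal (?f k x) \<partial>\<mu>) = ennreal (c k)" unfolding e .
  qed
  also have "\<dots> = ennreal s"
    using c by (simp add: suminf_ennreal2 sums_iff)
  finally have "AE x in \<mu>. (\<Sum>k. ennreal (?f k x)) \<noteq> \<infinity>"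
    by (intro nn_integral_PInf_AE) auto
  then show ae: "AE x in \<mu>. summable (\<lambda>k. ?f k x)"
  proof (rule AE_mp, intro AE_I2 impI)
    fix x assume "(\<Sum>k. ennreal (?f k x)) \<noteq> \<infinity>"
    then show "summable (\<lambda>k. ?f k x)" by (intro summable_suminf_not_top) (simp_all add: c(1))
  qed
  have nf: "norm (?f k x) = ?f k x" for k x using c(1)[of k] by simp
  have ae': "AE x in \<mu>. summable (\<lambda>k. norm (?f k x))" unfolding nf by (rule ae)
  have sm: "summable (\<lambda>k. LINT x|\<mu>. norm (?f k x))"
    unfolding nf e using c(2) by (simp add: sums_iff)
  show "integrable \<mu> (\<lambda>x. \<Sum>k. ?f k x)" by (rule integrable_suminf[OF i ae' sm])
  show "(LINT x|\<mu>. (\<Sum>k. ?f k x)) = s"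
    using integral_suminf[OF i ae' sm] c(2) unfolding e by (simp only: sums_iff)
qed

end

section \<open>The Schroedinger potentials\<close>

lemma nn_integral_le_of_AE_tendsto:
  fixes u :: "nat \<Rightarrow> 'a \<Rightarrow> ennreal"
  assumes [measurable]: "\<And>n. u n \<in> borel_measurable M"
    and lim: "AE x in M. (\<lambda>n. u n x) \<longlonglongrightarrow> v x" and L: "\<And>n. (\<integral>\<^sup>+x. u n x \<partial>M) = L"
  shows "(\<integral>\<^sup>+x. v x \<partial>M) \<le> L"
proof -
  have "(\<integral>\<^sup>+x. v x \<partial>M) = (\<integral>\<^sup>+x. liminf (\<lambda>n. u n x) \<partial>M)"
  proof (rule nn_integral_cong_AE, use lim in \<open>rule AE_mp\<close>, intro AE_I2 impI)
    fix x assume "(\<lambda>n. u n x) \<longlonglongrightarrow> v x"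
    then show "v x = liminf (\<lambda>n. u n x)" by (simp add: lim_imp_Liminf)
  qed
  also have "\<dots> \<le> liminf (\<lambda>n. \<integral>\<^sup>+x. u n x \<partial>M)" by (rule nn_integral_liminf) measurable
  finally show ?thesis by (simp add: L Liminf_const)
qed

lemma entropic_rate_times_plus2:
  "0 \<le> t \<Longrightarrow> entropic_rate \<epsilon> t * (entropic_rate \<epsilon> t + 2) = 16 / \<epsilon>\<^sup>2 * t"
proof -
  assume t: "0 \<le> t"
  define q where "q = sqrt (1 + 16 / \<epsilon>\<^sup>2 * t)"
  have "entropic_rate \<epsilon> t * (entropic_rate \<epsilon> t + 2) = q\<^sup>2 - 1"
    unfolding entropic_rate_def q_def[symmetric] by (simp add: power2_eq_square algebra_simps)
  also have "q\<^sup>2 = 1 + 16 / \<epsilon>\<^sup>2 * t" using t by (simp add: q_def)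
  finally show ?thesis by simp
qed

lemma Joint_fst:
  fixes \<mu>0 \<mu>1 :: "'a::{real_inner,polish_space} measure"
  assumes "\<gamma> \<in> Joint \<mu>0 \<mu>1"
  shows "fst \<in> measurable \<gamma> \<mu>0" "AE x in \<mu>0. P x \<Longrightarrow> AE p in \<gamma>. P (fst p)"
    "integrable \<mu>0 (f :: 'a \<Rightarrow> real) \<Longrightarrow> integrable \<gamma> (\<lambda>p. f (fst p))"
    "integrable \<mu>0 f \<Longrightarrow> (LINT p|\<gamma>. f (fst p)) = (LINT x|\<mu>0. f x)"
proof -
  have s: "sets \<gamma> = sets (\<mu>0 \<Otimes>\<^sub>M \<mu>1)" and d: "distr \<gamma> \<mu>0 fst = \<mu>0" using assms by (auto simp: Joint_def)
  show m: "fst \<in> measurable \<gamma> \<mu>0" using measurable_fst measurable_cong_sets[OF s refl] by blast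
  show "AE x in \<mu>0. P x \<Longrightarrow> AE p in \<gamma>. P (fst p)" by (rule AE_distrD[OF m, unfolded d])
  show "integrable \<mu>0 f \<Longrightarrow> integrable \<gamma> (\<lambda>p. f (fst p))" using integrable_distr[OF m, of f] d by simp
  show "integrable \<mu>0 f \<Longrightarrow> (LINT p|\<gamma>. f (fst p)) = (LINT x|\<mu>0. f x)"
    using integral_distr[OF m, of f] d by simp
qed

lemma Joint_snd:
  fixes \<mu>0 \<mu>1 :: "'a::{real_inner,polish_space} measure"
  assumes "\<gamma> \<in> Joint \<mu>0 \<mu>1"
  shows "snd \<in> measurable \<gamma> \<mu>1" "AE x in \<mu>1. P x \<Longrightarrow> AE p in \<gamma>. P (snd p)"
    "integrable \<mu>1 (f :: 'a \<Rightarrow> real) \<Longrightarrow> integrable \<gamma> (\<lambda>p. f (snd p))"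
    "integrable \<mu>1 f \<Longrightarrow> (LINT p|\<gamma>. f (snd p)) = (LINT x|\<mu>1. f x)"
proof -
  have s: "sets \<gamma> = sets (\<mu>0 \<Otimes>\<^sub>M \<mu>1)" and d: "distr \<gamma> \<mu>1 snd = \<mu>1" using assms by (auto simp: Joint_def)
  show m: "snd \<in> measurable \<gamma> \<mu>1" using measurable_snd measurable_cong_sets[OF s refl] by blast
  show "AE x in \<mu>1. P x \<Longrightarrow> AE p in \<gamma>. P (snd p)" by (rule AE_distrD[OF m, unfolded d])
  show "integrable \<mu>1 f \<Longrightarrow> integrable \<gamma> (\<lambda>p. f (snd p))" using integrable_distr[OF m, of f] d by simp
  show "integrable \<mu>1 f \<Longrightarrow> (LINT p|\<gamma>. f (snd p)) = (LINT x|\<mu>1. f x)"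
    using integral_distr[OF m, of f] d by simp
qed

section \<open>Finite-dimensional densities and their moments\<close>

locale entropic_coupling = X: gaussian \<mu>0 m0 C0 + Y: gaussian \<mu>1 m1 C1
  for \<mu>0 :: "'a::{real_inner,polish_space} measure" and m0 C0
    and \<mu>1 :: "'a measure" and m1 C1 +
  fixes \<epsilon> :: real and S :: "'a \<Rightarrow>\<^sub>L 'a" and B T s a b
  assumes eps: "0 < \<epsilon>" and S: "positive_op S" and SS: "S o\<^sub>L S = C0" and B: "hilbert_basis B"
    and T: "((\<lambda>e. inner (C1 (S e)) (S e)) has_sum T) B" and s_sums: "(\<lambda>k::nat. (s k)\<^sup>2) sums T"
    and C0a: "\<And>k. C0 (a k) = s k *\<^sub>R b k"
    and aa: "\<And>k l. inner (C0 (a k)) (a l) = (if k = l \<and> s k \<noteq> 0 then 1 else 0)"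
    and bb: "\<And>k l. inner (C1 (b k)) (b l) = (if k = l \<and> s k \<noteq> 0 then 1 else 0)"
begin

sublocale P: pair_prob_space \<mu>0 \<mu>1 ..

definition "M k = entropic_rate \<epsilon> ((s k)\<^sup>2)"
text \<open>The cost contains -2 times the mixed term, so an optimal log-density contains 2 /
  \<epsilon> times it; \<open>s k\<close> is the weight of the k-th product in its
  expansion.\<close>

definition "\<kappa> k = 2 * s k / \<epsilon>"
definition "\<xi> k x = inner (x - m0) (a k)"
definition "\<eta> k y = inner (y - m1) (b k)"
definition "E n p = (\<Sum>k<n. mehler_exponent (M k) (\<kappa> k) (\<xi> k (fst p)) (\<eta> k (snd p)))"

lemma M_nonneg: "0 \<le> M k"
  unfolding M_def by (rule entropic_rate_nonneg) simp

lemma kappa_square: "(\<kappa> k)\<^sup>2 = M k * (M k + 2) / 4"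
  unfolding M_def entropic_rate_times_plus2[OF zero_le_power2] \<kappa>_def
  by (simp add: power_divide power_mult_distrib)

lemma degenerate: "s k = 0 \<Longrightarrow> M k = 0" "s k = 0 \<Longrightarrow> \<kappa> k = 0"
  by (simp_all add: M_def \<kappa>_def)

lemma summable_M: "summable M"
proof (rule summable_comparison_test')
  show "summable (\<lambda>k. 8 / \<epsilon>\<^sup>2 * (s k)\<^sup>2)" using s_sums by (intro summable_mult) (simp add: sums_iff)
  show "norm (M k) \<le> 8 / \<epsilon>\<^sup>2 * (s k)\<^sup>2" for k
    using entropic_rate_le[of "(s k)\<^sup>2" \<epsilon>] M_nonneg[of k] by (simp add: M_def)
qed

lemma measurable_coords [measurable]:
  "\<xi> k \<in> borel_measurable borel" "\<eta> k \<in> borel_measurable borel"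
  unfolding \<xi>_def[abs_def] \<eta>_def[abs_def] by measurable

lemma E_measurable [measurable]: "E n \<in> borel_measurable (\<mu>0 \<Otimes>\<^sub>M \<mu>1)"
  unfolding E_def[abs_def] mehler_exponent_def by measurable

lemma exp_E: "ennreal (exp (c * E n p)) = (\<Prod>k<n. ennreal (exp (c * mehler_exponent (M k) (\<kappa> k) (\<xi> k (fst p)) (\<eta> k (snd p)))))"
  by (simp add: E_def sum_distrib_left exp_sum prod_ennreal)

text \<open>\<open>v\<close> stands for the variance of either coordinate, so one statement serves
  both marginals. For \<open>s k = 0\<close> the exponent vanishes and the factor is 1.\<close>

lemma mehler_factor:
  assumes v: "v = (if s k \<noteq> 0 then 1 else 0 :: real)"
  shows "(\<integral>\<^sup>+z. ennreal (exp (1 * mehler_exponent (M k) (\<kappa> k) t (sqrt v * z))) \<partial>std_normal_distribution) = 1"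
proof -
  interpret N: prob_space std_normal_distribution by (rule prob_space_normal_density) simp
  show ?thesis
  proof (cases "s k = 0")
    case True
    then show ?thesis
      using N.emeasure_space_1 by (simp add: degenerate mehler_exponent_def)
  next
    case False
    then show ?thesis
      using mehler_marginal[OF M_nonneg[of k] kappa_square[of k], of t] by (simp add: v)
  qed
qed

lemma marginal_snd: "(\<integral>\<^sup>+y. ennreal (exp (E n (x, y))) \<partial>\<mu>1) = 1"
proof -
  have "(\<integral>\<^sup>+y. ennreal (exp (E n (x, y))) \<partial>\<mu>1)
      = (\<integral>\<^sup>+y. (\<Prod>k<n. ennreal (exp (1 * mehler_exponent (M k) (\<kappa> k) (\<xi> k x) (inner (y - m1) (b k))))) \<partial>\<mu>1)"
    using exp_E[of 1 n] by (simp add: \<eta>_def)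
  also have "\<dots> = (\<Prod>k<n. \<integral>\<^sup>+z. ennreal (exp (1 * mehler_exponent (M k) (\<kappa> k) (\<xi> k x) (sqrt (inner (C1 (b k)) (b k)) * z))) \<partial>std_normal_distribution)"
    by (rule Y.nn_integral_prod_inner) (simp_all add: bb mehler_exponent_def)
  also have "\<dots> = 1"
    by (intro prod.neutral ballI mehler_factor) (simp add: bb)
  finally show ?thesis .
qed

lemma marginal_fst: "(\<integral>\<^sup>+x. ennreal (exp (E n (x, y))) \<partial>\<mu>0) = 1"
proof -
  have "(\<integral>\<^sup>+x. ennreal (exp (E n (x, y))) \<partial>\<mu>0)
      = (\<integral>\<^sup>+x. (\<Prod>k<n. ennreal (exp (1 * mehler_exponent (M k) (\<kappa> k) (\<eta> k y) (inner (x - m0) (a k))))) \<partial>\<mu>0)"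
    using exp_E[of 1 n] by (simp add: \<xi>_def mehler_exponent_commute[of _ _ "\<eta> _ y"])
  also have "\<dots> = (\<Prod>k<n. \<integral>\<^sup>+z. ennreal (exp (1 * mehler_exponent (M k) (\<kappa> k) (\<eta> k y) (sqrt (inner (C0 (a k)) (a k)) * z))) \<partial>std_normal_distribution)"
    by (rule X.nn_integral_prod_inner) (simp_all add: aa mehler_exponent_def)
  also have "\<dots> = 1"
    by (intro prod.neutral ballI mehler_factor) (simp add: aa)
  finally show ?thesis .
qed

text \<open>Independence is used twice: once y is integrated out, each factor \<open>G k\<close>
  depends on a single coordinate of x. Then \<open>1 + t \<le> exp t\<close> gives a bound
  independent of \<open>n\<close>.\<close>

lemma second_moment: "(\<integral>\<^sup>+p. ennreal ((exp (E n p))\<^sup>2) \<partial>(\<mu>0 \<Otimes>\<^sub>M \<mu>1)) \<le> ennreal (exp (suminf M / 2))"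
proof -
  interpret N: prob_space std_normal_distribution by (rule prob_space_normal_density) simp
  define G where "G k t = (\<integral>\<^sup>+z. ennreal (exp (2 * mehler_exponent (M k) (\<kappa> k) t (sqrt (inner (C1 (b k)) (b k)) * z))) \<partial>std_normal_distribution)" for k t
  have G_m [measurable]: "G k \<in> borel_measurable borel" for k
    unfolding G_def[abs_def] mehler_exponent_def by measurable
  have "(\<integral>\<^sup>+p. ennreal ((exp (E n p))\<^sup>2) \<partial>(\<mu>0 \<Otimes>\<^sub>M \<mu>1)) = (\<integral>\<^sup>+x. \<integral>\<^sup>+y. ennreal (exp (2 * E n (x, y))) \<partial>\<mu>1 \<partial>\<mu>0)"
    by (subst Y.nn_integral_fst[symmetric]) (simp_all flip: exp_double)
  also have "\<dots> = (\<integral>\<^sup>+x. (\<Prod>k<n. G k (inner (x - m0) (a k))) \<partial>\<mu>0)"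
  proof (rule nn_integral_cong)
    fix x
    have "(\<integral>\<^sup>+y. ennreal (exp (2 * E n (x, y))) \<partial>\<mu>1)
        = (\<integral>\<^sup>+y. (\<Prod>k<n. ennreal (exp (2 * mehler_exponent (M k) (\<kappa> k) (\<xi> k x) (inner (y - m1) (b k))))) \<partial>\<mu>1)"
      by (simp add: exp_E \<eta>_def)
    also have "\<dots> = (\<Prod>k<n. G k (\<xi> k x))"
      unfolding G_def by (rule Y.nn_integral_prod_inner) (simp_all add: bb mehler_exponent_def)
    finally show "(\<integral>\<^sup>+y. ennreal (exp (2 * E n (x, y))) \<partial>\<mu>1) = (\<Prod>k<n. G k (inner (x - m0) (a k)))"
      by (simp add: \<xi>_def)
  qed
  also have "\<dots> = (\<Prod>k<n. \<integral>\<^sup>+z. G k (sqrt (inner (C0 (a k)) (a k)) * z) \<partial>std_normal_distribution)"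
    by (rule X.nn_integral_prod_inner) (simp_all add: aa)
  also have "\<dots> = (\<Prod>k<n. ennreal (1 + M k / 2))"
  proof (rule prod.cong[OF refl])
    fix k
    show "(\<integral>\<^sup>+z. G k (sqrt (inner (C0 (a k)) (a k)) * z) \<partial>std_normal_distribution) = ennreal (1 + M k / 2)"
    proof (cases "s k = 0")
      case True
      then show ?thesis
        using N.emeasure_space_1 by (simp add: G_def degenerate mehler_exponent_def)
    next
      case False
      then show ?thesis
        using mehler_second_moment[OF M_nonneg[of k] kappa_square[of k]] by (simp add: G_def aa bb)
    qed
  qed
  also have "\<dots> = ennreal (\<Prod>k<n. 1 + M k / 2)"
    using M_nonneg by (intro prod_ennreal) simp
  also have "\<dots> \<le> ennreal (exp (suminf M / 2))"
  proof (rule ennreal_leI)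
    have "(\<Prod>k<n. 1 + M k / 2) \<le> (\<Prod>k<n. exp (M k / 2))"
      using M_nonneg by (intro prod_mono) (auto simp: add_nonneg_nonneg exp_ge_add_one_self)
    also have "\<dots> = exp ((\<Sum>k<n. M k) / 2)" by (simp add: exp_sum sum_divide_distrib)
    also have "\<dots> \<le> exp (suminf M / 2)"
      using sum_le_suminf[OF summable_M, of "{..<n}"] M_nonneg by simp
    finally show "(\<Prod>k<n. 1 + M k / 2) \<le> exp (suminf M / 2)" .
  qed
  finally show ?thesis .
qed

section \<open>Expansion of the mixed term\<close>

text \<open>The remainder of the expansion of the mixed term after \<open>n\<close> coordinates. For fixed \<open>y\<close> it is linear in
  \<open>x - m0\<close>, so its second moment is a quadratic form in \<open>C0\<close>.\<close>
definition "R n p = inner (fst p - m0) (snd p - m1) - (\<Sum>k<n. s k * \<xi> k (fst p) * \<eta> k (snd p))"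

lemma R_measurable [measurable]: "R n \<in> borel_measurable (\<mu>0 \<Otimes>\<^sub>M \<mu>1)"
  unfolding R_def[abs_def] by measurable

text \<open>For the form of \<open>C0\<close>, the vector \<open>u y\<close> is the orthogonal
  projection of \<open>y - m1\<close> onto the span of the first \<open>n\<close> vectors
  \<open>a k\<close>, with coefficients \<open>s k * \<eta> k y\<close>. Pythagoras gives the
  variance for fixed y; averaging over y leaves the trace minus the first \<open>n\<close>
  eigenvalues.\<close>

lemma remainder_second_moment:
  "(\<integral>\<^sup>+p. ennreal ((R n p)\<^sup>2) \<partial>(\<mu>0 \<Otimes>\<^sub>M \<mu>1)) = ennreal (T - (\<Sum>k<n. (s k)\<^sup>2))"
proof -
  define u where "u y = (\<Sum>k<n. (s k * \<eta> k y) *\<^sub>R a k)" for y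
  define w where "w y = (y - m1) - u y" for y
  have Rw: "R n (x, y) = inner (x - m0) (w y)" for x y
    by (simp add: R_def w_def u_def inner_diff_right inner_sum_right \<xi>_def algebra_simps)
  have C0S: "inner (C0 v) v = (norm (S v))\<^sup>2" for v
    by (simp add: SS[symmetric] positive_op_sym[OF S] power2_norm_eq_inner)
  have Cw: "inner (C0 (w y)) (w y) = (norm (S (y - m1)))\<^sup>2 - (\<Sum>k<n. (s k)\<^sup>2 * (\<eta> k y)\<^sup>2)" for y
  proof -
    have C0u: "C0 (u y) = (\<Sum>k<n. (s k * \<eta> k y) *\<^sub>R C0 (a k))"
      by (simp add: u_def blinfun.sum_right blinfun.bilinear_simps)
    have uv: "inner (C0 (u y)) (y - m1) = (\<Sum>k<n. (s k)\<^sup>2 * (\<eta> k y)\<^sup>2)"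
      unfolding C0u C0a
      by (simp add: inner_sum_left \<eta>_def inner_commute[of "b _"] power2_eq_square mult_ac)
    have uu: "inner (C0 (u y)) (u y) = (\<Sum>k<n. (s k)\<^sup>2 * (\<eta> k y)\<^sup>2)"
    proof -
      have "inner (C0 (a k)) (u y) = s k * \<eta> k y" if "k < n" for k
      proof -
        have "inner (C0 (a k)) (u y) = (\<Sum>l<n. if k = l then s k * \<eta> k y else 0)"
          unfolding u_def inner_sum_right inner_scaleR_right by (intro sum.cong refl) (auto simp: aa)
        then show ?thesis using that by simp
      qed
      then show ?thesis
        unfolding C0u inner_sum_left inner_scaleR_left
        by (intro sum.cong refl) (simp add: power2_eq_square)
    qed
    have "inner (C0 (y - m1)) (u y) = inner (C0 (u y)) (y - m1)"
      using positive_op_sym[OF X.C, of "y - m1" "u y"] inner_commute[of "y - m1" "C0 (u y)"] by (rule trans)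
    then have "inner (C0 (w y)) (w y)
        = inner (C0 (y - m1)) (y - m1) - 2 * inner (C0 (u y)) (y - m1) + inner (C0 (u y)) (u y)"
      by (simp add: w_def blinfun.diff_right inner_diff_left inner_diff_right del: minus_diff_eq)
    then show ?thesis unfolding uv uu C0S[of "y - m1"] by linarith
  qed
  have T0: "0 \<le> T" using T by (rule has_sum_nonneg) (rule positive_op_nonneg[OF Y.C])
  have "(\<integral>\<^sup>+y. ennreal ((norm (S (y - m1)))\<^sup>2) \<partial>\<mu>1) = ennreal T"
  proof (rule Y.nn_integral_parseval[where L = S and q = "\<lambda>v. (norm (S v))\<^sup>2", OF B _ T])
    show "((\<lambda>e. (inner v (S e))\<^sup>2) has_sum (norm (S v))\<^sup>2) B" for v
      using parseval[OF B, of "S v"] by (simp only: positive_op_sym[OF S])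
  qed
  moreover have "(\<lambda>y. S (y - m1)) \<in> borel_measurable borel"
    by (intro borel_measurable_continuous_onI continuous_intros)
  then have [measurable]: "(\<lambda>y. S (y - m1)) \<in> borel_measurable \<mu>1" by measurable
  moreover from calculation have iS: "integrable \<mu>1 (\<lambda>y. (norm (S (y - m1)))\<^sup>2)"
    by (intro integrableI_nonneg) simp_all
  ultimately have eS: "(LINT y|\<mu>1. (norm (S (y - m1)))\<^sup>2) = T"
    using nn_integral_eq_integral[OF iS] T0 by simp
  have i\<eta>: "integrable \<mu>1 (\<lambda>y. (s k)\<^sup>2 * (\<eta> k y)\<^sup>2)" for k
    unfolding \<eta>_def by (intro integrable_mult_right Y.integrable_inner_square)
  have e\<eta>: "(LINT y|\<mu>1. (s k)\<^sup>2 * (\<eta> k y)\<^sup>2) = (s k)\<^sup>2" for k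
    unfolding \<eta>_def by (simp add: Y.integral_inner_square bb)
  have iw: "integrable \<mu>1 (\<lambda>y. inner (C0 (w y)) (w y))"
    unfolding Cw by (intro Bochner_Integration.integrable_diff iS Bochner_Integration.integrable_sum i\<eta>)
  have "(\<integral>\<^sup>+p. ennreal ((R n p)\<^sup>2) \<partial>(\<mu>0 \<Otimes>\<^sub>M \<mu>1)) = (\<integral>\<^sup>+y. \<integral>\<^sup>+x. ennreal ((R n (x, y))\<^sup>2) \<partial>\<mu>0 \<partial>\<mu>1)"
    by (rule P.nn_integral_snd[symmetric]) measurable
  also have "\<dots> = (\<integral>\<^sup>+y. ennreal (inner (C0 (w y)) (w y)) \<partial>\<mu>1)"
    by (simp add: Rw X.nn_integral_inner_square)
  also have "\<dots> = ennreal (LINT y|\<mu>1. inner (C0 (w y)) (w y))"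
    by (rule nn_integral_eq_integral[OF iw]) (simp add: positive_op_nonneg[OF X.C])
  also have "(LINT y|\<mu>1. inner (C0 (w y)) (w y)) = T - (\<Sum>k<n. (s k)\<^sup>2)"
    unfolding Cw Bochner_Integration.integral_diff[OF iS Bochner_Integration.integrable_sum[OF i\<eta>]]
      Bochner_Integration.integral_sum[OF i\<eta>] eS e\<eta> ..
  finally show ?thesis .
qed

text \<open>The second moment tends to 0, which yields pointwise convergence along a subsequence;
  that is enough to identify the limit of the densities.\<close>

lemma remainder_AE: "\<exists>r. strict_mono (r :: nat \<Rightarrow> nat) \<and> (AE p in \<mu>0 \<Otimes>\<^sub>M \<mu>1. (\<lambda>n. R (r n) p) \<longlonglongrightarrow> 0)"
proof -
  have i: "integrable (\<mu>0 \<Otimes>\<^sub>M \<mu>1) (\<lambda>p. (R n p)\<^sup>2)" for n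
    by (rule integrableI_nonneg) (simp_all add: remainder_second_moment)
  have e: "(LINT p|(\<mu>0 \<Otimes>\<^sub>M \<mu>1). norm ((R n p)\<^sup>2)) = T - (\<Sum>k<n. (s k)\<^sup>2)" for n
  proof -
    have "(\<Sum>k<n. (s k)\<^sup>2) \<le> T"
      using s_sums sum_le_suminf[of "\<lambda>k. (s k)\<^sup>2" "{..<n}"] by (simp add: sums_iff)
    then show ?thesis
      using nn_integral_eq_integral[OF i[of n]] by (simp add: remainder_second_moment)
  qed
  have "(\<lambda>n. T - (\<Sum>k<n. (s k)\<^sup>2)) \<longlonglongrightarrow> T - T"
    using s_sums unfolding sums_def by (intro tendsto_intros)
  then have "(\<lambda>n. LINT p|(\<mu>0 \<Otimes>\<^sub>M \<mu>1). norm ((R n p)\<^sup>2)) \<longlonglongrightarrow> 0" unfolding e by simp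
  from tendsto_L1_AE_subseq[OF i this] obtain r :: "nat \<Rightarrow> nat" where r: "strict_mono r"
    and ae: "AE p in \<mu>0 \<Otimes>\<^sub>M \<mu>1. (\<lambda>n. (R (r n) p)\<^sup>2) \<longlonglongrightarrow> 0" by blast
  from ae have "AE p in \<mu>0 \<Otimes>\<^sub>M \<mu>1. (\<lambda>n. R (r n) p) \<longlonglongrightarrow> 0"
  proof (rule AE_mp, intro AE_I2 impI)
    fix p assume "(\<lambda>n. (R (r n) p)\<^sup>2) \<longlonglongrightarrow> 0"
    from tendsto_real_sqrt[OF this] show "(\<lambda>n. R (r n) p) \<longlonglongrightarrow> 0"
      by (simp add: tendsto_rabs_zero_iff)
  qed
  with r show ?thesis by blast
qed

section \<open>The limiting log-density\<close>

definition "c0 = (\<Sum>k. ln (1 + M k / 2)) / 2"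
text \<open>Where the series diverges the value of \<open>suminf\<close> is meaningless, but that
  set is null for the marginal and hence for every coupling. The same applies to
  \<open>g\<close>.\<close>

definition "f x = (\<Sum>k. M k / 4 * (\<xi> k x)\<^sup>2)"
definition "g y = (\<Sum>k. M k / 4 * (\<eta> k y)\<^sup>2)"
definition "\<phi> p = c0 - f (fst p) - g (snd p) + 2 / \<epsilon> * inner (fst p - m0) (snd p - m1)"

lemma summable_ln: "summable (\<lambda>k. ln (1 + M k / 2))"
proof (rule summable_comparison_test'[OF summable_M])
  show "norm (ln (1 + M k / 2)) \<le> M k" for k
    using M_nonneg[of k] ln_add_one_self_le_self[of "M k / 2"] by simp
qed

lemma quarter_M_sums: "(\<lambda>k. M k / 4) sums (suminf M / 4)"
  by (intro sums_divide summable_sums summable_M)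

lemma quarter_M_weights:
  "M k / 4 * inner (C0 (a k)) (a k) = M k / 4" "M k / 4 * inner (C1 (b k)) (b k) = M k / 4"
  by (simp_all add: aa bb degenerate)

lemma
  shows f_AE: "AE x in \<mu>0. summable (\<lambda>k. M k / 4 * (\<xi> k x)\<^sup>2)"
    and f_integrable: "integrable \<mu>0 f" and f_integral: "(LINT x|\<mu>0. f x) = suminf M / 4"
  using X.weighted_square_sum[where c = "\<lambda>k. M k / 4" and h = a, OF _ quarter_M_sums quarter_M_weights(1)] M_nonneg
  by (simp_all add: f_def[abs_def] \<xi>_def)

lemma
  shows g_AE: "AE x in \<mu>1. summable (\<lambda>k. M k / 4 * (\<eta> k x)\<^sup>2)"
    and g_integrable: "integrable \<mu>1 g" and g_integral: "(LINT x|\<mu>1. g x) = suminf M / 4"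
  using Y.weighted_square_sum[where c = "\<lambda>k. M k / 4" and h = b, OF _ quarter_M_sums quarter_M_weights(2)] M_nonneg
  by (simp_all add: g_def[abs_def] \<eta>_def)

lemma fg_measurable [measurable]: "f \<in> borel_measurable borel" "g \<in> borel_measurable borel"
  unfolding f_def[abs_def] g_def[abs_def] by measurable

lemma phi_measurable [measurable]: "\<phi> \<in> borel_measurable (\<mu>0 \<Otimes>\<^sub>M \<mu>1)"
  unfolding \<phi>_def[abs_def] by measurable

text \<open>With it the almost everywhere facts about each marginal pass to the product by the rules
  for general couplings.\<close>

lemma prod_in_Joint: "\<mu>0 \<Otimes>\<^sub>M \<mu>1 \<in> Joint \<mu>0 \<mu>1"
proof -
  have "distr (\<mu>0 \<Otimes>\<^sub>M \<mu>1) \<mu>1 snd = \<mu>1"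
  proof (rule measure_eqI)
    fix A assume A: "A \<in> sets (distr (\<mu>0 \<Otimes>\<^sub>M \<mu>1) \<mu>1 snd)"
    have "snd -` A \<inter> space (\<mu>0 \<Otimes>\<^sub>M \<mu>1) = space \<mu>0 \<times> A" by (auto simp: space_pair_measure)
    moreover have "A \<in> sets \<mu>1" using A by simp
    ultimately show "emeasure (distr (\<mu>0 \<Otimes>\<^sub>M \<mu>1) \<mu>1 snd) A = emeasure \<mu>1 A"
      using emeasure_distr[OF measurable_snd, of A \<mu>1 \<mu>0]
        Y.emeasure_pair_measure_Times[OF sets.top, of A \<mu>0] X.emeasure_space_1
      by (simp only: mult_1)
  qed simp
  then show ?thesis
    using Y.distr_pair_fst[of \<mu>0] P.prob_space_axioms by (simp add: Joint_def)
qed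

text \<open>The finite sum of products is traded for the inner product minus its remainder, so that
  every term has a known limit.\<close>

lemma E_split: "E n p = (\<Sum>k<n. ln (1 + M k / 2)) / 2 - (\<Sum>k<n. M k / 4 * (\<xi> k (fst p))\<^sup>2)
    - (\<Sum>k<n. M k / 4 * (\<eta> k (snd p))\<^sup>2) + 2 / \<epsilon> * (inner (fst p - m0) (snd p - m1) - R n p)"
proof -
  have "2 / \<epsilon> * (inner (fst p - m0) (snd p - m1) - R n p) = (\<Sum>k<n. \<kappa> k * \<xi> k (fst p) * \<eta> k (snd p))"
    by (simp add: R_def \<kappa>_def sum_distrib_left mult.assoc)
  then show ?thesis
    by (simp add: E_def mehler_exponent_def sum.distrib sum_subtractf sum_divide_distrib distrib_left)
qed

lemma E_tendsto_AE:
  assumes "AE p in \<mu>0 \<Otimes>\<^sub>M \<mu>1. (\<lambda>n. R (r n) p) \<longlonglongrightarrow> 0" and r: "strict_mono (r :: nat \<Rightarrow> nat)"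
  shows "AE p in \<mu>0 \<Otimes>\<^sub>M \<mu>1. (\<lambda>n. E (r n) p) \<longlonglongrightarrow> \<phi> p"
  using assms(1) Joint_fst(2)[OF prod_in_Joint f_AE] Joint_snd(2)[OF prod_in_Joint g_AE]
proof eventually_elim
  fix p
  assume R: "(\<lambda>n. R (r n) p) \<longlonglongrightarrow> 0" and s1: "summable (\<lambda>k. M k / 4 * (\<xi> k (fst p))\<^sup>2)"
    and s2: "summable (\<lambda>k. M k / 4 * (\<eta> k (snd p))\<^sup>2)"
  have sub: "(\<lambda>n. \<Sum>k<r n. h k) \<longlonglongrightarrow> suminf h" if "summable h" for h :: "nat \<Rightarrow> real"
    using LIMSEQ_subseq_LIMSEQ[OF summable_LIMSEQ[OF that] r] by (simp add: o_def)
  have "(\<lambda>n. E (r n) p) \<longlonglongrightarrow> (\<Sum>k. ln (1 + M k / 2)) / 2 - (\<Sum>k. M k / 4 * (\<xi> k (fst p))\<^sup>2)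
      - (\<Sum>k. M k / 4 * (\<eta> k (snd p))\<^sup>2) + 2 / \<epsilon> * (inner (fst p - m0) (snd p - m1) - 0)"
    unfolding E_split by (intro tendsto_intros sub summable_ln s1 s2 R) simp
  then show "(\<lambda>n. E (r n) p) \<longlonglongrightarrow> \<phi> p" by (simp add: \<phi>_def c0_def f_def g_def)
qed

section \<open>The optimal coupling\<close>

definition "\<pi> = density (\<mu>0 \<Otimes>\<^sub>M \<mu>1) (\<lambda>p. ennreal (exp (\<phi> p)))"

text \<open>Fatou's lemma can only lose mass, so it bounds both marginals from above; the uniform
  second moment excludes a loss. The three claims share one subsequence.\<close>

lemma exp_phi_integral: "(\<integral>\<^sup>+p. ennreal (exp (\<phi> p)) \<partial>(\<mu>0 \<Otimes>\<^sub>M \<mu>1)) = 1"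
  and pi_fst_le: "A \<in> sets \<mu>0 \<Longrightarrow> (\<integral>\<^sup>+p. indicator A (fst p) * ennreal (exp (\<phi> p)) \<partial>(\<mu>0 \<Otimes>\<^sub>M \<mu>1)) \<le> emeasure \<mu>0 A"
  and pi_snd_le: "A \<in> sets \<mu>1 \<Longrightarrow> (\<integral>\<^sup>+p. indicator A (snd p) * ennreal (exp (\<phi> p)) \<partial>(\<mu>0 \<Otimes>\<^sub>M \<mu>1)) \<le> emeasure \<mu>1 A"
proof -
  obtain r :: "nat \<Rightarrow> nat" where r: "strict_mono r" and ae: "AE p in \<mu>0 \<Otimes>\<^sub>M \<mu>1. (\<lambda>n. R (r n) p) \<longlonglongrightarrow> 0"
    using remainder_AE by (elim exE conjE)
  note lim = E_tendsto_AE[OF ae r]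
  have fst_le: "(\<integral>\<^sup>+p. indicator A (fst p) * ennreal (exp (\<phi> p)) \<partial>(\<mu>0 \<Otimes>\<^sub>M \<mu>1)) \<le> emeasure \<mu>0 A"
    if [measurable]: "A \<in> sets \<mu>0" for A
  proof (rule nn_integral_le_of_AE_tendsto)
    show "(\<lambda>p. indicator A (fst p) * ennreal (exp (E (r n) p))) \<in> borel_measurable (\<mu>0 \<Otimes>\<^sub>M \<mu>1)" for n
      by measurable
    show "AE p in \<mu>0 \<Otimes>\<^sub>M \<mu>1. (\<lambda>n. indicator A (fst p) * ennreal (exp (E (r n) p)))
        \<longlonglongrightarrow> indicator A (fst p) * ennreal (exp (\<phi> p))"
      using lim by eventually_elim (auto simp: indicator_def intro!: tendsto_ennrealI tendsto_exp)
    fix n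
    have "(\<integral>\<^sup>+p. indicator A (fst p) * ennreal (exp (E (r n) p)) \<partial>(\<mu>0 \<Otimes>\<^sub>M \<mu>1))
        = (\<integral>\<^sup>+x. \<integral>\<^sup>+y. indicator A x * ennreal (exp (E (r n) (x, y))) \<partial>\<mu>1 \<partial>\<mu>0)"
      by (subst Y.nn_integral_fst[symmetric]) simp_all
    also have "\<dots> = (\<integral>\<^sup>+x. indicator A x \<partial>\<mu>0)"
      by (simp add: nn_integral_cmult marginal_snd)
    finally show "(\<integral>\<^sup>+p. indicator A (fst p) * ennreal (exp (E (r n) p)) \<partial>(\<mu>0 \<Otimes>\<^sub>M \<mu>1)) = emeasure \<mu>0 A"
      using that by (simp only: nn_integral_indicator)
  qed
  then show "A \<in> sets \<mu>0 \<Longrightarrow> (\<integral>\<^sup>+p. indicator A (fst p) * ennreal (exp (\<phi> p)) \<partial>(\<mu>0 \<Otimes>\<^sub>M \<mu>1)) \<le> emeasure \<mu>0 A" .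
  show "(\<integral>\<^sup>+p. indicator A (snd p) * ennreal (exp (\<phi> p)) \<partial>(\<mu>0 \<Otimes>\<^sub>M \<mu>1)) \<le> emeasure \<mu>1 A"
    if [measurable]: "A \<in> sets \<mu>1"
  proof (rule nn_integral_le_of_AE_tendsto)
    show "(\<lambda>p. indicator A (snd p) * ennreal (exp (E (r n) p))) \<in> borel_measurable (\<mu>0 \<Otimes>\<^sub>M \<mu>1)" for n
      by measurable
    show "AE p in \<mu>0 \<Otimes>\<^sub>M \<mu>1. (\<lambda>n. indicator A (snd p) * ennreal (exp (E (r n) p)))
        \<longlonglongrightarrow> indicator A (snd p) * ennreal (exp (\<phi> p))"
      using lim by eventually_elim (auto simp: indicator_def intro!: tendsto_ennrealI tendsto_exp)
    fix n
    have "(\<integral>\<^sup>+p. indicator A (snd p) * ennreal (exp (E (r n) p)) \<partial>(\<mu>0 \<Otimes>\<^sub>M \<mu>1))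
        = (\<integral>\<^sup>+y. \<integral>\<^sup>+x. indicator A y * ennreal (exp (E (r n) (x, y))) \<partial>\<mu>0 \<partial>\<mu>1)"
      by (subst P.nn_integral_snd[symmetric]) simp_all
    also have "\<dots> = (\<integral>\<^sup>+y. indicator A y \<partial>\<mu>1)"
      by (simp add: nn_integral_cmult marginal_fst)
    finally show "(\<integral>\<^sup>+p. indicator A (snd p) * ennreal (exp (E (r n) p)) \<partial>(\<mu>0 \<Otimes>\<^sub>M \<mu>1)) = emeasure \<mu>1 A"
      using that by (simp only: nn_integral_indicator)
  qed
  have "1 \<le> (\<integral>\<^sup>+p. ennreal (exp (\<phi> p)) \<partial>(\<mu>0 \<Otimes>\<^sub>M \<mu>1))"
  proof (rule P.nn_integral_limit_L2_bounded[where Zn = "\<lambda>n p. exp (E (r n) p)" and V = "exp (suminf M / 2)"])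
    show "AE p in \<mu>0 \<Otimes>\<^sub>M \<mu>1. (\<lambda>n. exp (E (r n) p)) \<longlonglongrightarrow> exp (\<phi> p)"
      using lim by eventually_elim (rule tendsto_exp)
    fix n
    have "(\<integral>\<^sup>+p. ennreal (exp (E (r n) p)) \<partial>(\<mu>0 \<Otimes>\<^sub>M \<mu>1)) = (\<integral>\<^sup>+x. \<integral>\<^sup>+y. ennreal (exp (E (r n) (x, y))) \<partial>\<mu>1 \<partial>\<mu>0)"
      by (rule Y.nn_integral_fst[symmetric]) measurable
    also have "\<dots> = 1" using X.emeasure_space_1 by (simp add: marginal_snd)
    finally show "(\<integral>\<^sup>+p. ennreal (exp (E (r n) p)) \<partial>(\<mu>0 \<Otimes>\<^sub>M \<mu>1)) = 1" .
  qed (simp_all add: second_moment)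
  \<comment> \<open>The upper bound is the marginal estimate for the whole space.\<close>
  moreover have "(\<integral>\<^sup>+p. ennreal (exp (\<phi> p)) \<partial>(\<mu>0 \<Otimes>\<^sub>M \<mu>1)) \<le> 1"
    using fst_le[of "space \<mu>0"] X.emeasure_space_1 by simp
  ultimately show "(\<integral>\<^sup>+p. ennreal (exp (\<phi> p)) \<partial>(\<mu>0 \<Otimes>\<^sub>M \<mu>1)) = 1" by (rule antisym[rotated])
qed

lemma pi_prob_space: "prob_space \<pi>"
proof
  show "emeasure \<pi> (space \<pi>) = 1"
  proof -
    have "emeasure \<pi> (space \<pi>) = (\<integral>\<^sup>+p. ennreal (exp (\<phi> p)) * indicator (space (\<mu>0 \<Otimes>\<^sub>M \<mu>1)) p \<partial>(\<mu>0 \<Otimes>\<^sub>M \<mu>1))"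
      unfolding \<pi>_def space_density by (rule emeasure_density[OF _ sets.top]) measurable
    also have "\<dots> = (\<integral>\<^sup>+p. ennreal (exp (\<phi> p)) \<partial>(\<mu>0 \<Otimes>\<^sub>M \<mu>1))"
      by (intro nn_integral_cong) (simp only: indicator_simps mult_1_right)
    finally show ?thesis by (simp only: exp_phi_integral)
  qed
qed

lemma pi_in_Joint: "\<pi> \<in> Joint \<mu>0 \<mu>1"
proof -
  interpret \<pi>: prob_space \<pi> by (rule pi_prob_space)
  have sets: "sets \<pi> = sets (\<mu>0 \<Otimes>\<^sub>M \<mu>1)" by (simp add: \<pi>_def)
  have m: "fst \<in> measurable \<pi> \<mu>0" "snd \<in> measurable \<pi> \<mu>1" by (simp_all add: \<pi>_def)
  have em: "emeasure \<pi> D = (\<integral>\<^sup>+p. indicator D p * ennreal (exp (\<phi> p)) \<partial>(\<mu>0 \<Otimes>\<^sub>M \<mu>1))" if "D \<in> sets (\<mu>0 \<Otimes>\<^sub>M \<mu>1)" for D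
    using that by (simp add: \<pi>_def emeasure_density mult.commute)
  have "distr \<pi> \<mu>0 fst = \<mu>0"
  proof (rule measure_eqI_le)
    show "prob_space (distr \<pi> \<mu>0 fst)" by (rule \<pi>.prob_space_distr[OF m(1)])
    fix A assume A: "A \<in> sets \<mu>0"
    have D: "fst -` A \<inter> space \<pi> \<in> sets (\<mu>0 \<Otimes>\<^sub>M \<mu>1)" using measurable_sets[OF m(1) A] by (simp only: sets)
    have "emeasure (distr \<pi> \<mu>0 fst) A = (\<integral>\<^sup>+p. indicator A (fst p) * ennreal (exp (\<phi> p)) \<partial>(\<mu>0 \<Otimes>\<^sub>M \<mu>1))"
      unfolding emeasure_distr[OF m(1) A] em[OF D]
      by (intro nn_integral_cong) (auto simp: \<pi>_def indicator_def)
    then show "emeasure (distr \<pi> \<mu>0 fst) A \<le> emeasure \<mu>0 A" using pi_fst_le[OF A] by simp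
  qed (simp_all add: X.prob_space_axioms)
  moreover have "distr \<pi> \<mu>1 snd = \<mu>1"
  proof (rule measure_eqI_le)
    show "prob_space (distr \<pi> \<mu>1 snd)" by (rule \<pi>.prob_space_distr[OF m(2)])
    fix A assume A: "A \<in> sets \<mu>1"
    have D: "snd -` A \<inter> space \<pi> \<in> sets (\<mu>0 \<Otimes>\<^sub>M \<mu>1)" using measurable_sets[OF m(2) A] by (simp only: sets)
    have "emeasure (distr \<pi> \<mu>1 snd) A = (\<integral>\<^sup>+p. indicator A (snd p) * ennreal (exp (\<phi> p)) \<partial>(\<mu>0 \<Otimes>\<^sub>M \<mu>1))"
      unfolding emeasure_distr[OF m(2) A] em[OF D]
      by (intro nn_integral_cong) (auto simp: \<pi>_def indicator_def)
    then show "emeasure (distr \<pi> \<mu>1 snd) A \<le> emeasure \<mu>1 A" using pi_snd_le[OF A] by simp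
  qed (simp_all add: Y.prob_space_axioms)
  ultimately show ?thesis using sets \<pi>.prob_space_axioms by (simp add: Joint_def)
qed

section \<open>Values over arbitrary couplings\<close>

context
  fixes B0 B1 t0 t1
  assumes t0: "hilbert_basis B0" "((\<lambda>e. inner (C0 e) e) has_sum t0) B0"
    and t1: "hilbert_basis B1" "((\<lambda>e. inner (C1 e) e) has_sum t1) B1"
begin

lemma Joint_integrable_inner:
  assumes \<gamma>: "\<gamma> \<in> Joint \<mu>0 \<mu>1"
  shows "integrable \<gamma> (\<lambda>p. inner (fst p - m0) (snd p - m1))"
proof (rule Bochner_Integration.integrable_bound)
  show "integrable \<gamma> (\<lambda>p. (norm (fst p - m0))\<^sup>2 + (norm (snd p - m1))\<^sup>2)"
    by (intro Bochner_Integration.integrable_add Joint_fst(3)[OF \<gamma>, where f = "\<lambda>x. (norm (x - m0))\<^sup>2"]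
        Joint_snd(3)[OF \<gamma>, where f = "\<lambda>y. (norm (y - m1))\<^sup>2"] X.integrable_norm_square(1)[OF t0]
        Y.integrable_norm_square(1)[OF t1])
  have [measurable]: "fst \<in> borel_measurable \<gamma>" "snd \<in> borel_measurable \<gamma>"
    using Joint_fst(1)[OF \<gamma>] Joint_snd(1)[OF \<gamma>] by (simp_all cong: measurable_cong_sets)
  show "(\<lambda>p. inner (fst p - m0) (snd p - m1)) \<in> borel_measurable \<gamma>" by measurable
  have "\<bar>inner u v\<bar> \<le> (norm u)\<^sup>2 + (norm v)\<^sup>2" for u v :: 'a
  proof -
    have "\<bar>inner u v\<bar> \<le> norm u * norm v" by (rule Cauchy_Schwarz_ineq2)
    moreover have "0 \<le> (norm u - norm v)\<^sup>2" "0 \<le> norm u * norm v" by simp_all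
    ultimately show ?thesis by (simp add: power2_diff)
  qed
  then show "AE p in \<gamma>. norm (inner (fst p - m0) (snd p - m1)) \<le> norm ((norm (fst p - m0))\<^sup>2 + (norm (snd p - m1))\<^sup>2)"
    by (intro AE_I2) simp
qed

text \<open>\<open>f\<close> and \<open>g\<close> contribute \<open>suminf M / 4\<close> each
  through the marginals; only the mixed term sees the coupling.\<close>

lemma Joint_phi:
  assumes \<gamma>: "\<gamma> \<in> Joint \<mu>0 \<mu>1"
  shows "integrable \<gamma> \<phi>"
    "(LINT p|\<gamma>. \<phi> p) = c0 - suminf M / 2 + 2 / \<epsilon> * (LINT p|\<gamma>. inner (fst p - m0) (snd p - m1))"
proof -
  interpret \<gamma>: prob_space \<gamma> using \<gamma> by (simp add: Joint_def)
  note i = Joint_fst(3)[OF \<gamma> f_integrable] Joint_snd(3)[OF \<gamma> g_integrable] Joint_integrable_inner[OF \<gamma>]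
  note e = Joint_fst(4)[OF \<gamma> f_integrable] Joint_snd(4)[OF \<gamma> g_integrable]
  show "integrable \<gamma> \<phi>" unfolding \<phi>_def[abs_def] using i by simp
  show "(LINT p|\<gamma>. \<phi> p) = c0 - suminf M / 2 + 2 / \<epsilon> * (LINT p|\<gamma>. inner (fst p - m0) (snd p - m1))"
    unfolding \<phi>_def using i e by (simp add: \<gamma>.prob_space f_integral g_integral)
qed

text \<open>After centring at the means, the linear terms integrate to zero. The second claim allows
  \<open>ennreal\<close> to be removed before a real summand of either sign is added.\<close>

lemma Joint_quadratic_cost:
  assumes \<gamma>: "\<gamma> \<in> Joint \<mu>0 \<mu>1"
  shows "(\<integral>\<^sup>+p. ennreal ((norm (fst p - snd p))\<^sup>2) \<partial>\<gamma>)
    = ennreal ((norm (m0 - m1))\<^sup>2 + t0 + t1 - 2 * (LINT p|\<gamma>. inner (fst p - m0) (snd p - m1)))"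
    and "0 \<le> (norm (m0 - m1))\<^sup>2 + t0 + t1 - 2 * (LINT p|\<gamma>. inner (fst p - m0) (snd p - m1))"
proof -
  interpret \<gamma>: prob_space \<gamma> using \<gamma> by (simp add: Joint_def)
  let ?I = "\<lambda>p. inner (fst p - m0) (snd p - m1)" and ?d = "m0 - m1"
  have eq: "(norm (fst p - snd p))\<^sup>2 = (norm (fst p - m0))\<^sup>2 + (norm (snd p - m1))\<^sup>2 + (norm ?d)\<^sup>2
      - 2 * ?I p + 2 * inner (fst p - m0) ?d - 2 * inner (snd p - m1) ?d" for p :: "'a \<times> 'a"
  proof -
    have "fst p - snd p = (fst p - m0) - (snd p - m1) + ?d" by simp
    moreover have "(norm (u - v + w))\<^sup>2 = (norm u)\<^sup>2 + (norm v)\<^sup>2 + (norm w)\<^sup>2 - 2 * inner u v + 2 * inner u w - 2 * inner v w" for u v w :: 'a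
      by (simp add: power2_norm_eq_inner inner_add_left inner_add_right inner_diff_left inner_diff_right inner_commute)
    ultimately show ?thesis by metis
  qed
  note iX = Joint_fst(3)[OF \<gamma> X.integrable_norm_square(1)[OF t0]] Joint_fst(3)[OF \<gamma> X.integrable_inner[of ?d]]
  note iY = Joint_snd(3)[OF \<gamma> Y.integrable_norm_square(1)[OF t1]] Joint_snd(3)[OF \<gamma> Y.integrable_inner[of ?d]]
  note eX = Joint_fst(4)[OF \<gamma> X.integrable_norm_square(1)[OF t0]] Joint_fst(4)[OF \<gamma> X.integrable_inner[of ?d]]
  note eY = Joint_snd(4)[OF \<gamma> Y.integrable_norm_square(1)[OF t1]] Joint_snd(4)[OF \<gamma> Y.integrable_inner[of ?d]]
  have i: "integrable \<gamma> (\<lambda>p. (norm (fst p - snd p))\<^sup>2)"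
    unfolding eq using iX iY Joint_integrable_inner[OF \<gamma>] by simp
  have e: "(LINT p|\<gamma>. (norm (fst p - snd p))\<^sup>2) = (norm ?d)\<^sup>2 + t0 + t1 - 2 * (LINT p|\<gamma>. ?I p)"
    unfolding eq using iX iY eX eY Joint_integrable_inner[OF \<gamma>]
    by (simp add: \<gamma>.prob_space X.integrable_norm_square(2)[OF t0] Y.integrable_norm_square(2)[OF t1]
        X.integral_inner Y.integral_inner)
  show "(\<integral>\<^sup>+p. ennreal ((norm (fst p - snd p))\<^sup>2) \<partial>\<gamma>) = ennreal ((norm ?d)\<^sup>2 + t0 + t1 - 2 * (LINT p|\<gamma>. ?I p))"
    using nn_integral_eq_integral[OF i] by (simp add: e)
  have "0 \<le> (LINT p|\<gamma>. (norm (fst p - snd p))\<^sup>2)" by (rule Bochner_Integration.integral_nonneg) simp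
  then show "0 \<le> (norm ?d)\<^sup>2 + t0 + t1 - 2 * (LINT p|\<gamma>. ?I p)" unfolding e .
qed

lemma Joint_cost_phi:
  assumes \<gamma>: "\<gamma> \<in> Joint \<mu>0 \<mu>1"
  shows "enn2ereal (\<integral>\<^sup>+p. ennreal ((norm (fst p - snd p))\<^sup>2) \<partial>\<gamma>) + ereal \<epsilon> * ereal (LINT p|\<gamma>. \<phi> p)
    = ereal ((norm (m0 - m1))\<^sup>2 + t0 + t1 - \<epsilon> / 2 * suminf M + \<epsilon> * c0)"
  unfolding Joint_quadratic_cost(1)[OF \<gamma>] Joint_phi(2)[OF \<gamma>]
  using Joint_quadratic_cost(2)[OF \<gamma>] eps by (simp add: enn2ereal_ennreal field_simps)

theorem entropic_OT_value:
  defines "V \<equiv> ereal ((norm (m0 - m1))\<^sup>2 + t0 + t1 - \<epsilon> / 2 * suminf M + \<epsilon> * c0)"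
  shows "OT_eps \<epsilon> \<mu>0 \<mu>1 = V" and "OT_cost \<epsilon> \<mu>0 \<mu>1 \<pi> = V"
proof -
  have lower: "V \<le> OT_cost \<epsilon> \<mu>0 \<mu>1 \<gamma>" if \<gamma>: "\<gamma> \<in> Joint \<mu>0 \<mu>1" for \<gamma>
  proof -
    have "ereal (LINT p|\<gamma>. \<phi> p) \<le> KL \<gamma> (\<mu>0 \<Otimes>\<^sub>M \<mu>1)"
      by (rule KL_ge_integral) (use \<gamma> P.prob_space_axioms Joint_phi(1)[OF \<gamma>] in \<open>simp_all add: Joint_def exp_phi_integral\<close>)
    then have "ereal \<epsilon> * ereal (LINT p|\<gamma>. \<phi> p) \<le> ereal \<epsilon> * KL \<gamma> (\<mu>0 \<Otimes>\<^sub>M \<mu>1)"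
      using eps by (intro ereal_mult_left_mono) simp_all
    then show ?thesis
      unfolding V_def Joint_cost_phi[OF \<gamma>, symmetric] OT_cost_def by (rule add_left_mono)
  qed
  have "KL \<pi> (\<mu>0 \<Otimes>\<^sub>M \<mu>1) = ereal (LINT p|\<pi>. \<phi> p)"
    using Joint_phi(1)[OF pi_in_Joint] unfolding \<pi>_def
    by (intro KL_density_exp P.sigma_finite_measure_axioms phi_measurable)
  then show pi: "OT_cost \<epsilon> \<mu>0 \<mu>1 \<pi> = V"
    unfolding OT_cost_def V_def Joint_cost_phi[OF pi_in_Joint, symmetric] by simp
  show "OT_eps \<epsilon> \<mu>0 \<mu>1 = V"
    unfolding OT_eps_def
  proof (rule antisym)
    show "(INF \<gamma>\<in>Joint \<mu>0 \<mu>1. OT_cost \<epsilon> \<mu>0 \<mu>1 \<gamma>) \<le> V"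
      using INF_lower[OF pi_in_Joint, of "OT_cost \<epsilon> \<mu>0 \<mu>1"] unfolding pi .
    show "V \<le> (INF \<gamma>\<in>Joint \<mu>0 \<mu>1. OT_cost \<epsilon> \<mu>0 \<mu>1 \<gamma>)" by (rule INF_greatest) (rule lower)
  qed
qed

end

end

theorem mainTheorem4:
  fixes \<mu>0 \<mu>1 :: "'a::{real_inner,polish_space} measure"
    and m0 m1 :: 'a and C0 C1 :: "'a \<Rightarrow>\<^sub>L 'a" and \<epsilon> :: real
  assumes "trace_class_pos C0" and "trace_class_pos C1"
    and "gaussian_measure \<mu>0 m0 C0" and "gaussian_measure \<mu>1 m1 C1"
    and "\<epsilon> > 0"
  shows "OT_eps \<epsilon> \<mu>0 \<mu>1 = ereal ((norm (m0 - m1))\<^sup>2 + op_trace C0 + op_trace C1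
            - \<epsilon> / 2 * op_trace (M_eps \<epsilon> C0 C1)
            + \<epsilon> / 2 * ln (fredholm_det (id_blinfun + (1/2) *\<^sub>R M_eps \<epsilon> C0 C1)))
    \<and> (\<exists>\<gamma>\<in>Joint \<mu>0 \<mu>1. OT_cost \<epsilon> \<mu>0 \<mu>1 \<gamma> = OT_eps \<epsilon> \<mu>0 \<mu>1)"
proof -
  have pos: "positive_op C0" "positive_op C1" using assms(1,2) by (simp_all add: trace_class_pos_def)
  obtain B0 where t0: "hilbert_basis B0" "((\<lambda>e. inner (C0 e) e) has_sum op_trace C0) B0"
    by (rule trace_class_pos_op_trace[OF assms(1)])
  obtain B1 where t1: "hilbert_basis B1" "((\<lambda>e. inner (C1 e) e) has_sum op_trace C1) B1"
    by (rule trace_class_pos_op_trace[OF assms(2)])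
  obtain S B T s a b where c: "positive_op S" "S o\<^sub>L S = C0" "hilbert_basis B"
    "((\<lambda>e. inner (C1 (S e)) (S e)) has_sum T) B" "(\<lambda>k. (s k)\<^sup>2) sums T"
    "\<And>k. C0 (a k) = s k *\<^sub>R b k"
    "\<And>k l. inner (C0 (a k)) (a l) = (if k = l \<and> s k \<noteq> 0 then 1 else 0)"
    "\<And>k l. inner (C1 (b k)) (b l) = (if k = l \<and> s k \<noteq> 0 then 1 else 0)"
    and Ms: "(\<lambda>k::nat. entropic_rate \<epsilon> ((s k)\<^sup>2)) sums op_trace (M_eps \<epsilon> C0 C1)"
    and lns: "(\<lambda>k. ln (1 + entropic_rate \<epsilon> ((s k)\<^sup>2) / 2))
       sums ln (fredholm_det (id_blinfun + (1/2) *\<^sub>R M_eps \<epsilon> C0 C1))"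
    by (fact canonical_pairs[OF assms(1) pos(2)])
  interpret X: gaussian \<mu>0 m0 C0
    using assms(3) pos by (simp add: gaussian_def gaussian_axioms_def gaussian_measure_def)
  interpret Y: gaussian \<mu>1 m1 C1
    using assms(4) pos by (simp add: gaussian_def gaussian_axioms_def gaussian_measure_def)
  interpret entropic_coupling \<mu>0 m0 C0 \<mu>1 m1 C1 \<epsilon> S B T s a b
    by unfold_locales (fact assms(5) c)+
  have "suminf M = op_trace (M_eps \<epsilon> C0 C1)" using Ms by (simp add: M_def[abs_def] sums_iff)
  \<comment> \<open>The factor 1/2 stems from the square root in the normalising constant of the
    Mehler kernel; it becomes the \<epsilon> / 2 in front of the logarithm.\<close>
  moreover have "c0 = ln (fredholm_det (id_blinfun + (1/2) *\<^sub>R M_eps \<epsilon> C0 C1)) / 2"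
    using lns by (simp add: c0_def M_def sums_iff)
  ultimately show ?thesis
    using entropic_OT_value[OF t0 t1] pi_in_Joint by auto
qed

end
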